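(* Let $\Lambda\subset J^1M$ be a closed Legendrian submanifold of arbitrary dimension $n=\dim M$ with mild front singularities, equipped with a $\mathbb{Z}$-valued Maslov potential $\mu$ and a compatible simplicial decomposition $\mathcal{E}$ of $M$, and let $\mathbb{K}$ be a field. There is a bijection between augmentations from the simplicial DGA of $(\Lambda,\mu,\mathcal{E})$ to $\mathbb{K}$ and chain homotopy diagrams (CHDs) for $(\Lambda,\mu,\mathcal{E})$ over $\mathbb{K}$.
   Context: **Setting.** $J^1M=T^*M\times\mathbb{R}$ has local coordinates $(x,y,z)$; $\pi_{xz}:J^1M\to M\times\mathbb{R}$ and $\pi_x:J^1M\to M$ are the front and base projections. $\Lambda$ has mild front singularities if $\pi_{xz}|_\Lambda$ is an immersion outside a codimension 1 submanifold $\Lambda_{\mathit{cusp}}\subset\Lambda$ along which it has a standard cusp singularity (locally $(t_1,\dots,t_n)\mapsto(t_1^3,t_1^2,t_2,\dots,t_n)$, $\Lambda_{\mathit{cusp}}=\{t_1=0\}$). A Maslov potential is a locally constant $\mu:\Lambda\setminus\Lambda_{\mathit{cusp}}\to\mathbb{Z}$ increasing by 1 when passing through $\Lambda_{\mathit{cusp}}$ from the lower to the upper sheet of the cusp edge. $\mathcal{E}=\{e_I\}$ has open simplices as cells, $I=(i_0<\dots<i_m)$ listing the vertices of $\overline{e_I}$, vertices totally ordered; $e_I\le e_J$ iff $e_I\subset\overline{e_J}$. Compatibility means: (P1) for each $e_I$, the components of $\Lambda\cap\pi_x^{-1}(e_I)$ project homeomorphically to $e_I$ and each is contained in $\Lambda\setminus\Lambda_{\mathit{cusp}}$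 (these are the sheets above $e_I$, forming the set $\Lambda(e_I)$) or in $\Lambda_{\mathit{cusp}}$ (cusp components); a sheet $S$ is the graph of a function $z(S)$ on $e_I$ in the front; (P2) for $S,S'\in\Lambda(e_I)$, $z(S)>z(S')$, $z(S)<z(S')$ or $z(S)=z(S')$ on all of $e_I$; (P3) if $e_J\le e_I$ each sheet of $\Lambda(e_J)$ lies in the closure (in $\Lambda$) of a unique sheet of $\Lambda(e_I)$ and the remaining sheets of $\Lambda(e_I)$ meet in pairs at cusp components above $e_J$. (For $n=2$ compatibility is defined by a skeleton condition which implies (P1)–(P3).) **Simplicial DGA.** Order $\Lambda(e_I)=\{S_1,\dots,S_{N_I}\}$ with $z(S_{i-1})\ge z(S_i)$. $\mathcal{A}$ is the free unital associative $\mathbb{Z}$-algebra on $m^I_{i,j}$ for all $I,i,j$ with $z(S_i)>z(S_j)$, $|m^I_{i,j}|=\mu(S_i)-\mu(S_j)+\dim e_I-1$. $M(e_I)$ is the matrix $(m^I_{i,j})$ (0 where no generator exists). For $e_J\le e_I$, $M_I(e_J)$ is the $N_I\times N_I$ matrix with $m^J_{i,j}$ in position $(i',j')$ where $S^J_i\subset\overline{S^I_{i'}}$, $S^J_j\subset\overline{S^I_{j'}}$; if $\dim e_J=0$, also with $1$ in position $(k,l)$, $k<l$, when $S^I_k,S^I_l$ meet at a cusp above $e_J$; other entries $0$. With $\Theta_I=\mathrm{diag}((-1)^{\mu(S_1)},\dots,(-1)^{\mu(S_{N_I})})$, $\partial$ is the degree $-1$ derivation with, for $I=(i_0,\dots,i_m)$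 (first sum absent when $m=0$), $$\partial M(e_I)=\Theta_I\Big(-\sum_{k=0}^m(-1)^kM_I(e_{i_0\cdots\widehat{i_k}\cdots i_m})+\sum_{k=0}^m(-1)^kM_I(e_{i_0\cdots i_k})M_I(e_{i_k\cdots i_m})\Big).$$ An augmentation to $\mathbb{K}$ is a unital DGA homomorphism $\epsilon:(\mathcal{A},\partial)\to(\mathbb{K},0)$, $\mathbb{K}$ concentrated in degree $0$. **CHDs.** $V(e_I)=\mathrm{Span}_{\mathbb{K}}\Lambda(e_I)$ with grading $|S|=-\mu(S)$. Put $S\prec S'$ iff $z(S)>z(S')$; a linear map $c:V(e_I)\to V(e_I)$ is strictly lower triangular if $c(S)\in\mathrm{Span}\{S':S\prec S'\}$ for all $S\in\Lambda(e_I)$. For $e_I\le e_J$, $V(e_J)=V(e_I)\oplus V^{I,J}_{\mathit{cusp}}$, where a sheet in $\Lambda(e_I)$ is identified with the sheet of $\Lambda(e_J)$ whose closure contains it and $V^{I,J}_{\mathit{cusp}}$ is spanned by the sheets of $\Lambda(e_J)$ meeting in pairs at cusps above $e_I$. The boundary extension $c_J(e_I):V(e_J)\to V(e_J)$ of $c(e_I):V(e_I)\to V(e_I)$ equals $c(e_I)$ on $V(e_I)$, and on $V^{I,J}_{\mathit{cusp}}$ equals $d_0$ if $\dim e_I=0$ (with $d_0S_a=S_b$, $d_0S_b=0$ for upper/lower sheets $S_a,S_b$ meeting at a cusp), $\mathit{id}$ if $\dim e_I=1$, and $0$ if $\dim e_I\ge2$. A simplex diagram $(\Delta,V,\{a_F\})$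 consists of a simplex $\Delta$ with ordered vertices, a graded $\mathbb{K}$-module $V$, and for each face $F=[i_0,\dots,i_m]$ a linear map $a_F=a_{i_0\dots i_m}:V\to V$ of degree $1-m$ with $\sum_{0<k<m}(-1)^{k+1}a_{i_0\ldots\widehat{i_k}\ldots i_m}+\sum_{0\le k\le m}(-1)^ka_{i_k\ldots i_m}\circ a_{i_0\ldots i_k}=0$. A CHD for $(\Lambda,\mu,\mathcal{E})$ is a collection of linear maps $c(e_I):V(e_I)\to V(e_I)$, $e_I\in\mathcal{E}$, such that: $c(e_I)$ has degree $1-\dim e_I$; $c(e_I)$ is strictly lower triangular if $\dim e_I\ne1$ and $c(e_I)-\mathit{id}$ is strictly lower triangular if $\dim e_I=1$; and for each $e_I$, $(\overline{e_I},V(e_I),\{c_I(e_F)\}_{F\subset I})$ is a simplex diagram. *)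

theory Defs
  imports "HOL-Analysis.Analysis" "HOL-Library.Poly_Mapping"
begin

section \<open>Smooth maps and smooth manifolds\<close>

primrec Ck_on :: "nat \<Rightarrow> 'a::real_normed_vector set \<Rightarrow> ('a \<Rightarrow> 'b::real_normed_vector) \<Rightarrow> bool" where
  "Ck_on 0 S f \<longleftrightarrow> continuous_on S f"
| "Ck_on (Suc k) S f \<longleftrightarrow> (\<forall>x\<in>S. f differentiable (at x)) \<and>
      (\<forall>v. Ck_on k S (\<lambda>x. frechet_derivative f (at x) v))"

text \<open>Only used for open \<open>S\<close> in finite-dimensional spaces.\<close>

definition smooth_on :: "'a::real_normed_vector set \<Rightarrow> ('a \<Rightarrow> 'b::real_normed_vector) \<Rightarrow> bool" where
  "smooth_on S f \<longleftrightarrow> (\<forall>k. Ck_on k S f)"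

definition diffeo_on :: "'a::real_normed_vector set \<Rightarrow> ('a \<Rightarrow> 'b::real_normed_vector) \<Rightarrow> bool" where
  "diffeo_on U f \<longleftrightarrow> open U \<and> open (f ` U) \<and> inj_on f U \<and>
     smooth_on U f \<and> smooth_on (f ` U) (inv_into U f)"

text \<open>A chart is a domain together with a coordinate map; the values of the coordinate map outside
  the domain are irrelevant.\<close>

type_synonym ('m, 'n) chart = "'m set \<times> ('m \<Rightarrow> real ^ 'n)"

definition is_chart :: "'m topology \<Rightarrow> ('m, 'n::finite) chart \<Rightarrow> bool" where
  "is_chart M c \<longleftrightarrow> openin M (fst c) \<and> open (snd c ` fst c) \<and>
     homeomorphic_map (subtopology M (fst c)) (top_of_set (snd c ` fst c)) (snd c)"

definition transition :: "('m, 'n::finite) chart \<Rightarrow> ('m, 'n) chart \<Rightarrow> real ^ 'n \<Rightarrow> real ^ 'n" where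
  "transition c d = snd d \<circ> inv_into (fst c) (snd c)"

definition smooth_manifold :: "'m topology \<Rightarrow> ('m, 'n::finite) chart set \<Rightarrow> bool" where
  "smooth_manifold M A \<longleftrightarrow> Hausdorff_space M \<and> second_countable M \<and>
     (\<forall>c\<in>A. is_chart M c) \<and> topspace M = (\<Union>c\<in>A. fst c) \<and>
     (\<forall>c\<in>A. \<forall>d\<in>A. smooth_on (snd c ` (fst c \<inter> fst d)) (transition c d))"


section \<open>The 1-jet space\<close>

text \<open>A point of \<open>J\<^sup>1M = T\<^sup>*M \<times> \<real>\<close> is a triple \<open>(x, \<eta>, z)\<close>.  A cotangent vector at \<open>x\<close> is given
  by its components in all charts of the atlas around \<open>x\<close>, subject to the covariant
  transformation law; components in charts not containing \<open>x\<close> are normalised to \<open>0\<close>.\<close>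

type_synonym ('m, 'n) jet = "'m \<times> (('m, 'n) chart \<Rightarrow> real ^ 'n) \<times> real"

definition cotangent_space ::
    "('m, 'n::finite) chart set \<Rightarrow> 'm \<Rightarrow> (('m, 'n) chart \<Rightarrow> real ^ 'n) set" where
  "cotangent_space A x = {\<eta>.
     (\<forall>c. c \<notin> A \<or> x \<notin> fst c \<longrightarrow> \<eta> c = 0) \<and>
     (\<forall>c\<in>A. \<forall>d\<in>A. x \<in> fst c \<and> x \<in> fst d \<longrightarrow>
        (\<forall>v. \<eta> c \<bullet> v = \<eta> d \<bullet> frechet_derivative (transition c d) (at (snd c x)) v))}"

definition jet_space :: "'m topology \<Rightarrow> ('m, 'n::finite) chart set \<Rightarrow> ('m, 'n) jet set" where
  "jet_space M A = {(x, \<eta>, z). x \<in> topspace M \<and> \<eta> \<in> cotangent_space A x}"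

abbreviation base_proj :: "('m, 'n) jet \<Rightarrow> 'm" where
  "base_proj p \<equiv> fst p"

abbreviation zcoord :: "('m, 'n) jet \<Rightarrow> real" where
  "zcoord p \<equiv> snd (snd p)"

text \<open>The local coordinates \<open>(x, y, z)\<close> on \<open>J\<^sup>1M\<close> induced by a chart of \<open>M\<close>, and the local
  coordinates \<open>(x, z)\<close> of the front projection.\<close>

definition jet_coords :: "('m, 'n::finite) chart \<Rightarrow> ('m, 'n) jet \<Rightarrow> (real ^ 'n) \<times> (real ^ 'n) \<times> real" where
  "jet_coords c p = (snd c (base_proj p), fst (snd p) c, zcoord p)"

definition front_coords :: "('m, 'n::finite) chart \<Rightarrow> ('m, 'n) jet \<Rightarrow> (real ^ 'n) \<times> real" where
  "front_coords c p = (snd c (base_proj p), zcoord p)"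

definition jet_topology :: "'m topology \<Rightarrow> ('m, 'n::finite) chart set \<Rightarrow> ('m, 'n) jet topology" where
  "jet_topology M A = topology_generated_by
     {{p \<in> jet_space M A. base_proj p \<in> fst c \<and> jet_coords c p \<in> B} | c B. c \<in> A \<and> open B}"


section \<open>Closed Legendrian submanifolds with mild front singularities\<close>

text \<open>A smooth local parametrisation of a subset \<open>\<Lambda>\<close> of \<open>J\<^sup>1M\<close> by an open subset \<open>W\<close> of \<open>\<real>\<^sup>n\<close>,
  \<open>n = dim M\<close>.\<close>

definition local_param :: "'m topology \<Rightarrow> ('m, 'n::finite) chart set \<Rightarrow> ('m, 'n) jet set \<Rightarrow>
    (real ^ 'n) set \<Rightarrow> (real ^ 'n \<Rightarrow> ('m, 'n) jet) \<Rightarrow> bool" where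
  "local_param M A \<Lambda> W \<psi> \<longleftrightarrow> open W \<and>
     openin (subtopology (jet_topology M A) \<Lambda>) (\<psi> ` W) \<and>
     homeomorphic_map (top_of_set W) (subtopology (jet_topology M A) (\<psi> ` W)) \<psi> \<and>
     (\<forall>c\<in>A. smooth_on {t \<in> W. base_proj (\<psi> t) \<in> fst c} (jet_coords c \<circ> \<psi>) \<and>
        (\<forall>t\<in>W. base_proj (\<psi> t) \<in> fst c \<longrightarrow>
           inj (frechet_derivative (jet_coords c \<circ> \<psi>) (at t))))"

definition closed_submanifold ::
    "'m topology \<Rightarrow> ('m, 'n::finite) chart set \<Rightarrow> ('m, 'n) jet set \<Rightarrow> bool" where
  "closed_submanifold M A \<Lambda> \<longleftrightarrow> compactin (jet_topology M A) \<Lambda> \<and>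
     (\<forall>p\<in>\<Lambda>. \<exists>W \<psi>. local_param M A \<Lambda> W \<psi> \<and> p \<in> \<psi> ` W)"

text \<open>The contact form \<open>dz - y dx\<close> vanishes on \<open>\<Lambda>\<close>.\<close>

definition closed_legendrian ::
    "'m topology \<Rightarrow> ('m, 'n::finite) chart set \<Rightarrow> ('m, 'n) jet set \<Rightarrow> bool" where
  "closed_legendrian M A \<Lambda> \<longleftrightarrow> closed_submanifold M A \<Lambda> \<and>
     (\<forall>W \<psi>. local_param M A \<Lambda> W \<psi> \<longrightarrow>
        (\<forall>c\<in>A. \<forall>t\<in>W. base_proj (\<psi> t) \<in> fst c \<longrightarrow>
          (\<forall>v. case frechet_derivative (jet_coords c \<circ> \<psi>) (at t) v of
                 (dx, dy, dz) \<Rightarrow> dz = fst (snd (\<psi> t)) c \<bullet> dx)))"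

definition front_immersed_at :: "'m topology \<Rightarrow> ('m, 'n::finite) chart set \<Rightarrow> ('m, 'n) jet set \<Rightarrow>
    ('m, 'n) jet \<Rightarrow> bool" where
  "front_immersed_at M A \<Lambda> p \<longleftrightarrow>
     (\<forall>W \<psi>. \<forall>t\<in>W. \<forall>c\<in>A. local_param M A \<Lambda> W \<psi> \<and> \<psi> t = p \<and> base_proj p \<in> fst c \<longrightarrow>
        inj (frechet_derivative (front_coords c \<circ> \<psi>) (at t)))"

definition standard_cusp :: "'n::finite \<Rightarrow> real ^ 'n \<Rightarrow> real \<times> (real ^ 'n)" where
  "standard_cusp i t = ((t $ i) ^ 3, \<chi> j. if j = i then (t $ i) ^ 2 else t $ j)"

text \<open>Up to local diffeomorphisms of \<open>\<Lambda>\<close> (the parametrisation \<open>\<psi>\<close>) and of \<open>M \<times> \<real>\<close> (the map \<open>G\<close>,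
  written in a chart of \<open>M\<close>), the front projection near \<open>p\<close> is the standard cusp and the cusp
  locus is the hyperplane where the distinguished coordinate (with index \<open>i\<close>) vanishes.\<close>

definition front_cusp_at :: "'m topology \<Rightarrow> ('m, 'n::finite) chart set \<Rightarrow> ('m, 'n) jet set \<Rightarrow>
    ('m, 'n) jet set \<Rightarrow> ('m, 'n) jet \<Rightarrow> bool" where
  "front_cusp_at M A \<Lambda> C p \<longleftrightarrow>
     (\<exists>i W \<psi> c Q G. local_param M A \<Lambda> W \<psi> \<and> 0 \<in> W \<and> \<psi> 0 = p \<and> c \<in> A \<and>
        base_proj ` \<psi> ` W \<subseteq> fst c \<and> diffeo_on Q G \<and>
        G ` Q \<subseteq> (snd c ` fst c) \<times> UNIV \<and>
        (\<forall>t\<in>W. standard_cusp i t \<in> Q \<and> front_coords c (\<psi> t) = G (standard_cusp i t)) \<and>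
        (\<forall>t\<in>W. \<psi> t \<in> C \<longleftrightarrow> t $ i = 0))"

text \<open>The condition at the points of \<open>C\<close> includes that the cusp locus \<open>C\<close> is a submanifold of
  codimension 1 of \<open>\<Lambda>\<close>.\<close>

definition mild_front_singularities :: "'m topology \<Rightarrow> ('m, 'n::finite) chart set \<Rightarrow>
    ('m, 'n) jet set \<Rightarrow> ('m, 'n) jet set \<Rightarrow> bool" where
  "mild_front_singularities M A \<Lambda> C \<longleftrightarrow> C \<subseteq> \<Lambda> \<and>
     (\<forall>p\<in>\<Lambda> - C. front_immersed_at M A \<Lambda> p) \<and>
     (\<forall>p\<in>C. front_cusp_at M A \<Lambda> C p)"

text \<open>Near a cusp point, two distinct non-cusp points of \<open>\<Lambda>\<close> over the same base point lie on the
  upper and lower sheet of the cusp edge, according to their \<open>z\<close>-coordinates.\<close>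

definition maslov_potential :: "'m topology \<Rightarrow> ('m, 'n::finite) chart set \<Rightarrow> ('m, 'n) jet set \<Rightarrow>
    ('m, 'n) jet set \<Rightarrow> (('m, 'n) jet \<Rightarrow> int) \<Rightarrow> bool" where
  "maslov_potential M A \<Lambda> C \<mu> \<longleftrightarrow>
     continuous_map (subtopology (jet_topology M A) (\<Lambda> - C)) (discrete_topology UNIV) \<mu> \<and>
     (\<forall>q\<in>C. \<exists>U. openin (subtopology (jet_topology M A) \<Lambda>) U \<and> q \<in> U \<and>
        (\<forall>p\<in>U - C. \<forall>p'\<in>U - C. base_proj p = base_proj p' \<and> zcoord p > zcoord p' \<longrightarrow>
           \<mu> p = \<mu> p' + 1))"


section \<open>Simplicial decompositions\<close>

definition simplicial_complex :: "'v set set \<Rightarrow> bool" where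
  "simplicial_complex K \<longleftrightarrow> (\<forall>I\<in>K. finite I \<and> I \<noteq> {}) \<and>
     (\<forall>I\<in>K. \<forall>J. J \<subseteq> I \<and> J \<noteq> {} \<longrightarrow> J \<in> K)"

text \<open>Barycentric coordinates.\<close>

definition closed_simplex :: "'v set \<Rightarrow> ('v \<Rightarrow> real) set" where
  "closed_simplex I = {t. (\<forall>v. 0 \<le> t v) \<and> (\<forall>v. v \<notin> I \<longrightarrow> t v = 0) \<and> sum t I = 1}"

definition open_simplex :: "'v set \<Rightarrow> ('v \<Rightarrow> real) set" where
  "open_simplex I = {t \<in> closed_simplex I. \<forall>v\<in>I. 0 < t v}"

text \<open>The geometric realisation with its weak topology.\<close>

definition realization :: "'v set set \<Rightarrow> ('v \<Rightarrow> real) topology" where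
  "realization K = topology (\<lambda>T. T \<subseteq> (\<Union>I\<in>K. closed_simplex I) \<and>
     (\<forall>I\<in>K. openin (top_of_set (closed_simplex I)) (T \<inter> closed_simplex I)))"

lemma openin_realization:
  "openin (realization K) T \<longleftrightarrow> T \<subseteq> (\<Union>I\<in>K. closed_simplex I) \<and>
     (\<forall>I\<in>K. openin (top_of_set (closed_simplex I)) (T \<inter> closed_simplex I))"
proof -
  have "istopology (\<lambda>T. T \<subseteq> (\<Union>I\<in>K. closed_simplex I) \<and>
     (\<forall>I\<in>K. openin (top_of_set (closed_simplex I)) (T \<inter> closed_simplex I)))"
    (is "istopology ?P")
    unfolding istopology_def
  proof (intro conjI allI impI)
    fix S T assume "?P S" "?P T"
    moreover have "S \<inter> T \<inter> X = (S \<inter> X) \<inter> (T \<inter> X)" for X by blast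
    ultimately show "S \<inter> T \<subseteq> (\<Union>I\<in>K. closed_simplex I)"
      and "\<forall>I\<in>K. openin (top_of_set (closed_simplex I)) (S \<inter> T \<inter> closed_simplex I)"
      by (blast, simp add: openin_Int)
  next
    fix F assume F: "\<forall>S\<in>F. ?P S"
    then show "\<Union>F \<subseteq> (\<Union>I\<in>K. closed_simplex I)" by blast
    have "\<Union>F \<inter> X = (\<Union>S\<in>F. S \<inter> X)" for X by blast
    then show "\<forall>I\<in>K. openin (top_of_set (closed_simplex I)) (\<Union>F \<inter> closed_simplex I)"
      using F by (metis (no_types, lifting) imageE openin_Union)
  qed
  then show ?thesis by (simp add: realization_def topology_inverse')
qed

definition simplicial_decomposition ::
    "'m topology \<Rightarrow> 'v set set \<Rightarrow> (('v \<Rightarrow> real) \<Rightarrow> 'm) \<Rightarrow> bool" where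
  "simplicial_decomposition M K h \<longleftrightarrow>
     simplicial_complex K \<and> homeomorphic_map (realization K) M h"

definition cell :: "(('v \<Rightarrow> real) \<Rightarrow> 'm) \<Rightarrow> 'v set \<Rightarrow> 'm set" where
  "cell h I = h ` open_simplex I"

definition cell_dim :: "'v set \<Rightarrow> nat" where
  "cell_dim I = card I - 1"

text \<open>For \<open>I = {i\<^sub>0 < \<dots> < i\<^sub>m}\<close>: the faces \<open>i\<^sub>0\<dots>\<close> with \<open>i\<^sub>k\<close> omitted, \<open>i\<^sub>0\<dots>i\<^sub>k\<close> and \<open>i\<^sub>k\<dots>i\<^sub>m\<close>.\<close>

definition omit_face :: "'v::linorder set \<Rightarrow> nat \<Rightarrow> 'v set" where
  "omit_face I k = I - {sorted_list_of_set I ! k}"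

definition front_face :: "'v::linorder set \<Rightarrow> nat \<Rightarrow> 'v set" where
  "front_face I k = set (take (Suc k) (sorted_list_of_set I))"

definition back_face :: "'v::linorder set \<Rightarrow> nat \<Rightarrow> 'v set" where
  "back_face I k = set (drop k (sorted_list_of_set I))"


section \<open>Free algebras and derivations\<close>

datatype 'g word = Word (letters: "'g list")

instantiation word :: (type) monoid_add
begin
definition zero_word :: "'a word" where "zero_word = Word []"
definition plus_word :: "'a word \<Rightarrow> 'a word \<Rightarrow> 'a word" where
  "plus_word u w = Word (letters u @ letters w)"
instance by standard (simp_all add: zero_word_def plus_word_def)
end

text \<open>Finitely supported integer functions on words with the convolution product form the free unital
  associative \<open>\<int>\<close>-algebra on the type of letters; the subset below is the subalgebra generated by \<open>G\<close>.\<close>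

type_synonym 'g free_alg = "'g word \<Rightarrow>\<^sub>0 int"

definition monomial :: "'g list \<Rightarrow> 'g free_alg" where
  "monomial w = Poly_Mapping.single (Word w) 1"

definition free_algebra :: "'g set \<Rightarrow> 'g free_alg set" where
  "free_algebra G = {a. \<forall>w\<in>Poly_Mapping.keys a. set (letters w) \<subseteq> G}"

definition word_deg :: "('g \<Rightarrow> int) \<Rightarrow> 'g list \<Rightarrow> int" where
  "word_deg deg w = (\<Sum>g\<leftarrow>w. deg g)"

definition homogeneous :: "('g \<Rightarrow> int) \<Rightarrow> int \<Rightarrow> 'g free_alg \<Rightarrow> bool" where
  "homogeneous deg d a \<longleftrightarrow> (\<forall>w\<in>Poly_Mapping.keys a. word_deg deg (letters w) = d)"

definition parity_sign :: "int \<Rightarrow> 'a::ring_1" where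
  "parity_sign d = (if even d then 1 else - 1)"

primrec derive_word :: "('g \<Rightarrow> int) \<Rightarrow> ('g \<Rightarrow> 'g free_alg) \<Rightarrow> 'g list \<Rightarrow> 'g free_alg" where
  "derive_word deg \<delta> [] = 0"
| "derive_word deg \<delta> (g # w) =
     \<delta> g * monomial w + parity_sign (deg g) * monomial [g] * derive_word deg \<delta> w"

definition derivation :: "('g \<Rightarrow> int) \<Rightarrow> ('g \<Rightarrow> 'g free_alg) \<Rightarrow> 'g free_alg \<Rightarrow> 'g free_alg" where
  "derivation deg \<delta> a = (\<Sum>w\<in>Poly_Mapping.keys a.
     of_int (Poly_Mapping.lookup a w) * derive_word deg \<delta> (letters w))"

text \<open>The next lemmas show that this is the (graded) derivation extending \<open>\<delta>\<close>.\<close>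

lemma monomial_append: "monomial (u @ w) = monomial u * monomial w"
  by (simp add: monomial_def mult_single plus_word_def)

lemma monomial_Nil [simp]: "monomial [] = 1"
  by (simp add: monomial_def flip: zero_word_def)

lemma parity_sign_add: "parity_sign (c + d) = (parity_sign c * parity_sign d :: 'a::ring_1)"
  by (simp add: parity_sign_def)

lemma parity_sign_commute: "parity_sign d * a = (a * parity_sign d :: 'a::ring_1)"
  by (simp add: parity_sign_def)

lemma derivation_monomial: "derivation deg \<delta> (monomial w) = derive_word deg \<delta> w"
  by (simp add: derivation_def monomial_def)

lemma derivation_generator: "derivation deg \<delta> (monomial [g]) = \<delta> g"
  by (simp add: derivation_monomial)

lemma derivation_superset:
  assumes "finite F" "Poly_Mapping.keys a \<subseteq> F"
  shows "derivation deg \<delta> a =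
    (\<Sum>w\<in>F. of_int (Poly_Mapping.lookup a w) * derive_word deg \<delta> (letters w))"
  unfolding derivation_def using assms
  by (intro sum.mono_neutral_left) (auto simp: in_keys_iff)

lemma derivation_add: "derivation deg \<delta> (a + b) = derivation deg \<delta> a + derivation deg \<delta> b"
proof -
  let ?F = "Poly_Mapping.keys a \<union> Poly_Mapping.keys b"
  have "finite ?F" "Poly_Mapping.keys (a + b) \<subseteq> ?F"
    by (simp_all add: Poly_Mapping.keys_add)
  then show ?thesis
    by (simp add: derivation_superset[of ?F] lookup_add distrib_right sum.distrib)
qed

lemma derivation_monomial_mult:
  "derivation deg \<delta> (monomial u * monomial w) =
     derivation deg \<delta> (monomial u) * monomial w +
     parity_sign (word_deg deg u) * monomial u * derivation deg \<delta> (monomial w)"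
proof -
  have "derive_word deg \<delta> (u @ w) = derive_word deg \<delta> u * monomial w +
      parity_sign (word_deg deg u) * monomial u * derive_word deg \<delta> w"
  proof (induction u)
    case Nil
    then show ?case by (simp add: word_deg_def parity_sign_def)
  next
    case (Cons g u)
    have "monomial (g # u) = monomial [g] * monomial u"
      using monomial_append[of "[g]" u] by simp
    moreover have "word_deg deg (g # u) = deg g + word_deg deg u"
      by (simp add: word_deg_def)
    ultimately show ?case
      using Cons by (simp add: parity_sign_add parity_sign_def monomial_append algebra_simps)
  qed
  then show ?thesis
    by (simp add: derivation_monomial flip: monomial_append)
qed


section \<open>Free vector spaces and simplex diagrams\<close>

text \<open>\<open>Span\<^sub>\<bbbK> B\<close> for a finite set \<open>B\<close> of basis elements is realised as the set of functions
  supported in \<open>B\<close>.\<close>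

definition span_space :: "'s set \<Rightarrow> ('s \<Rightarrow> 'k::field) set" where
  "span_space B = {v. \<forall>s. s \<notin> B \<longrightarrow> v s = 0}"

definition basis_vec :: "'s \<Rightarrow> 's \<Rightarrow> 'k::field" where
  "basis_vec s = (\<lambda>t. if t = s then 1 else 0)"

definition graded_part :: "('s \<Rightarrow> 'k::field) set \<Rightarrow> ('s \<Rightarrow> int) \<Rightarrow> int \<Rightarrow> ('s \<Rightarrow> 'k) set" where
  "graded_part V gr d = {v \<in> V. \<forall>s. v s \<noteq> 0 \<longrightarrow> gr s = d}"

definition linear_endo :: "('s \<Rightarrow> 'k::field) set \<Rightarrow> (('s \<Rightarrow> 'k) \<Rightarrow> ('s \<Rightarrow> 'k)) \<Rightarrow> bool" where
  "linear_endo V f \<longleftrightarrow> (\<forall>v\<in>V. f v \<in> V) \<and>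
     (\<forall>u\<in>V. \<forall>v\<in>V. f (\<lambda>s. u s + v s) = (\<lambda>s. f u s + f v s)) \<and>
     (\<forall>r. \<forall>v\<in>V. f (\<lambda>s. r * v s) = (\<lambda>s. r * f v s))"

definition has_degree ::
    "('s \<Rightarrow> 'k::field) set \<Rightarrow> ('s \<Rightarrow> int) \<Rightarrow> int \<Rightarrow> (('s \<Rightarrow> 'k) \<Rightarrow> ('s \<Rightarrow> 'k)) \<Rightarrow> bool" where
  "has_degree V gr r f \<longleftrightarrow> (\<forall>d. f ` graded_part V gr d \<subseteq> graded_part V gr (d + r))"

definition simplex_diagram :: "'v::linorder set \<Rightarrow> ('s \<Rightarrow> 'k::field) set \<Rightarrow> ('s \<Rightarrow> int) \<Rightarrow>
    ('v set \<Rightarrow> ('s \<Rightarrow> 'k) \<Rightarrow> ('s \<Rightarrow> 'k)) \<Rightarrow> bool" where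
  "simplex_diagram \<Delta> V gr a \<longleftrightarrow> (\<forall>F. F \<subseteq> \<Delta> \<and> F \<noteq> {} \<longrightarrow>
     linear_endo V (a F) \<and> has_degree V gr (1 - int (cell_dim F)) (a F) \<and>
     (\<forall>v\<in>V. \<forall>s.
        (\<Sum>k\<in>{0<..<cell_dim F}. (- 1) ^ (k + 1) * a (omit_face F k) v s) +
        (\<Sum>k\<le>cell_dim F. (- 1) ^ k * a (back_face F k) (a (front_face F k) v) s) = 0))"


section \<open>Sheets, the simplicial DGA and chain homotopy diagrams\<close>

locale sheet_data =
  fixes M :: "'m topology"
    and A :: "('m, 'n::finite) chart set"
    and \<Lambda> :: "('m, 'n) jet set"
    and C :: "('m, 'n) jet set"
    and \<mu> :: "('m, 'n) jet \<Rightarrow> int"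
    and K :: "'v::linorder set set"
    and h :: "('v \<Rightarrow> real) \<Rightarrow> 'm"
begin

abbreviation L :: "('m, 'n) jet topology" where
  "L \<equiv> subtopology (jet_topology M A) \<Lambda>"

abbreviation e :: "'v set \<Rightarrow> 'm set" where
  "e \<equiv> cell h"

definition cell_le :: "'v set \<Rightarrow> 'v set \<Rightarrow> bool" where
  "cell_le J I \<longleftrightarrow> e J \<subseteq> M closure_of (e I)"

definition components_above :: "'v set \<Rightarrow> ('m, 'n) jet set set" where
  "components_above I =
     connected_components_of (subtopology L {p \<in> \<Lambda>. base_proj p \<in> e I})"

definition sheets :: "'v set \<Rightarrow> ('m, 'n) jet set set" where
  "sheets I = {S \<in> components_above I. S \<subseteq> \<Lambda> - C}"

definition cusp_components :: "'v set \<Rightarrow> ('m, 'n) jet set set" where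
  "cusp_components I = {D \<in> components_above I. D \<subseteq> C}"

definition sheet_z :: "('m, 'n) jet set \<Rightarrow> 'm \<Rightarrow> real" where
  "sheet_z S x = zcoord (the_inv_into S base_proj x)"

definition above :: "'v set \<Rightarrow> ('m, 'n) jet set \<Rightarrow> ('m, 'n) jet set \<Rightarrow> bool" where
  "above I S S' \<longleftrightarrow> (\<forall>x\<in>e I. sheet_z S x > sheet_z S' x)"

definition sheet_mu :: "('m, 'n) jet set \<Rightarrow> int" where
  "sheet_mu S = (THE k. \<forall>p\<in>S. \<mu> p = k)"

definition meet_at_cusp :: "'v set \<Rightarrow> ('m, 'n) jet set \<Rightarrow> ('m, 'n) jet set \<Rightarrow> bool" where
  "meet_at_cusp J S S' \<longleftrightarrow> S \<noteq> S' \<and>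
     (\<exists>D\<in>cusp_components J. D \<subseteq> L closure_of S \<and> D \<subseteq> L closure_of S')"

text \<open>For \<open>e\<^sub>J \<le> e\<^sub>I\<close>: sheets above \<open>e\<^sub>I\<close> whose closure contains no sheet above \<open>e\<^sub>J\<close>.\<close>

definition remaining_sheets :: "'v set \<Rightarrow> 'v set \<Rightarrow> ('m, 'n) jet set set" where
  "remaining_sheets J I = {S \<in> sheets I. \<not> (\<exists>T\<in>sheets J. T \<subseteq> L closure_of S)}"

definition P1 :: bool where
  "P1 \<longleftrightarrow> (\<forall>I\<in>K. \<forall>D\<in>components_above I.
     homeomorphic_map (subtopology L D) (subtopology M (e I)) base_proj \<and>
     (D \<subseteq> \<Lambda> - C \<or> D \<subseteq> C))"

definition P2 :: bool where
  "P2 \<longleftrightarrow> (\<forall>I\<in>K. \<forall>S\<in>sheets I. \<forall>S'\<in>sheets I.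
     (\<forall>x\<in>e I. sheet_z S x > sheet_z S' x) \<or> (\<forall>x\<in>e I. sheet_z S x < sheet_z S' x) \<or>
     (\<forall>x\<in>e I. sheet_z S x = sheet_z S' x))"

definition P3 :: bool where
  "P3 \<longleftrightarrow> (\<forall>I\<in>K. \<forall>J\<in>K. cell_le J I \<longrightarrow>
     (\<forall>T\<in>sheets J. \<exists>!S. S \<in> sheets I \<and> T \<subseteq> L closure_of S) \<and>
     (\<forall>S\<in>remaining_sheets J I. \<exists>!S'. S' \<in> remaining_sheets J I \<and> meet_at_cusp J S S'))"

definition compatible :: bool where
  "compatible \<longleftrightarrow> P1 \<and> P2 \<and> P3"

text \<open>For \<open>e\<^sub>J \<le> e\<^sub>I\<close>: \<open>extend_sheet J I T\<close> is the sheet above \<open>e\<^sub>I\<close> whose closure contains \<open>T\<close>, and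
  \<open>face_sheet J S\<close> is the sheet above \<open>e\<^sub>J\<close> contained in the closure of \<open>S\<close> (if there is one).\<close>

definition extend_sheet :: "'v set \<Rightarrow> 'v set \<Rightarrow> ('m, 'n) jet set \<Rightarrow> ('m, 'n) jet set" where
  "extend_sheet J I T = (THE S. S \<in> sheets I \<and> T \<subseteq> L closure_of S)"

definition face_sheet :: "'v set \<Rightarrow> ('m, 'n) jet set \<Rightarrow> ('m, 'n) jet set" where
  "face_sheet J S = (THE T. T \<in> sheets J \<and> T \<subseteq> L closure_of S)"


subsection \<open>The simplicial DGA\<close>

text \<open>The rows and columns of the matrices above \<open>e\<^sub>I\<close> are indexed by the sheets \<open>\<Lambda>(e\<^sub>I)\<close> themselves
  rather than by their positions in a list ordered by descending \<open>z\<close>.\<close>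

definition generators :: "('v set \<times> ('m, 'n) jet set \<times> ('m, 'n) jet set) set" where
  "generators = {(I, S, S'). I \<in> K \<and> S \<in> sheets I \<and> S' \<in> sheets I \<and> above I S S'}"

definition gen_deg :: "'v set \<times> ('m, 'n) jet set \<times> ('m, 'n) jet set \<Rightarrow> int" where
  "gen_deg = (\<lambda>(I, S, S'). sheet_mu S - sheet_mu S' + int (cell_dim I) - 1)"

definition cell_matrix :: "'v set \<Rightarrow> ('m, 'n) jet set \<Rightarrow> ('m, 'n) jet set \<Rightarrow>
    ('v set \<times> ('m, 'n) jet set \<times> ('m, 'n) jet set) free_alg" where
  "cell_matrix I S S' = (if (I, S, S') \<in> generators then monomial [(I, S, S')] else 0)"

text \<open>The matrix \<open>M\<^sub>I(e\<^sub>J)\<close>.\<close>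

definition bdry_matrix :: "'v set \<Rightarrow> 'v set \<Rightarrow> ('m, 'n) jet set \<Rightarrow> ('m, 'n) jet set \<Rightarrow>
    ('v set \<times> ('m, 'n) jet set \<times> ('m, 'n) jet set) free_alg" where
  "bdry_matrix I J S S' =
     (if S \<in> sheets I - remaining_sheets J I \<and> S' \<in> sheets I - remaining_sheets J I
      then cell_matrix J (face_sheet J S) (face_sheet J S')
      else if cell_dim J = 0 \<and> S \<in> sheets I \<and> S' \<in> sheets I \<and> meet_at_cusp J S S' \<and> above I S S'
      then 1 else 0)"

definition gen_diff :: "'v set \<times> ('m, 'n) jet set \<times> ('m, 'n) jet set \<Rightarrow>
    ('v set \<times> ('m, 'n) jet set \<times> ('m, 'n) jet set) free_alg" where
  "gen_diff = (\<lambda>(I, S, S'). parity_sign (sheet_mu S) *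
     (- (if cell_dim I = 0 then 0
         else (\<Sum>k\<le>cell_dim I. (- 1) ^ k * bdry_matrix I (omit_face I k) S S')) +
      (\<Sum>k\<le>cell_dim I. (- 1) ^ k *
         (\<Sum>R\<in>sheets I. bdry_matrix I (front_face I k) S R * bdry_matrix I (back_face I k) R S'))))"

definition differential ::
    "('v set \<times> ('m, 'n) jet set \<times> ('m, 'n) jet set) free_alg \<Rightarrow>
     ('v set \<times> ('m, 'n) jet set \<times> ('m, 'n) jet set) free_alg" where
  "differential = derivation gen_deg gen_diff"

text \<open>Maps are taken to be \<open>undefined\<close> outside their domains, so that they are determined by their
  values there.\<close>

definition augmentations ::
    "(('v set \<times> ('m, 'n) jet set \<times> ('m, 'n) jet set) free_alg \<Rightarrow> 'k::field) set" where
  "augmentations = {\<epsilon> \<in> extensional (free_algebra generators).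
     \<epsilon> 1 = 1 \<and>
     (\<forall>a\<in>free_algebra generators. \<forall>b\<in>free_algebra generators.
        \<epsilon> (a + b) = \<epsilon> a + \<epsilon> b \<and> \<epsilon> (a * b) = \<epsilon> a * \<epsilon> b) \<and>
     (\<forall>a\<in>free_algebra generators. \<forall>d. homogeneous gen_deg d a \<and> d \<noteq> 0 \<longrightarrow> \<epsilon> a = 0) \<and>
     (\<forall>a\<in>free_algebra generators. \<epsilon> (differential a) = 0)}"


subsection \<open>Chain homotopy diagrams\<close>

definition sheet_space :: "'v set \<Rightarrow> (('m, 'n) jet set \<Rightarrow> 'k::field) set" where
  "sheet_space I = span_space (sheets I)"

definition sheet_deg :: "('m, 'n) jet set \<Rightarrow> int" where
  "sheet_deg S = - sheet_mu S"

definition strictly_lower_triangular ::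
    "'v set \<Rightarrow> ((('m, 'n) jet set \<Rightarrow> 'k::field) \<Rightarrow> (('m, 'n) jet set \<Rightarrow> 'k)) \<Rightarrow> bool" where
  "strictly_lower_triangular I f \<longleftrightarrow>
     (\<forall>S\<in>sheets I. f (basis_vec S) \<in> span_space {S' \<in> sheets I. above I S S'})"

text \<open>The boundary extension \<open>c\<^sub>I(e\<^sub>J)\<close> of \<open>f = c(e\<^sub>J)\<close>.  The decomposition of \<open>V(e\<^sub>I)\<close> into
  \<open>V(e\<^sub>J)\<close> and the cusp part is the partition of \<open>\<Lambda>(e\<^sub>I)\<close> into the extensions of sheets above \<open>e\<^sub>J\<close> and
  the remaining sheets.\<close>

definition bdry_extension :: "'v set \<Rightarrow> 'v set \<Rightarrow>
    ((('m, 'n) jet set \<Rightarrow> 'k::field) \<Rightarrow> (('m, 'n) jet set \<Rightarrow> 'k)) \<Rightarrow>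
    (('m, 'n) jet set \<Rightarrow> 'k) \<Rightarrow> (('m, 'n) jet set \<Rightarrow> 'k)" where
  "bdry_extension I J f v = (\<lambda>S.
     if S \<in> sheets I - remaining_sheets J I
     then f (\<lambda>T. if T \<in> sheets J then v (extend_sheet J I T) else 0) (face_sheet J S)
     else if S \<in> remaining_sheets J I
     then (if cell_dim J = 0
           then \<Sum>R\<in>{R \<in> remaining_sheets J I. meet_at_cusp J R S \<and> above I R S}. v R
           else if cell_dim J = 1 then v S
           else 0)
     else 0)"

definition CHDs ::
    "('v set \<Rightarrow> (('m, 'n) jet set \<Rightarrow> 'k::field) \<Rightarrow> (('m, 'n) jet set \<Rightarrow> 'k)) set" where
  "CHDs = {c \<in> extensional K.
     (\<forall>I\<in>K. c I \<in> extensional (sheet_space I) \<and> linear_endo (sheet_space I) (c I) \<and>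
        has_degree (sheet_space I) sheet_deg (1 - int (cell_dim I)) (c I) \<and>
        (if cell_dim I = 1
         then strictly_lower_triangular I (\<lambda>v S. c I v S - v S)
         else strictly_lower_triangular I (c I)) \<and>
        simplex_diagram I (sheet_space I) sheet_deg (\<lambda>F. bdry_extension I F (c F)))}"

end

end

theory Submission
  imports Defs
begin

text \<open>An augmentation is determined by its values on the generators, i.e. by one strictly triangular
  matrix \<open>M\<^sub>I\<close> for each cell, and a CHD corresponds to the matrices \<open>A\<^sub>I\<close>, where \<open>A\<^sub>I = M\<^sub>I + id\<close> for
  edges and \<open>A\<^sub>I = M\<^sub>I\<close> otherwise.  Adding the identity on edges turns the augmentation equation of
  \<open>e\<^sub>I\<close> into the simplex relation of the top face of \<open>e\<^sub>I\<close>.  The relations of the proper faces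
  \<open>F\<close> hold on \<open>V(e\<^sub>F)\<close> because of the relation for \<open>e\<^sub>F\<close> itself, and on the cusp part because
  sheets that meet at a cusp above \<open>e\<^sub>F\<close> also meet at a cusp above every face of \<open>e\<^sub>F\<close>.

  The functoriality needed for this is topological: by (P1) the fibres of \<open>\<Lambda>\<close> are totally
  disconnected, so by compactness the closure of a component above a cell is the graph of a
  continuous section over the closed cell, and hence contains exactly one component above each face.\<close>

section \<open>The topology of the 1-jet space\<close>

text \<open>Both sides turn out to be the same set \<open>points\<close> of scalar functions on the
  generators. In the grading by -\<mu>, a generator of degree 0 is exactly an entry of degree 1 -
  dim. The sign matrix multiplies each row by a unit, so an augmentation imposes the bare matrix
  relation, but only at entries \<open>(S, S')\<close> with \<open>S\<close> above
  \<open>S'\<close>; a CHD imposes it at all entries, and triangularity closes the gap. Three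
  obstacles shape the geometric half. (P3) compares one pair of cells at a time and speaks of sheets
  only, whereas a face \<open>G\<close> of a face \<open>F\<close> of \<open>I\<close> must look the
  same from \<open>F\<close> and from \<open>I\<close>, even where a sheet runs into a cusp; hence
  faces are taken of all components, cusp components included. The entry 1 of a cusp is placed by
  the order of two sheets above the cell at hand, so this order must agree above \<open>F\<close>
  and \<open>I\<close>; the standard cusp keeps the two sheets from being level. Finally, matrices
  need finitely many sheets above each cell, while \<open>M\<close> may be noncompact: this is drawn
  from compactness of \<Lambda> and local compactness of \<open>M\<close>.\<close>

lemma jet_space_base: "p \<in> jet_space M A \<Longrightarrow> base_proj p \<in> topspace M"
  by (auto simp: jet_space_def)

lemma jet_space_chart:
  assumes "smooth_manifold M A" "p \<in> jet_space M A"
  obtains c where "c \<in> A" "base_proj p \<in> fst c"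
  using assms(1) jet_space_base[OF assms(2)] unfolding smooth_manifold_def by blast

lemma topspace_jet_topology:
  assumes "smooth_manifold M A"
  shows "topspace (jet_topology M A) = jet_space M A"
proof
  show "topspace (jet_topology M A) \<subseteq> jet_space M A"
    by (auto simp: jet_topology_def)
  show "jet_space M A \<subseteq> topspace (jet_topology M A)"
  proof
    fix p assume p: "p \<in> jet_space M A"
    then obtain c where "c \<in> A" "base_proj p \<in> fst c"
      using assms jet_space_chart by blast
    then have "p \<in> {p \<in> jet_space M A. base_proj p \<in> fst c \<and> jet_coords c p \<in> UNIV}"
      using p by simp
    then show "p \<in> topspace (jet_topology M A)"
      unfolding jet_topology_def topology_generated_by_topspace using \<open>c \<in> A\<close> open_UNIV by blast
  qed
qed

lemma openin_jet_coords:
  assumes "c \<in> A" "open B"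
  shows "openin (jet_topology M A) {p \<in> jet_space M A. base_proj p \<in> fst c \<and> jet_coords c p \<in> B}"
  unfolding jet_topology_def using assms by (intro topology_generated_by_Basis) blast

text \<open>Each generating set of the topology belongs to one chart, so the preimage of
  \<open>U\<close> is assembled as a union over all charts: the base coordinate is confined to the
  chart image of \<open>U\<close>, the other coordinates are free.\<close>

lemma continuous_map_base_proj:
  assumes "smooth_manifold M A"
  shows "continuous_map (jet_topology M A) M base_proj"
proof -
  have ch: "\<And>c. c \<in> A \<Longrightarrow> is_chart M c"
    using assms by (simp add: smooth_manifold_def)
  show ?thesis
    unfolding continuous_map_def
  proof (intro conjI allI impI)
    show "base_proj \<in> topspace (jet_topology M A) \<rightarrow> topspace M"
      by (auto simp: topspace_jet_topology[OF assms] jet_space_def)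
  next
    fix U assume U: "openin M U"
    define B where "B c = (snd c ` (fst c \<inter> U)) \<times> (UNIV :: ((real^'b) \<times> real) set)"
      for c :: "'a set \<times> ('a \<Rightarrow> real^'b)"
    have opB: "open (B c)" if "c \<in> A" for c
    proof -
      have hm: "homeomorphic_map (subtopology M (fst c)) (top_of_set (snd c ` fst c)) (snd c)"
        and op: "open (snd c ` fst c)"
        using ch[OF that] by (auto simp: is_chart_def)
      have "openin (subtopology M (fst c)) (fst c \<inter> U)"
        using U by (auto simp: openin_subtopology)
      then have "openin (top_of_set (snd c ` fst c)) (snd c ` (fst c \<inter> U))"
        using homeomorphic_imp_open_map[OF hm] by (simp add: open_map_def)
      then have "open (snd c ` (fst c \<inter> U))"
        using op openin_open_trans by blast
      then show ?thesis
        unfolding B_def by (intro open_Times) auto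
    qed
    \<comment> \<open>A chart map is arbitrary outside its domain; injectivity on the domain is what
      leads back from coordinates to \<open>base_proj p \<in> U\<close>.\<close>
    have inj: "inj_on (snd c) (fst c)" if "c \<in> A" for c
    proof -
      have "homeomorphic_map (subtopology M (fst c)) (top_of_set (snd c ` fst c)) (snd c)"
        and "openin M (fst c)"
        using ch[OF that] by (auto simp: is_chart_def)
      then show ?thesis
        using openin_subset[of M "fst c"]
        by (metis homeomorphic_imp_injective_map topspace_subtopology_subset)
    qed
    have "{p \<in> topspace (jet_topology M A). base_proj p \<in> U} =
        (\<Union>c\<in>A. {p \<in> jet_space M A. base_proj p \<in> fst c \<and> jet_coords c p \<in> B c})" (is "?l = ?r")
    proof (intro equalityI subsetI)
      fix p assume "p \<in> ?l"
      then have p: "p \<in> jet_space M A" "base_proj p \<in> U"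
        by (simp_all add: topspace_jet_topology[OF assms])
      then obtain c where "c \<in> A" "base_proj p \<in> fst c"
        using assms jet_space_chart by blast
      with p have "c \<in> A" "base_proj p \<in> fst c \<and> jet_coords c p \<in> B c"
        by (simp_all add: B_def jet_coords_def)
      with p show "p \<in> ?r" by (intro UN_I[of c] CollectI conjI) simp_all
    next
      fix p assume "p \<in> ?r"
      then obtain c where c: "c \<in> A" "p \<in> jet_space M A" "base_proj p \<in> fst c" "jet_coords c p \<in> B c"
        by blast
      from c(4) have "snd c (base_proj p) \<in> snd c ` (fst c \<inter> U)"
        by (simp add: B_def jet_coords_def)
      then obtain y where y: "y \<in> fst c" "y \<in> U" "snd c (base_proj p) = snd c y"
        by blast
      then have "base_proj p \<in> U"
        using inj_onD[OF inj[OF c(1)] y(3) c(3) y(1)] by simp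
      then show "p \<in> ?l"
        using c(2) topspace_jet_topology[OF assms] by blast
    qed
    then show "openin (jet_topology M A) {p \<in> topspace (jet_topology M A). base_proj p \<in> U}"
      using openin_jet_coords[OF _ opB] by (simp only:) (rule openin_Union, blast)
  qed
qed

lemma continuous_map_zcoord:
  assumes "smooth_manifold M A"
  shows "continuous_map (jet_topology M A) euclideanreal zcoord"
  unfolding continuous_map_def
proof (intro conjI allI impI)
  fix U :: "real set" assume "openin euclideanreal U"
  then have op: "open ((UNIV :: (real^'b) set) \<times> (UNIV :: (real^'b) set) \<times> U)"
    by (intro open_Times) auto
  have "{p \<in> topspace (jet_topology M A). zcoord p \<in> U} =
    (\<Union>c\<in>A. {p \<in> jet_space M A. base_proj p \<in> fst c \<and> jet_coords c p \<in> UNIV \<times> UNIV \<times> U})"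
    (is "?l = ?r")
  proof (intro equalityI subsetI)
    fix p assume "p \<in> ?l"
    then have p: "p \<in> jet_space M A" "zcoord p \<in> U"
      by (simp_all add: topspace_jet_topology[OF assms])
    then obtain c where "c \<in> A" "base_proj p \<in> fst c"
      using assms jet_space_chart by blast
    with p have "c \<in> A" "base_proj p \<in> fst c \<and> jet_coords c p \<in> UNIV \<times> UNIV \<times> U"
      by (simp_all add: jet_coords_def)
    with p show "p \<in> ?r" by (intro UN_I[of c] CollectI conjI) simp_all
  next
    fix p assume "p \<in> ?r"
    then have "p \<in> jet_space M A" "zcoord p \<in> U"
      by (simp_all add: jet_coords_def)
    then show "p \<in> ?l"
      using topspace_jet_topology[OF assms] by blast
  qed
  then show "openin (jet_topology M A) {p \<in> topspace (jet_topology M A). zcoord p \<in> U}"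
    using openin_jet_coords[OF _ op, of _ A M] by (simp only:) (rule openin_Union, blast)
qed auto

text \<open>Points over different base points are separated in \<open>M\<close>. Over the same base
  point they differ in height or in the covector, and either difference is visible in a single chart
  around that point.\<close>

lemma Hausdorff_jet_topology:
  assumes "smooth_manifold M A"
  shows "Hausdorff_space (jet_topology M A)"
  unfolding Hausdorff_space_def
proof (intro allI impI, elim conjE)
  fix p q
  assume pq: "p \<in> topspace (jet_topology M A)" "q \<in> topspace (jet_topology M A)" "p \<noteq> q"
  then have pj: "p \<in> jet_space M A" "q \<in> jet_space M A"
    by (simp_all add: topspace_jet_topology[OF assms])
  show "\<exists>U V. openin (jet_topology M A) U \<and> openin (jet_topology M A) V \<and>
    p \<in> U \<and> q \<in> V \<and> disjnt U V"
  proof (cases "base_proj p = base_proj q")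
    case False
    have "base_proj p \<in> topspace M" "base_proj q \<in> topspace M" "Hausdorff_space M"
      using pj[THEN jet_space_base] assms unfolding smooth_manifold_def by simp_all
    then obtain U V where UV: "openin M U" "openin M V" "base_proj p \<in> U" "base_proj q \<in> V" "disjnt U V"
      using False unfolding Hausdorff_space_def by blast
    let ?f = "\<lambda>U. {r \<in> topspace (jet_topology M A). base_proj r \<in> U}"
    have "openin (jet_topology M A) (?f U)" "openin (jet_topology M A) (?f V)"
      using continuous_map_base_proj[OF assms] UV by (auto simp: continuous_map_def)
    moreover have "p \<in> ?f U" "q \<in> ?f V" "disjnt (?f U) (?f V)"
      using pq UV by (auto simp: disjnt_def)
    ultimately show ?thesis by blast
  next
    case True
    have "\<exists>c\<in>A. base_proj p \<in> fst c \<and> jet_coords c p \<noteq> jet_coords c q"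
    proof (rule ccontr)
      assume n: "\<not> ?thesis"
      obtain c where c: "c \<in> A" "base_proj p \<in> fst c"
        using assms pj(1) jet_space_chart by blast
      then have "jet_coords c p = jet_coords c q" using n by blast
      then have "zcoord p = zcoord q"
        by (simp add: jet_coords_def)
      moreover have "fst (snd p) d = fst (snd q) d" for d
      proof (cases "d \<in> A \<and> base_proj p \<in> fst d")
        case True
        then have "jet_coords d p = jet_coords d q" using n by blast
        then show ?thesis by (simp add: jet_coords_def)
      next
        case False
        \<comment> \<open>Components in charts away from the base point are normalised to 0, so they
          cannot distinguish \<open>p\<close> from \<open>q\<close>.\<close>
        have z: "fst (snd r) d = 0" if "r \<in> jet_space M A" "d \<notin> A \<or> base_proj r \<notin> fst d" for r
        proof -
          have "fst (snd r) \<in> cotangent_space A (base_proj r)"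
            using that(1) by (auto simp: jet_space_def)
          then show ?thesis
            using that(2) unfolding cotangent_space_def mem_Collect_eq by blast
        qed
        have "d \<notin> A \<or> base_proj p \<notin> fst d" using False by blast
        moreover from this have "d \<notin> A \<or> base_proj q \<notin> fst d"
          unfolding \<open>base_proj p = base_proj q\<close> .
        ultimately show ?thesis
          using z[OF pj(1)] z[OF pj(2)] by simp
      qed
      then have "fst (snd p) = fst (snd q)" by (rule ext)
      ultimately have "p = q"
        using True by (metis prod.collapse)
      then show False using pq by blast
    qed
    then obtain c where c: "c \<in> A" "base_proj p \<in> fst c" "jet_coords c p \<noteq> jet_coords c q" by blast
    then obtain U V where "open U" "open V" "jet_coords c p \<in> U" "jet_coords c q \<in> V" "U \<inter> V = {}"
      by (meson hausdorff)
    moreover define f where "f U = {p \<in> jet_space M A. base_proj p \<in> fst c \<and> jet_coords c p \<in> U}" for U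
    ultimately have "openin (jet_topology M A) (f U)" "openin (jet_topology M A) (f V)"
      "p \<in> f U" "q \<in> f V" "disjnt (f U) (f V)"
      using openin_jet_coords[OF c(1)] c pj True by (simp_all add: f_def disjnt_iff) blast
    then show ?thesis by blast
  qed
qed

text \<open>Supplies the compact neighbourhood from which local finiteness of the complex is deduced
  in \<open>finite_star\<close>.\<close>

lemma locally_compact_manifold:
  assumes "smooth_manifold M A"
  shows "locally_compact_space M"
  unfolding locally_compact_space_def
proof
  fix x assume "x \<in> topspace M"
  then obtain c where c: "c \<in> A" "x \<in> fst c" "is_chart M c"
    using assms by (auto simp: smooth_manifold_def)
  then have hm: "homeomorphic_map (subtopology M (fst c)) (top_of_set (snd c ` fst c)) (snd c)"
    and op: "open (snd c ` fst c)" and opM: "openin M (fst c)"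
    by (auto simp: is_chart_def)
  have "locally_compact_space (top_of_set (snd c ` fst c))"
    using op by (intro locally_compact_space_open_subset)
      (auto simp: locally_compact_space_euclidean)
  then have "locally_compact_space (subtopology M (fst c))"
    using hm homeomorphic_locally_compact_space homeomorphic_map_imp_homeomorphic_space by blast
  moreover have "x \<in> topspace (subtopology M (fst c))"
    using c opM openin_subset by fastforce
  ultimately obtain U K where "openin (subtopology M (fst c)) U" "compactin (subtopology M (fst c)) K"
    "x \<in> U" "U \<subseteq> K"
    unfolding locally_compact_space_def by meson
  then show "\<exists>U K. openin M U \<and> compactin M K \<and> x \<in> U \<and> U \<subseteq> K"
    using opM by (meson compactin_subtopology openin_trans_full)
qed


section \<open>Open simplices\<close>

text \<open>The support of a point names the open simplex that contains it; a closed simplex is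
  thereby split into its open faces.\<close>

lemma closed_simplex_support:
  assumes "finite I" "t \<in> closed_simplex I"
  shows "{v. t v \<noteq> 0} \<subseteq> I" "t \<in> open_simplex {v. t v \<noteq> 0}" "{v. t v \<noteq> 0} \<noteq> {}"
proof -
  have t: "\<And>v. 0 \<le> t v" "\<And>v. v \<notin> I \<Longrightarrow> t v = 0" "sum t I = 1"
    using assms by (auto simp: closed_simplex_def)
  show sub: "{v. t v \<noteq> 0} \<subseteq> I" using t by blast
  have s: "sum t {v. t v \<noteq> 0} = 1"
    using t(3) sum.mono_neutral_left[OF assms(1) sub, of t] by auto
  show "t \<in> open_simplex {v. t v \<noteq> 0}"
    using s t(1) by (auto simp: open_simplex_def closed_simplex_def less_le)
  show "{v. t v \<noteq> 0} \<noteq> {}"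
    using s by force
qed

lemma open_simplex_support:
  "t \<in> open_simplex I \<Longrightarrow> {v. t v \<noteq> 0} = I"
  by (auto simp: open_simplex_def closed_simplex_def less_le)

lemma open_simplex_nonempty:
  assumes "finite I" "I \<noteq> {}"
  shows "open_simplex I \<noteq> {}"
proof -
  have "card I > 0" using assms by (simp add: card_gt_0_iff)
  then have "(\<lambda>v. if v \<in> I then 1 / real (card I) else 0) \<in> open_simplex I"
    using assms by (auto simp: open_simplex_def closed_simplex_def)
  then show ?thesis by blast
qed

lemma closed_simplex_mono:
  assumes "finite I" "J \<subseteq> I"
  shows "closed_simplex J \<subseteq> closed_simplex I"
proof
  fix t assume t: "t \<in> closed_simplex J"
  then have "sum t I = sum t J"
    using assms by (intro sum.mono_neutral_right) (auto simp: closed_simplex_def)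
  then show "t \<in> closed_simplex I" using t assms by (auto simp: closed_simplex_def)
qed

text \<open>An arbitrarily small move towards an interior point leaves the boundary, so every face
  is approached from the open simplex.\<close>

lemma segment_in_open_simplex:
  assumes t: "t \<in> closed_simplex I" and u: "u \<in> open_simplex I" and s: "0 < s" "s \<le> 1"
  shows "(\<lambda>v. (1 - s) * t v + s * u v) \<in> open_simplex I"
proof -
  have "(\<Sum>v\<in>I. (1 - s) * t v + s * u v) = (1 - s) * sum t I + s * sum u I"
    by (simp add: sum.distrib sum_distrib_left)
  then show ?thesis
    using assms by (auto simp: open_simplex_def closed_simplex_def intro!: add_nonneg_pos)
qed

lemma continuous_map_realization:
  assumes "I \<in> K"
  shows "continuous_map (top_of_set (closed_simplex I)) (realization K) id"
  unfolding continuous_map_def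
proof (intro conjI allI impI)
  have "topspace (realization K) \<supseteq> closed_simplex I"
  proof -
    have "openin (realization K) (\<Union>I\<in>K. closed_simplex I)"
    proof -
      have "(\<Union>I\<in>K. closed_simplex I) \<inter> closed_simplex J = closed_simplex J" if "J \<in> K" for J
        using that by blast
      then show ?thesis
        unfolding openin_realization by (metis order_refl openin_subtopology_self)
    qed
    then show ?thesis
      using openin_subset assms by blast
  qed
  then show "id \<in> topspace (top_of_set (closed_simplex I)) \<rightarrow> topspace (realization K)"
    by auto
  fix U assume U: "openin (realization K) U"
  have "{x \<in> topspace (top_of_set (closed_simplex I)). id x \<in> U} = U \<inter> closed_simplex I"
    by auto
  then show "openin (top_of_set (closed_simplex I)) {x \<in> topspace (top_of_set (closed_simplex I)). id x \<in> U}"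
    using U assms openin_realization by metis
qed

lemma topspace_realization: "topspace (realization K) = (\<Union>I\<in>K. closed_simplex I)"
proof
  show "topspace (realization K) \<subseteq> (\<Union>I\<in>K. closed_simplex I)"
    using openin_topspace[of "realization K"] unfolding openin_realization by blast
  show "(\<Union>I\<in>K. closed_simplex I) \<subseteq> topspace (realization K)"
    using continuous_map_realization[of _ K] by (fastforce simp: continuous_map_def)
qed

text \<open>The functions carry the product topology, so convexity is stated pointwise and a segment
  is continuous because each of its coordinates is.\<close>

lemma connected_star_shaped:
  fixes V :: "('v \<Rightarrow> real) set"
  assumes "\<And>a b s. a \<in> V \<Longrightarrow> b \<in> V \<Longrightarrow> 0 \<le> s \<Longrightarrow> s \<le> 1 \<Longrightarrow> (\<lambda>v. (1 - s) * a v + s * b v) \<in> V"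
  shows "connected V"
proof -
  have "\<exists>T. connected T \<and> T \<subseteq> V \<and> a \<in> T \<and> b \<in> T" if ab: "a \<in> V" "b \<in> V" for a b
  proof -
    let ?f = "\<lambda>s v. (1 - s) * a v + s * b v"
    have "continuous_on {0..1::real} ?f"
      by (intro continuous_on_coordinatewise_then_product continuous_intros)
    then have "connected (?f ` {0..1})"
      by (intro connected_continuous_image) auto
    moreover have "?f ` {0..1} \<subseteq> V" using assms ab by auto
    moreover have "a \<in> ?f ` {0..1}"
      by (rule image_eqI[of _ _ 0]) simp_all
    moreover have "b \<in> ?f ` {0..1}"
      by (rule image_eqI[of _ _ 1]) simp_all
    ultimately show ?thesis by blast
  qed
  then show ?thesis
    using connected_iff_connected_component connected_component_def by metis
qed

text \<open>Coordinates outside the finite set \<open>I\<close> vanish on the simplex, so only those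
  in \<open>I\<close> matter and one radius serves them all.\<close>

lemma simplex_box_in_open:
  fixes W :: "('v \<Rightarrow> real) set"
  assumes I: "finite I" and W: "open W" "t \<in> W" and t: "t \<in> closed_simplex I"
  obtains \<epsilon> where "\<epsilon> > 0" "{u \<in> closed_simplex I. \<forall>v\<in>I. \<bar>u v - t v\<bar> < \<epsilon>} \<subseteq> W"
proof -
  have "openin (product_topology (\<lambda>v. euclidean) UNIV) W"
    using W by (simp add: open_fun_def)
  from product_topology_open_contains_basis[OF this W(2)]
  obtain X where X: "t \<in> (\<Pi>\<^sub>E i\<in>UNIV. X i)" "\<And>i. open (X i)" "(\<Pi>\<^sub>E i\<in>UNIV. X i) \<subseteq> W"
    by auto
  have "\<forall>v. \<exists>r>0. ball (t v) r \<subseteq> X v"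
    using X(1,2) by (auto simp: PiE_UNIV_domain intro: openE)
  then obtain r where r: "\<And>v. r v > 0" "\<And>v. ball (t v) (r v) \<subseteq> X v" by metis
  \<comment> \<open>The extra element 1 keeps the set whose minimum is taken nonempty.\<close>
  define \<epsilon> where "\<epsilon> = Min (insert 1 (r ` I))"
  have e: "\<epsilon> > 0" "\<And>v. v \<in> I \<Longrightarrow> \<epsilon> \<le> r v"
    using I r(1) by (auto simp: \<epsilon>_def)
  have "{u \<in> closed_simplex I. \<forall>v\<in>I. \<bar>u v - t v\<bar> < \<epsilon>} \<subseteq> W"
  proof
    fix u assume u: "u \<in> {u \<in> closed_simplex I. \<forall>v\<in>I. \<bar>u v - t v\<bar> < \<epsilon>}"
    have "u v \<in> X v" for v
    proof (cases "v \<in> I")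
      case True
      then have "u v \<in> ball (t v) (r v)"
        using u e(2)[of v] by (auto simp: dist_real_def abs_minus_commute)
      then show ?thesis using r by blast
    next
      case False
      then have "u v = t v" using u t by (auto simp: closed_simplex_def)
      then show ?thesis using r by (metis centre_in_ball subsetD)
    qed
    then show "u \<in> W" using X(3) by (auto simp: PiE_UNIV_domain)
  qed
  then show thesis using e that by blast
qed

section \<open>Closures of the components above a cell\<close>

lemma closure_of_meets: "r \<in> X closure_of D \<Longrightarrow> openin X T \<Longrightarrow> r \<in> T \<Longrightarrow> \<exists>y\<in>D. y \<in> T"
  by (auto simp: in_closure_of)

locale compatible_sheets = sheet_data M A \<Lambda> C \<mu> K h
  for M :: "'m topology"
    and A :: "('m, 'n::finite) chart set"
    and \<Lambda> C :: "('m, 'n) jet set"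
    and \<mu> :: "('m, 'n) jet \<Rightarrow> int"
    and K :: "'v::linorder set set"
    and h :: "('v \<Rightarrow> real) \<Rightarrow> 'm" +
  assumes manifold: "smooth_manifold M A"
    and legendrian: "closed_legendrian M A \<Lambda>"
    and mild: "mild_front_singularities M A \<Lambda> C"
    and maslov: "maslov_potential M A \<Lambda> C \<mu>"
    and decomposition: "simplicial_decomposition M K h"
    and compat: "compatible"
begin

lemma P1: P1 and P2: P2 and P3: P3
  using compat by (simp_all add: compatible_def)

lemma Hausdorff_M: "Hausdorff_space M"
  using manifold by (simp add: smooth_manifold_def)

lemma compactin_Legendrian: "compactin (jet_topology M A) \<Lambda>"
  using legendrian by (simp add: closed_legendrian_def closed_submanifold_def)

lemma topspace_L: "topspace L = \<Lambda>"
  using compactin_subset_topspace[OF compactin_Legendrian] by auto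

lemma topspace_Int_Legendrian [simp]: "topspace (jet_topology M A) \<inter> \<Lambda> = \<Lambda>"
  using topspace_L by simp

lemma Legendrian_topspace [simp]: "p \<in> \<Lambda> \<Longrightarrow> p \<in> topspace (jet_topology M A)"
  using topspace_Int_Legendrian by blast

lemma compact_L: "compact_space L"
  using compactin_Legendrian by (simp add: compactin_subspace)

lemma Hausdorff_L: "Hausdorff_space L"
  using Hausdorff_jet_topology[OF manifold] Hausdorff_space_subtopology by blast

lemma continuous_base: "continuous_map L M base_proj"
  using continuous_map_base_proj[OF manifold] by (rule continuous_map_from_subtopology)

lemma continuous_z: "continuous_map L euclideanreal zcoord"
  using continuous_map_zcoord[OF manifold] by (rule continuous_map_from_subtopology)

lemma closed_base: "closedin L T \<Longrightarrow> closedin M (base_proj ` T)"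
  using continuous_imp_closed_map[OF continuous_base compact_L Hausdorff_M]
  by (simp add: closed_map_def)

lemma open_base_preimage: "openin M U \<Longrightarrow> openin L {p \<in> \<Lambda>. base_proj p \<in> U}"
  using continuous_base unfolding continuous_map_def topspace_L by blast

section \<open>Cells of the decomposition and their neighbourhoods\<close>

lemma homeo_h: "homeomorphic_map (realization K) M h"
  using decomposition by (simp add: simplicial_decomposition_def)

lemma simplex_finite: "I \<in> K \<Longrightarrow> finite I" and simplex_nonempty: "I \<in> K \<Longrightarrow> I \<noteq> {}"
  using decomposition by (auto simp: simplicial_decomposition_def simplicial_complex_def)

lemma face_in_complex: "I \<in> K \<Longrightarrow> J \<subseteq> I \<Longrightarrow> J \<noteq> {} \<Longrightarrow> J \<in> K"
  using decomposition unfolding simplicial_decomposition_def simplicial_complex_def by blast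

lemma open_simplex_in_realization: "I \<in> K \<Longrightarrow> open_simplex I \<subseteq> topspace (realization K)"
  by (auto simp: topspace_realization open_simplex_def)

lemma inj_h: "inj_on h (topspace (realization K))"
  using homeomorphic_imp_injective_map[OF homeo_h] .

lemma h_image: "h ` topspace (realization K) = topspace M"
  using homeomorphic_imp_surjective_map[OF homeo_h] .

lemma cell_subset: "I \<in> K \<Longrightarrow> e I \<subseteq> topspace M"
  using open_simplex_in_realization h_image by (fastforce simp: cell_def)

lemma cell_nonempty: "I \<in> K \<Longrightarrow> e I \<noteq> {}"
  using open_simplex_nonempty[of I] simplex_finite[of I] simplex_nonempty[of I] by (simp add: cell_def)

lemma continuous_on_simplex:
  assumes "I \<in> K"
  shows "continuous_map (top_of_set (closed_simplex I)) M h"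
  using continuous_map_compose[OF continuous_map_realization[OF assms]
      homeomorphic_imp_continuous_map[OF homeo_h]] by simp

text \<open>Makes connectedness arguments possible at a boundary point of \<open>e I\<close>: a
  small box cuts the open simplex in a nonempty convex set. Only this trace on the cell is claimed
  to lie in \<open>U\<close>.\<close>

lemma small_neighbourhood:
  assumes I: "I \<in> K" and J: "J \<subseteq> I" "J \<noteq> {}" and x: "x \<in> e J" and U: "openin M U" "x \<in> U"
  obtains U' where "openin M U'" "x \<in> U'" "U' \<inter> e I \<subseteq> U" "connectedin M (U' \<inter> e I)"
    "U' \<inter> e I \<noteq> {}"
proof -
  let ?R = "realization K"
  obtain t0 where t0: "t0 \<in> open_simplex J" "x = h t0"
    using x by (auto simp: cell_def)
  then have t0I: "t0 \<in> closed_simplex I"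
    using closed_simplex_mono[OF simplex_finite[OF I] J(1)] by (auto simp: open_simplex_def)
  have "openin (top_of_set (closed_simplex I)) {t \<in> closed_simplex I. h t \<in> U}"
    using continuous_on_simplex[OF I] U(1) by (auto simp: continuous_map_def)
  then obtain W where W: "open W" "{t \<in> closed_simplex I. h t \<in> U} = closed_simplex I \<inter> W"
    by (auto simp: openin_open)
  then have "t0 \<in> W" using t0I t0 U by blast
  obtain \<epsilon> where \<epsilon>: "\<epsilon> > 0" "{u \<in> closed_simplex I. \<forall>v\<in>I. \<bar>u v - t0 v\<bar> < \<epsilon>} \<subseteq> W"
    using simplex_box_in_open[OF simplex_finite[OF I] W(1) \<open>t0 \<in> W\<close> t0I] by blast
  \<comment> \<open>The box restricts the coordinates in \<open>I\<close> alone, which makes it open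
    as a finite intersection. In simplices with further vertices it is not small, so the image of
    \<open>B\<close> may leave \<open>U\<close> away from \<open>e I\<close>.\<close>
  define Q where "Q = {t :: 'v \<Rightarrow> real. \<forall>v\<in>I. \<bar>t v - t0 v\<bar> < \<epsilon>}"
  define B where "B = topspace ?R \<inter> Q"
  have "open {t :: 'v \<Rightarrow> real. \<bar>t v - t0 v\<bar> < \<epsilon>}" for v
    by (intro open_Collect_less continuous_intros continuous_on_product_coordinates)
  then have "open (\<Inter>v\<in>I. {t :: 'v \<Rightarrow> real. \<bar>t v - t0 v\<bar> < \<epsilon>})"
    using simplex_finite[OF I] by (intro open_INT) auto
  moreover have "Q = (\<Inter>v\<in>I. {t :: 'v \<Rightarrow> real. \<bar>t v - t0 v\<bar> < \<epsilon>})"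
    by (auto simp: Q_def)
  ultimately have "open Q" by simp
  have "openin ?R B"
    unfolding openin_realization
  proof (intro conjI ballI)
    show "B \<subseteq> (\<Union>I\<in>K. closed_simplex I)"
      by (auto simp: B_def topspace_realization)
    fix I' assume "I' \<in> K"
    then have "B \<inter> closed_simplex I' = closed_simplex I' \<inter> Q"
      by (auto simp: B_def topspace_realization)
    then show "openin (top_of_set (closed_simplex I')) (B \<inter> closed_simplex I')"
      using \<open>open Q\<close> by (simp add: openin_open_Int)
  qed
  then have opB: "openin M (h ` B)"
    using homeomorphic_imp_open_map[OF homeo_h] by (simp add: open_map_def)
  have t0R: "t0 \<in> topspace ?R"
    using t0I I by (auto simp: topspace_realization)
  have xB: "x \<in> h ` B"
    using t0 t0R \<epsilon>(1) by (auto simp: B_def Q_def)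
  have eq: "h ` B \<inter> e I = h ` (Q \<inter> open_simplex I)"
    using inj_on_image_Int[OF inj_h, of B "open_simplex I"] open_simplex_in_realization[OF I]
    by (auto simp: B_def cell_def)
  have sub: "Q \<inter> open_simplex I \<subseteq> closed_simplex I"
    by (auto simp: open_simplex_def)
  have "h ` B \<inter> e I \<subseteq> U"
    using \<epsilon>(2) W(2) sub unfolding eq Q_def by blast
  moreover have "connected (Q \<inter> open_simplex I)"
  proof (rule connected_star_shaped)
    fix a b s assume ab: "a \<in> Q \<inter> open_simplex I" "b \<in> Q \<inter> open_simplex I" and s: "0 \<le> s" "s \<le> (1::real)"
    have "(\<lambda>v. (1 - s) * a v + s * b v) \<in> open_simplex I"
    proof (cases "s = 0")
      case True then show ?thesis using ab by simp
    next
      case False then show ?thesis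
        using segment_in_open_simplex[of a I b s] ab s by (auto simp: open_simplex_def)
    qed
    moreover have "\<bar>(1 - s) * a v + s * b v - t0 v\<bar> < \<epsilon>" if "v \<in> I" for v
    proof -
      have "a v \<in> ball (t0 v) \<epsilon>" "b v \<in> ball (t0 v) \<epsilon>"
        using ab that by (auto simp: Q_def dist_real_def abs_minus_commute)
      then have "(1 - s) *\<^sub>R a v + s *\<^sub>R b v \<in> ball (t0 v) \<epsilon>"
        using s by (intro convexD[OF convex_ball]) auto
      then show ?thesis by (simp add: dist_real_def abs_minus_commute)
    qed
    ultimately show "(\<lambda>v. (1 - s) * a v + s * b v) \<in> Q \<inter> open_simplex I"
      by (auto simp: Q_def)
  qed
  then have "connectedin (top_of_set (closed_simplex I)) (Q \<inter> open_simplex I)"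
    using sub by (simp add: connectedin_subtopology)
  then have "connectedin M (h ` B \<inter> e I)"
    unfolding eq using connectedin_continuous_map_image[OF continuous_on_simplex[OF I]] by blast
  moreover have "h ` B \<inter> e I \<noteq> {}"
  proof -
    obtain u where u: "u \<in> open_simplex I"
      using open_simplex_nonempty simplex_finite[OF I] simplex_nonempty[OF I] by blast
    \<comment> \<open>Coordinates of points of a simplex differ by at most 1, so
      \<open>s < \<epsilon>\<close> keeps the moved point in the box, while \<open>s > 0\<close>
      puts it into the open simplex.\<close>
    define s where "s = min 1 (\<epsilon> / 2)"
    have s: "0 < s" "s \<le> 1" "s < \<epsilon>" using \<epsilon>(1) by (auto simp: s_def)
    let ?w = "\<lambda>v. (1 - s) * t0 v + s * u v"
    have "?w \<in> open_simplex I"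
      using segment_in_open_simplex[OF t0I u] s by blast
    moreover have "\<bar>?w v - t0 v\<bar> < \<epsilon>" if "v \<in> I" for v
    proof -
      have le1: "w v \<le> 1 \<and> 0 \<le> w v" if "w \<in> closed_simplex I" for w
        using that \<open>v \<in> I\<close> member_le_sum[OF \<open>v \<in> I\<close>, of w] simplex_finite[OF I]
        by (auto simp: closed_simplex_def)
      have "\<bar>u v - t0 v\<bar> \<le> 1"
        using le1[OF t0I] le1[of u] u by (auto simp: open_simplex_def)
      moreover have "?w v - t0 v = s * (u v - t0 v)" by (simp add: algebra_simps)
      ultimately show ?thesis
        using s by (simp add: abs_mult) (metis mult_left_le less_imp_le order.strict_trans1)
    qed
    ultimately have "?w \<in> Q \<inter> open_simplex I"
      by (auto simp: Q_def)
    then show ?thesis unfolding eq by blast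
  qed
  ultimately show thesis
    using that opB xB by blast
qed

text \<open>Links the combinatorial faces, which index the matrices and the simplex relations, to
  the closure order in which (P3) is stated.\<close>

lemma face_cell_le:
  assumes "I \<in> K" "J \<subseteq> I" "J \<noteq> {}"
  shows "cell_le J I"
  unfolding cell_le_def
proof
  fix x assume x: "x \<in> e J"
  have "\<exists>y\<in>e I. y \<in> U" if U: "openin M U" "x \<in> U" for U
    using small_neighbourhood[OF assms x U] by blast
  then show "x \<in> M closure_of (e I)"
    using x cell_subset[OF face_in_complex[OF assms]] unfolding in_closure_of by blast
qed

lemma connected_cell:
  assumes "I \<in> K"
  shows "connectedin M (e I)"
proof -
  have "connected (open_simplex I)"
  proof (rule connected_star_shaped)
    fix a b s assume ab: "a \<in> open_simplex I" "b \<in> open_simplex I" and s: "0 \<le> s" "s \<le> (1::real)"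
    show "(\<lambda>v. (1 - s) * a v + s * b v) \<in> open_simplex I"
    proof (cases "s = 0")
      case True then show ?thesis using ab by simp
    next
      case False then show ?thesis
        using segment_in_open_simplex[of a I b s] ab s by (auto simp: open_simplex_def)
    qed
  qed
  then have "connectedin (top_of_set (closed_simplex I)) (open_simplex I)"
    by (auto simp: connectedin_subtopology open_simplex_def)
  then show ?thesis
    unfolding cell_def using connectedin_continuous_map_image[OF continuous_on_simplex[OF assms]] by blast
qed

section \<open>Components of the Legendrian above one cell\<close>

lemma component_subset: "D \<in> components_above I \<Longrightarrow> D \<subseteq> {p \<in> \<Lambda>. base_proj p \<in> e I}"
  unfolding components_above_def using connected_components_of_subset by fastforce

lemma component_connected: "D \<in> components_above I \<Longrightarrow> connectedin L D"
  unfolding components_above_def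
  by (drule connectedin_connected_components_of) (simp add: connectedin_subtopology)

lemma component_nonempty: "D \<in> components_above I \<Longrightarrow> D \<noteq> {}"
  unfolding components_above_def using nonempty_connected_components_of by blast

lemma component_homeo:
  "I \<in> K \<Longrightarrow> D \<in> components_above I \<Longrightarrow> homeomorphic_map (subtopology L D) (subtopology M (e I)) base_proj"
  using P1 by (simp add: P1_def)

lemma component_dichotomy:
  "I \<in> K \<Longrightarrow> D \<in> components_above I \<Longrightarrow> D \<in> sheets I \<or> D \<in> cusp_components I"
  using P1 by (auto simp: P1_def sheets_def cusp_components_def)

lemma sheets_not_cusp: "S \<in> sheets I \<Longrightarrow> S \<notin> cusp_components J"
  using component_nonempty unfolding sheets_def cusp_components_def by blast

lemma topspace_component: "D \<in> components_above I \<Longrightarrow> topspace (subtopology L D) = D"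
  using component_subset[of D I] topspace_L by (intro topspace_subtopology_subset) blast

lemma topspace_cell: "I \<in> K \<Longrightarrow> topspace (subtopology M (e I)) = e I"
  using cell_subset by (intro topspace_subtopology_subset)

lemma component_inj:
  assumes "I \<in> K" "D \<in> components_above I"
  shows "inj_on base_proj D"
  using homeomorphic_imp_injective_map[OF component_homeo[OF assms]]
  unfolding topspace_component[OF assms(2)] .

lemma component_image:
  assumes "I \<in> K" "D \<in> components_above I"
  shows "base_proj ` D = e I"
  using homeomorphic_imp_surjective_map[OF component_homeo[OF assms]]
  unfolding topspace_component[OF assms(2)] topspace_cell[OF assms(1)] .

lemma component_maximal:
  assumes D: "D \<in> components_above I" and Z: "connectedin L Z" "\<And>p. p \<in> Z \<Longrightarrow> base_proj p \<in> e I"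
    and ne: "Z \<inter> D \<noteq> {}"
  shows "Z \<subseteq> D"
proof -
  have "Z \<subseteq> {p \<in> \<Lambda>. base_proj p \<in> e I}"
    using Z(2) connectedin_subset_topspace[OF Z(1)] by auto
  then have "connectedin (subtopology L {p \<in> \<Lambda>. base_proj p \<in> e I}) Z"
    using Z(1) by (simp only: connectedin_subtopology simp_thms)
  moreover have "\<not> disjnt D Z" using ne by (auto simp: disjnt_def)
  ultimately show ?thesis
    using D unfolding components_above_def by (intro connected_components_of_maximal)
qed

lemma component_exists:
  assumes "p \<in> \<Lambda>" "base_proj p \<in> e I"
  obtains D where "D \<in> components_above I" "p \<in> D"
proof -
  have "p \<in> \<Union>(components_above I)"
    unfolding components_above_def Union_connected_components_of using assms by simp
  then show thesis using that by blast
qed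

lemma component_disjoint:
  assumes "D \<in> components_above I" "D' \<in> components_above I" "p \<in> D" "p \<in> D'"
  shows "D = D'"
proof
  show "D \<subseteq> D'" using assms component_subset[OF assms(1)]
    by (intro component_maximal[OF assms(2) component_connected[OF assms(1)]]) auto
  show "D' \<subseteq> D" using assms component_subset[OF assms(2)]
    by (intro component_maximal[OF assms(1) component_connected[OF assms(2)]]) auto
qed

lemma connected_in_component:
  assumes "connectedin L Z" "Z \<noteq> {}" "\<And>p. p \<in> Z \<Longrightarrow> base_proj p \<in> e I"
  obtains D where "D \<in> components_above I" "Z \<subseteq> D"
proof -
  obtain p where p: "p \<in> Z" using assms(2) by blast
  then have "p \<in> \<Lambda>" using connectedin_subset_topspace[OF assms(1)] by auto
  then obtain D where "D \<in> components_above I" "p \<in> D"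
    using component_exists assms(3)[OF p] by blast
  then show thesis
    using component_maximal[OF _ assms(1,3)] p that by blast
qed

text \<open>The base projection of the compact \<Lambda> is a closed map, so the image of the
  closure of \<open>D\<close> is closed; it contains \<open>e I\<close> and hence all of its
  closure.\<close>

lemma limit_exists:
  assumes I: "I \<in> K" and J: "J \<subseteq> I" "J \<noteq> {}" and x: "x \<in> e J" and D: "D \<in> components_above I"
  obtains p where "p \<in> L closure_of D" "base_proj p = x"
proof -
  have "closedin M (base_proj ` (L closure_of D))"
    by (intro closed_base closedin_closure_of)
  moreover have "D \<subseteq> L closure_of D"
    using component_subset[OF D] topspace_L by (intro closure_of_subset) blast
  then have "e I \<subseteq> base_proj ` (L closure_of D)"
    using component_image[OF I D] by blast
  ultimately have "M closure_of (e I) \<subseteq> base_proj ` (L closure_of D)"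
    by (rule closure_of_minimal[rotated])
  then show thesis
    using face_cell_le[OF I J] x that unfolding cell_le_def by blast
qed

text \<open>The fibre of \<open>\<Lambda>\<close> over \<open>x\<close> is compact and by (P1) totally disconnected.  If \<open>D\<close> had two limit
  points over \<open>x\<close>, a clopen splitting of the fibre would disconnect \<open>D\<close> over a small connected
  piece of the cell near \<open>x\<close>.\<close>

lemma limit_unique:
  assumes I: "I \<in> K" and J: "J \<subseteq> I" "J \<noteq> {}" and x: "x \<in> e J" and D: "D \<in> components_above I"
    and pq: "p \<in> L closure_of D" "q \<in> L closure_of D" "base_proj p = x" "base_proj q = x"
  shows "p = q"
proof (rule ccontr)
  assume ne: "p \<noteq> q"
  have JK: "J \<in> K" using face_in_complex[OF I J] .
  define \<Phi> where "\<Phi> = {p \<in> \<Lambda>. base_proj p = x}"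
  have pq\<Phi>: "p \<in> \<Phi>" "q \<in> \<Phi>"
    using pq closure_of_subset_topspace[of L D] by (auto simp: \<Phi>_def)
  have "closedin M {x}"
    using Hausdorff_M x cell_subset[OF JK] by (intro closedin_Hausdorff_singleton) auto
  then have "closedin L {p \<in> topspace L. base_proj p \<in> {x}}"
    using continuous_base closedin_continuous_map_preimage by blast
  then have cl\<Phi>: "closedin L \<Phi>" unfolding topspace_L \<Phi>_def by simp
  have cpt: "compact_space (subtopology L \<Phi>)" "Hausdorff_space (subtopology L \<Phi>)"
    using cl\<Phi> compact_L closedin_compact_space compact_space_subtopology Hausdorff_L
      Hausdorff_space_subtopology by blast+
  have "\<not> connected_component_of (subtopology L \<Phi>) p q"
  proof
    assume "connected_component_of (subtopology L \<Phi>) p q"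
    then obtain Z where Z: "connectedin (subtopology L \<Phi>) Z" "p \<in> Z" "q \<in> Z"
      unfolding connected_component_of_def by blast
    then have "connectedin L Z" "Z \<subseteq> \<Phi>" by (simp_all add: connectedin_subtopology)
    moreover have "base_proj r \<in> e J" if "r \<in> Z" for r
      using that x \<open>Z \<subseteq> \<Phi>\<close> by (auto simp: \<Phi>_def)
    ultimately obtain D' where "D' \<in> components_above J" "Z \<subseteq> D'"
      using connected_in_component[of Z J] Z by blast
    then show False
      using component_inj[OF JK] Z pq ne by (metis inj_onD subsetD)
  qed
  \<comment> \<open>In a compact Hausdorff space quasi-components are components, so points not
    joined by a connected set are separated by a clopen set.\<close>
  then have "\<not> quasi_component_of (subtopology L \<Phi>) p q"
    using quasi_eq_connected_component_of cpt by metis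
  then obtain T where T: "closedin (subtopology L \<Phi>) T" "openin (subtopology L \<Phi>) T" "(p \<in> T) \<noteq> (q \<in> T)"
    using pq\<Phi> unfolding quasi_component_of_def \<Phi>_def by auto
  have T': "closedin (subtopology L \<Phi>) (\<Phi> - T)"
    using T(2) \<Phi>_def openin_closedin_eq by fastforce
  have "T \<subseteq> \<Phi>" using closedin_subset[OF T(1)] by auto
  have comp: "compactin L T" "compactin L (\<Phi> - T)"
    using T(1) T' cpt(1) closedin_compact_space compactin_subtopology by blast+
  obtain P Q where PQ: "openin L P" "openin L Q" "T \<subseteq> P" "\<Phi> - T \<subseteq> Q" "disjnt P Q"
    using Hausdorff_space_compact_separation[OF Hausdorff_L comp] by (auto simp: disjnt_def)
  \<comment> \<open>The complement of this projection is the set of base points over which \<Lambda>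
    stays inside \<open>P \<union> Q\<close>; it is open because the projection is a closed
    map.\<close>
  have "closedin M (base_proj ` (\<Lambda> - (P \<union> Q)))"
    using PQ(1,2) by (intro closed_base) (metis closedin_diff closedin_topspace openin_Un topspace_L)
  then have opU: "openin M (topspace M - base_proj ` (\<Lambda> - (P \<union> Q)))"
    by blast
  have xU: "x \<in> topspace M - base_proj ` (\<Lambda> - (P \<union> Q))"
  proof
    show "x \<in> topspace M" using x cell_subset[OF JK] by blast
    have "\<Phi> \<subseteq> P \<union> Q" using PQ(3,4) by blast
    then show "x \<notin> base_proj ` (\<Lambda> - (P \<union> Q))" unfolding \<Phi>_def by blast
  qed
  obtain U' where U': "openin M U'" "x \<in> U'" "U' \<inter> e I \<subseteq> topspace M - base_proj ` (\<Lambda> - (P \<union> Q))"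
    "connectedin M (U' \<inter> e I)" "U' \<inter> e I \<noteq> {}"
    by (rule small_neighbourhood[OF I J x opU xU])
  define Z where "Z = {p \<in> D. base_proj p \<in> U'}"
  have Zimg: "base_proj ` Z = U' \<inter> e I"
    unfolding component_image[OF I D, symmetric] Z_def by blast
  have ZD: "Z \<subseteq> topspace (subtopology L D)"
    unfolding topspace_component[OF D] Z_def by blast
  have "connectedin (subtopology M (e I)) (base_proj ` Z)"
    unfolding Zimg using U'(4) by (simp add: connectedin_subtopology)
  then have "connectedin (subtopology L D) Z"
    using homeomorphic_map_connectedness[OF component_homeo[OF I D] ZD] by blast
  then have Zc: "connectedin L Z" by (simp add: connectedin_subtopology)
  have cover: "Z \<subseteq> P \<union> Q"
  proof
    fix r assume r: "r \<in> Z"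
    then have "base_proj r \<notin> base_proj ` (\<Lambda> - (P \<union> Q))" using Zimg U'(3) by blast
    moreover have "r \<in> \<Lambda>" using r component_subset[OF D] unfolding Z_def by blast
    ultimately show "r \<in> P \<union> Q" by blast
  qed
  have meets: "Z \<inter> R \<noteq> {}" if R: "openin L R" "r \<in> R" "r \<in> L closure_of D" "base_proj r = x" for R r
  proof -
    have "openin L (R \<inter> {p \<in> \<Lambda>. base_proj p \<in> U'})"
      by (rule openin_Int[OF R(1) open_base_preimage[OF U'(1)]])
    moreover have "r \<in> \<Lambda>"
      using R(2) openin_subset[OF R(1)] unfolding topspace_L by blast
    then have "r \<in> R \<inter> {p \<in> \<Lambda>. base_proj p \<in> U'}"
      using R(2,4) U'(2) by simp
    ultimately have "\<exists>y\<in>D. y \<in> R \<inter> {p \<in> \<Lambda>. base_proj p \<in> U'}"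
      by (intro closure_of_meets[OF R(3)])
    then show ?thesis unfolding Z_def by blast
  qed
  have "Z \<inter> P \<noteq> {} \<and> Z \<inter> Q \<noteq> {}"
  proof (cases "p \<in> T")
    case True
    then show ?thesis
      using meets[OF PQ(1) _ pq(1,3)] meets[OF PQ(2) _ pq(2,4)] T(3) PQ(3,4) pq\<Phi> by blast
  next
    case False
    then show ?thesis
      using meets[OF PQ(1) _ pq(2,4)] meets[OF PQ(2) _ pq(1,3)] T(3) PQ(3,4) pq\<Phi> by blast
  qed
  then show False
    using Zc cover PQ(1,2,5) unfolding connectedin disjnt_def by blast
qed

end

section \<open>The face of a component above a face of its cell\<close>

context compatible_sheets
begin

text \<open>Defined for every component, since the face of a sheet may be a cusp component;
  \<open>face_sheet\<close> covers only the case where it is a sheet.\<close>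

definition face_component :: "'v set \<Rightarrow> ('m, 'n) jet set \<Rightarrow> ('m, 'n) jet set" where
  "face_component J D = (THE D'. D' \<in> components_above J \<and> D' \<subseteq> L closure_of D)"

lemma component_over:
  assumes "I \<in> K" "D \<in> components_above I" "x \<in> e I"
  obtains p where "p \<in> D" "base_proj p = x"
proof -
  have "x \<in> base_proj ` D" using component_image[OF assms(1,2)] assms(3) by simp
  then show thesis using that by blast
qed

text \<open>The part \<Sigma> of the closure of \<open>D\<close> above \<open>e J\<close> projects
  bijectively to \<open>e J\<close>. Once this bijection is a homeomorphism, \<Sigma> is connected
  and must itself be the component sought.\<close>

lemma face_component_ex1:
  assumes I: "I \<in> K" and J: "J \<subseteq> I" "J \<noteq> {}" and D: "D \<in> components_above I"
  shows "\<exists>!D'. D' \<in> components_above J \<and> D' \<subseteq> L closure_of D"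
proof -
  have JK: "J \<in> K" using face_in_complex[OF I J] .
  define \<Sigma> where "\<Sigma> = {p \<in> L closure_of D. base_proj p \<in> e J}"
  have cl\<Lambda>: "L closure_of D \<subseteq> \<Lambda>"
    using closure_of_subset_topspace[of L D] unfolding topspace_L .
  then have \<Sigma>\<Lambda>: "\<Sigma> \<subseteq> \<Lambda>" unfolding \<Sigma>_def by blast
  have top\<Sigma>: "topspace (subtopology L \<Sigma>) = \<Sigma>"
    using \<Sigma>\<Lambda> topspace_L by (intro topspace_subtopology_subset) blast
  have img: "base_proj ` \<Sigma> = e J"
  proof
    show "base_proj ` \<Sigma> \<subseteq> e J" unfolding \<Sigma>_def by blast
    show "e J \<subseteq> base_proj ` \<Sigma>"
    proof
      fix x assume x: "x \<in> e J"
      obtain p where "p \<in> L closure_of D" "base_proj p = x"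
        by (rule limit_exists[OF I J x D])
      then show "x \<in> base_proj ` \<Sigma>" using x unfolding \<Sigma>_def by blast
    qed
  qed
  have inj: "inj_on base_proj \<Sigma>"
  proof (rule inj_onI)
    fix p q assume pq: "p \<in> \<Sigma>" "q \<in> \<Sigma>" and eq: "base_proj p = base_proj q"
    have "p \<in> L closure_of D" "q \<in> L closure_of D" "base_proj q \<in> e J"
      using pq unfolding \<Sigma>_def by simp_all
    then show "p = q"
      using limit_unique[OF I J _ D _ _ eq refl] by blast
  qed
  have "closed_map L M base_proj"
    by (rule continuous_imp_closed_map[OF continuous_base compact_L Hausdorff_M])
  then have "closed_map (subtopology L (L closure_of D)) M base_proj"
    by (rule closed_map_from_subtopology[OF _ closedin_closure_of])
  moreover have "topspace (subtopology L (L closure_of D)) = L closure_of D"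
    by (intro topspace_subtopology_subset closure_of_subset_topspace)
  then have "{p \<in> topspace (subtopology L (L closure_of D)). base_proj p \<in> e J} = \<Sigma>"
    by (simp only: \<Sigma>_def)
  \<comment> \<open>A closed map stays closed when restricted to the full preimage of a set, and
    \<Sigma> is the full preimage of \<open>e J\<close> in the closure of \<open>D\<close>.\<close>
  ultimately have "closed_map (subtopology (subtopology L (L closure_of D)) \<Sigma>) (subtopology M (e J)) base_proj"
    by (rule closed_map_restriction)
  moreover have "subtopology (subtopology L (L closure_of D)) \<Sigma> = subtopology L \<Sigma>"
    unfolding subtopology_subtopology by (rule arg_cong[of _ _ "subtopology (jet_topology M A)"]) (auto simp: \<Sigma>_def)
  ultimately have "closed_map (subtopology L \<Sigma>) (subtopology M (e J)) base_proj" by (simp only:)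
  moreover have "continuous_map (subtopology L \<Sigma>) (subtopology M (e J)) base_proj"
    using continuous_base continuous_map_from_subtopology img top\<Sigma>
    by (intro continuous_map_into_subtopology) blast+
  ultimately have hom: "homeomorphic_map (subtopology L \<Sigma>) (subtopology M (e J)) base_proj"
    by (intro bijective_closed_imp_homeomorphic_map) (simp_all only: top\<Sigma> img inj topspace_cell[OF JK])
  have "connectedin (subtopology M (e J)) (base_proj ` \<Sigma>)"
    using connected_cell[OF JK] by (simp add: img connectedin_subtopology)
  then have "connectedin (subtopology L \<Sigma>) \<Sigma>"
    using homeomorphic_map_connectedness[OF hom, of \<Sigma>] unfolding top\<Sigma> by blast
  then have con: "connectedin L \<Sigma>" by (simp add: connectedin_subtopology)
  have "\<Sigma> \<noteq> {}" using img cell_nonempty[OF JK] by blast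
  then obtain D' where D': "D' \<in> components_above J" "\<Sigma> \<subseteq> D'"
    using connected_in_component[OF con] unfolding \<Sigma>_def by blast
  have eq: "D'' = D'" if D'': "D'' \<in> components_above J" "D'' \<subseteq> L closure_of D" for D''
  proof -
    have "D'' \<subseteq> \<Sigma>"
      using D''(2) component_subset[OF D''(1)] unfolding \<Sigma>_def by blast
    moreover obtain p where "p \<in> D''" using component_nonempty[OF D''(1)] by blast
    ultimately show ?thesis
      using component_disjoint[OF D''(1) D'(1)] D'(2) by blast
  qed
  \<comment> \<open>\<Sigma> already reaches every point of \<open>e J\<close>, and
    \<open>D'\<close> has only one point over each, so the inclusion of \<Sigma> in
    \<open>D'\<close> is an equality.\<close>
  have "D' \<subseteq> \<Sigma>"
  proof
    fix p assume p: "p \<in> D'"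
    then have "base_proj p \<in> base_proj ` \<Sigma>"
      using component_subset[OF D'(1)] unfolding img by blast
    then obtain q where q: "q \<in> \<Sigma>" "base_proj q = base_proj p" by (metis imageE)
    then have "q = p"
      using component_inj[OF JK D'(1)] D'(2) p by (meson inj_onD subsetD)
    then show "p \<in> \<Sigma>" using q by simp
  qed
  then have "D' \<subseteq> L closure_of D" unfolding \<Sigma>_def by blast
  then show ?thesis using D'(1) eq by blast
qed

lemma face_component:
  assumes "I \<in> K" "J \<subseteq> I" "J \<noteq> {}" "D \<in> components_above I"
  shows "face_component J D \<in> components_above J" "face_component J D \<subseteq> L closure_of D"
  using theI'[OF face_component_ex1[OF assms]] unfolding face_component_def by blast+

lemma face_component_eq:
  assumes "I \<in> K" "J \<subseteq> I" "J \<noteq> {}" "D \<in> components_above I"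
    and "D' \<in> components_above J" "D' \<subseteq> L closure_of D"
  shows "face_component J D = D'"
  using face_component_ex1[OF assms(1-4)] face_component[OF assms(1-4)] assms(5,6) by blast

text \<open>Faces compose because closures are closed: whatever lies in the closure of a face of
  \<open>D\<close> lies in the closure of \<open>D\<close>, and uniqueness identifies it.\<close>

lemma face_component_trans:
  assumes I: "I \<in> K" and F: "F \<subseteq> I" and G: "G \<subseteq> F" "G \<noteq> {}" and D: "D \<in> components_above I"
  shows "face_component G (face_component F D) = face_component G D"
proof -
  have "F \<noteq> {}" using G by blast
  have FK: "F \<in> K" using face_in_complex[OF I F \<open>F \<noteq> {}\<close>] .
  note f = face_component[OF I F \<open>F \<noteq> {}\<close> D]
  note g = face_component[OF FK G f(1)]
  have "L closure_of (face_component F D) \<subseteq> L closure_of D"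
    using f(2) by (intro closure_of_minimal) auto
  then show ?thesis
    using face_component_eq[OF I _ G(2) D g(1)] g(2) F G(1) by simp
qed

lemma face_component_self:
  assumes "I \<in> K" "D \<in> components_above I"
  shows "face_component I D = D"
  using component_subset[OF assms(2)] topspace_L closure_of_subset[of D L]
  by (intro face_component_eq[OF assms(1) order_refl simplex_nonempty[OF assms(1)] assms(2,2)]) blast

text \<open>All points of \<open>D\<close> over a small base neighbourhood lie in \<open>N\<close>,
  not just some of them: the part of the closure outside \<open>N\<close> has closed projection,
  which misses \<open>base_proj p\<close> since \<open>p\<close> is the only limit there.\<close>

lemma tube:
  assumes I: "I \<in> K" and J: "J \<subseteq> I" "J \<noteq> {}" and D: "D \<in> components_above I"
    and p: "p \<in> face_component J D" and N: "openin L N" "p \<in> N"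
  obtains U where "openin M U" "base_proj p \<in> U" "\<And>q. q \<in> D \<Longrightarrow> base_proj q \<in> U \<Longrightarrow> q \<in> N"
proof -
  note f = face_component[OF I J D]
  have x: "base_proj p \<in> e J" using component_subset[OF f(1)] p by blast
  have pD: "p \<in> L closure_of D" using f(2) p by blast
  have DD: "D \<subseteq> L closure_of D"
    using component_subset[OF D] topspace_L by (intro closure_of_subset) blast
  let ?U = "topspace M - base_proj ` (L closure_of D - N)"
  have "closedin M (base_proj ` (L closure_of D - N))"
    by (intro closed_base closedin_diff closedin_closure_of N)
  then have "openin M ?U" by blast
  moreover have "base_proj p \<notin> base_proj ` (L closure_of D - N)"
  proof
    assume "base_proj p \<in> base_proj ` (L closure_of D - N)"
    then obtain q where q: "base_proj p = base_proj q" "q \<in> L closure_of D - N"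
      by (rule imageE)
    then have "q = p"
      by (intro limit_unique[OF I J x D _ pD _ refl]) simp_all
    then show False using q N by simp
  qed
  then have "base_proj p \<in> ?U"
    using x cell_subset[OF face_in_complex[OF I J]] by blast
  moreover have "q \<in> N" if "q \<in> D" "base_proj q \<in> ?U" for q
    using that DD by blast
  ultimately show thesis by (rule that)
qed

text \<open>Compares two components through points over a common base point, close to prescribed
  limits. The neighbourhoods will be half-spaces in \<open>z\<close> or neighbourhoods of a cusp
  point.\<close>

lemma tube2:
  assumes I: "I \<in> K" and J: "J \<subseteq> I" "J \<noteq> {}"
    and D: "D \<in> components_above I" "D' \<in> components_above I"
    and p: "p \<in> face_component J D" "p' \<in> face_component J D'" "base_proj p = base_proj p'"
    and N: "openin L N" "p \<in> N" "openin L N'" "p' \<in> N'"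
  obtains q q' where "q \<in> D" "q' \<in> D'" "base_proj q = base_proj q'" "q \<in> N" "q' \<in> N'"
proof -
  obtain U where U: "openin M U" "base_proj p \<in> U" "\<And>q. q \<in> D \<Longrightarrow> base_proj q \<in> U \<Longrightarrow> q \<in> N"
    by (rule tube[OF I J D(1) p(1) N(1,2)]) blast
  obtain U' where U': "openin M U'" "base_proj p' \<in> U'" "\<And>q. q \<in> D' \<Longrightarrow> base_proj q \<in> U' \<Longrightarrow> q \<in> N'"
    by (rule tube[OF I J D(2) p(2) N(3,4)]) blast
  have "base_proj p \<in> M closure_of (e I)"
    using face_cell_le[OF I J] component_subset[OF face_component(1)[OF I J D(1)]] p(1)
    unfolding cell_le_def by blast
  moreover have "openin M (U \<inter> U')" "base_proj p \<in> U \<inter> U'"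
    using U(1,2) U'(1,2) p(3) by (simp_all add: openin_Int)
  ultimately obtain x where x: "x \<in> e I" "x \<in> U \<inter> U'"
    using closure_of_meets by metis
  obtain q where q: "q \<in> D" "base_proj q = x" by (rule component_over[OF I D(1) x(1)])
  obtain q' where q': "q' \<in> D'" "base_proj q' = x" by (rule component_over[OF I D(2) x(1)])
  show thesis
    using that[OF q(1) q'(1)] U(3)[OF q(1)] U'(3)[OF q'(1)] q(2) q'(2) x(2) by simp
qed


section \<open>Faces of sheets\<close>

lemma sheet_component: "S \<in> sheets I \<Longrightarrow> S \<in> components_above I"
  by (simp add: sheets_def)

lemma sheet_z_eq:
  assumes "I \<in> K" "S \<in> sheets I" "p \<in> S"
  shows "sheet_z S (base_proj p) = zcoord p"
  unfolding sheet_z_def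
  using the_inv_into_f_f[OF component_inj[OF assms(1) sheet_component[OF assms(2)]] assms(3)] by simp

lemma P3_face:
  assumes I: "I \<in> K" and J: "J \<subseteq> I" "J \<noteq> {}"
  shows "T \<in> sheets J \<Longrightarrow> \<exists>!S. S \<in> sheets I \<and> T \<subseteq> L closure_of S"
    and "S \<in> remaining_sheets J I \<Longrightarrow> \<exists>!S'. S' \<in> remaining_sheets J I \<and> meet_at_cusp J S S'"
  using mp[OF bspec[OF bspec[OF P3[unfolded P3_def] I] face_in_complex[OF I J]] face_cell_le[OF I J]]
  by simp_all

lemma extend_sheet_ex1:
  assumes "I \<in> K" "J \<subseteq> I" "J \<noteq> {}" "T \<in> sheets J"
  shows "\<exists>!S. S \<in> sheets I \<and> T \<subseteq> L closure_of S"
  by (rule P3_face(1)[OF assms])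

lemma sheet_extension_unique:
  assumes I: "I \<in> K" and J: "J \<subseteq> I" "J \<noteq> {}" and S: "S \<in> sheets I" "S' \<in> sheets I"
    and f: "face_component J S \<in> sheets J" "face_component J S = face_component J S'"
  shows "S = S'"
  using extend_sheet_ex1[OF I J f(1)] S f(2) face_component(2)[OF I J sheet_component] by metis

text \<open>Together with \<open>extend_face\<close> this makes \<open>extend_sheet\<close> and
  \<open>face_component\<close> inverse bijections between the sheets above \<open>e J\<close> and
  those sheets above \<open>e I\<close> whose face is a sheet; sums over sheets are reindexed along
  them.\<close>

lemma extend_sheet:
  assumes "I \<in> K" "J \<subseteq> I" "J \<noteq> {}" "T \<in> sheets J"
  shows "extend_sheet J I T \<in> sheets I" "face_component J (extend_sheet J I T) = T"
proof -
  have *: "extend_sheet J I T \<in> sheets I \<and> T \<subseteq> L closure_of (extend_sheet J I T)"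
    unfolding extend_sheet_def by (rule theI'[OF extend_sheet_ex1[OF assms]])
  then show "extend_sheet J I T \<in> sheets I" by blast
  show "face_component J (extend_sheet J I T) = T"
    using * by (intro face_component_eq[OF assms(1-3)] sheet_component assms(4)) auto
qed

lemma extend_face:
  assumes "I \<in> K" "J \<subseteq> I" "J \<noteq> {}" "S \<in> sheets I" "face_component J S \<in> sheets J"
  shows "extend_sheet J I (face_component J S) = S"
  using sheet_extension_unique[OF assms(1-3) assms(4) extend_sheet(1)[OF assms(1-3,5)] assms(5)]
    extend_sheet(2)[OF assms(1-3,5)] by simp

lemma sheet_face_iff:
  assumes I: "I \<in> K" and J: "J \<subseteq> I" "J \<noteq> {}" and S: "S \<in> sheets I"
  shows "(\<exists>T\<in>sheets J. T \<subseteq> L closure_of S) \<longleftrightarrow> face_component J S \<in> sheets J"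
  using face_component_eq[OF I J sheet_component[OF S] sheet_component]
    face_component(2)[OF I J sheet_component[OF S]] by metis

lemma remaining_iff:
  assumes "I \<in> K" "J \<subseteq> I" "J \<noteq> {}"
  shows "S \<in> remaining_sheets J I \<longleftrightarrow> S \<in> sheets I \<and> face_component J S \<notin> sheets J"
  using sheet_face_iff[OF assms] unfolding remaining_sheets_def by blast

lemma face_sheet_eq:
  assumes I: "I \<in> K" and J: "J \<subseteq> I" "J \<noteq> {}" and S: "S \<in> sheets I" and f: "face_component J S \<in> sheets J"
  shows "face_sheet J S = face_component J S"
  unfolding face_sheet_def
  using f face_component(2)[OF I J sheet_component[OF S]]
    face_component_eq[OF I J sheet_component[OF S] sheet_component]
  by (intro the_equality) (blast, metis)

text \<open>A cusp component in the closure of a sheet can only be its face, and by (P1) a face that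
  is not a sheet is a cusp component. Meeting thus becomes an equation between faces.\<close>

lemma meet_iff:
  assumes I: "I \<in> K" and J: "J \<subseteq> I" "J \<noteq> {}" and S: "S \<in> sheets I" "S' \<in> sheets I"
  shows "meet_at_cusp J S S' \<longleftrightarrow>
    S \<noteq> S' \<and> face_component J S = face_component J S' \<and> face_component J S \<notin> sheets J"
proof -
  note f = face_component[OF I J sheet_component]
  have "D = face_component J T" if "D \<in> cusp_components J" "D \<subseteq> L closure_of T" "T \<in> sheets I" for D T
    using face_component_eq[OF I J sheet_component[OF that(3)] _ that(2)] that(1)
    unfolding cusp_components_def by simp
  then have "(\<exists>D\<in>cusp_components J. D \<subseteq> L closure_of S \<and> D \<subseteq> L closure_of S') \<longleftrightarrow>
    face_component J S = face_component J S' \<and> face_component J S \<in> cusp_components J"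
    using S f(2)[OF S(1)] f(2)[OF S(2)] by metis
  moreover have "face_component J S \<in> cusp_components J \<longleftrightarrow> face_component J S \<notin> sheets J"
    using component_dichotomy[OF face_in_complex[OF I J] f(1)[OF S(1)]] sheets_not_cusp by blast
  ultimately show ?thesis unfolding meet_at_cusp_def by blast
qed

lemma meet_sym: "meet_at_cusp J S S' \<Longrightarrow> meet_at_cusp J S' S"
  unfolding meet_at_cusp_def by blast

lemma cusp_partner:
  assumes "I \<in> K" "J \<subseteq> I" "J \<noteq> {}" "S \<in> sheets I" "face_component J S \<notin> sheets J"
  shows "\<exists>!S'. S' \<in> sheets I \<and> meet_at_cusp J S S'"
proof -
  have "S \<in> remaining_sheets J I" using assms remaining_iff by blast
  then have "\<exists>!S'. S' \<in> remaining_sheets J I \<and> meet_at_cusp J S S'"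
    by (rule P3_face(2)[OF assms(1-3)])
  moreover have "S' \<in> remaining_sheets J I \<and> meet_at_cusp J S S' \<longleftrightarrow> S' \<in> sheets I \<and> meet_at_cusp J S S'" for S'
    using remaining_iff[OF assms(1-3)] meet_iff[OF assms(1-4)] by metis
  ultimately show ?thesis by simp
qed

lemma meet_unique:
  assumes I: "I \<in> K" and J: "J \<subseteq> I" "J \<noteq> {}"
    and S: "S \<in> sheets I" "S' \<in> sheets I" "S'' \<in> sheets I"
    and "meet_at_cusp J S S'" "meet_at_cusp J S S''"
  shows "S' = S''"
  using cusp_partner[OF I J S(1)] meet_iff[OF I J S(1,2)] assms(5-) by blast

text \<open>A cusp component cannot end in a sheet, which would be in the closure of both sheets that
  meet there; so sheets meeting above a cell also meet above its faces.\<close>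

lemma meet_face:
  assumes I: "I \<in> K" and F: "F \<subseteq> I" and G: "G \<subseteq> F" "G \<noteq> {}"
    and S: "S \<in> sheets I" "S' \<in> sheets I" and m: "meet_at_cusp F S S'"
  shows "meet_at_cusp G S S'"
proof -
  have F0: "F \<noteq> {}" and GI: "G \<subseteq> I" using F G by auto
  have ne: "S \<noteq> S'" and eq: "face_component F S = face_component F S'"
    using m meet_iff[OF I F F0 S] by auto
  have "face_component G S = face_component G S'"
    using face_component_trans[OF I F G sheet_component] S eq by metis
  then show ?thesis
    using sheet_extension_unique[OF I GI G(2) S] meet_iff[OF I GI G(2) S] ne by blast
qed

text \<open>The partner of \<open>S\<close> above \<open>F\<close> remains a partner above
  \<open>G\<close>, and above \<open>G\<close> there is only one.\<close>

lemma meet_face_iff: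
  assumes I: "I \<in> K" and F: "F \<subseteq> I" and G: "G \<subseteq> F" "G \<noteq> {}"
    and S: "S \<in> sheets I" "S' \<in> sheets I" and r: "face_component F S \<notin> sheets F"
  shows "meet_at_cusp G S S' \<longleftrightarrow> meet_at_cusp F S S'"
proof
  assume m: "meet_at_cusp G S S'"
  have F0: "F \<noteq> {}" and GI: "G \<subseteq> I" using F G by auto
  obtain S'' where S'': "S'' \<in> sheets I" "meet_at_cusp F S S''"
    using cusp_partner[OF I F F0 S(1) r] by blast
  have "meet_at_cusp G S S''" by (rule meet_face[OF I F G S(1) S''])
  then have "S' = S''" using meet_unique[OF I GI G(2) S S''(1) m] by blast
  then show "meet_at_cusp F S S'" using S''(2) by simp
qed (rule meet_face[OF I F G S])

text \<open>A sheet that ends in a cusp above \<open>F\<close> has a partner there, which it still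
  meets above \<open>G\<close>.\<close>

lemma face_remaining:
  assumes I: "I \<in> K" and F: "F \<subseteq> I" and G: "G \<subseteq> F" "G \<noteq> {}" and S: "S \<in> sheets I"
    and r: "face_component F S \<notin> sheets F"
  shows "face_component G S \<notin> sheets G"
proof -
  have F0: "F \<noteq> {}" and GI: "G \<subseteq> I" using F G by auto
  obtain S' where S': "S' \<in> sheets I" "meet_at_cusp F S S'"
    using cusp_partner[OF I F F0 S r] by blast
  then have "meet_at_cusp G S S'" using meet_face[OF I F G S] by blast
  then show ?thesis using meet_iff[OF I GI G(2) S S'(1)] by blast
qed

text \<open>Distinct sheets above \<open>I\<close> have distinct faces as soon as these are sheets,
  so meeting above \<open>G\<close> may be tested on the faces above \<open>F\<close>.\<close>

lemma meet_face_face: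
  assumes I: "I \<in> K" and F: "F \<subseteq> I" and G: "G \<subseteq> F" "G \<noteq> {}"
    and S: "S \<in> sheets I" "S' \<in> sheets I"
    and f: "face_component F S \<in> sheets F" "face_component F S' \<in> sheets F"
  shows "meet_at_cusp G (face_component F S) (face_component F S') \<longleftrightarrow> meet_at_cusp G S S'"
proof -
  have F0: "F \<noteq> {}" and GI: "G \<subseteq> I" using F G by auto
  have "face_component F S = face_component F S' \<longleftrightarrow> S = S'"
    using sheet_extension_unique[OF I F F0 S f(1)] by blast
  then show ?thesis
    using meet_iff[OF face_in_complex[OF I F F0] G f] meet_iff[OF I GI G(2) S]
      face_component_trans[OF I F G sheet_component] S by simp
qed


section \<open>The order and the Maslov grading of the sheets\<close>

lemma above_irrefl: "I \<in> K \<Longrightarrow> \<not> above I S S"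
  using cell_nonempty[of I] unfolding above_def by blast

lemma above_trans: "above I S S' \<Longrightarrow> above I S' S'' \<Longrightarrow> above I S S''"
  unfolding above_def using order.strict_trans by blast

lemma openin_z: "openin L {q \<in> \<Lambda>. zcoord q > c}" "openin L {q \<in> \<Lambda>. zcoord q < c}"
proof -
  show "openin L {q \<in> \<Lambda>. zcoord q > c}"
    using openin_continuous_map_preimage[OF continuous_z, of "{c<..}"] unfolding topspace_L by simp
  show "openin L {q \<in> \<Lambda>. zcoord q < c}"
    using openin_continuous_map_preimage[OF continuous_z, of "{..<c}"] unfolding topspace_L by simp
qed

text \<open>A strict inequality at limit points persists nearby, and by (P2) a single point of
  \<open>e I\<close> decides the order. The converse can fail, because sheets may cross over
  \<open>e J\<close>.\<close>

lemma above_face: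
  assumes I: "I \<in> K" and J: "J \<subseteq> I" "J \<noteq> {}" and S: "S \<in> sheets I" "S' \<in> sheets I"
    and f: "face_component J S \<in> sheets J" "face_component J S' \<in> sheets J"
    and a: "above J (face_component J S) (face_component J S')"
  shows "above I S S'"
proof -
  have JK: "J \<in> K" using face_in_complex[OF I J] .
  obtain x where x: "x \<in> e J" using cell_nonempty[OF JK] by blast
  obtain p where p: "p \<in> face_component J S" "base_proj p = x"
    by (rule component_over[OF JK sheet_component[OF f(1)] x])
  obtain p' where p': "p' \<in> face_component J S'" "base_proj p' = x"
    by (rule component_over[OF JK sheet_component[OF f(2)] x])
  have "zcoord p > zcoord p'"
    using a x sheet_z_eq[OF JK f(1) p(1)] sheet_z_eq[OF JK f(2) p'(1)] p(2) p'(2)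
    unfolding above_def by auto
  then obtain c where c: "zcoord p > c" "c > zcoord p'" using dense by blast
  have \<Lambda>: "p \<in> \<Lambda>" "p' \<in> \<Lambda>"
    using component_subset[OF sheet_component[OF f(1)]] component_subset[OF sheet_component[OF f(2)]] p(1) p'(1)
    by blast+
  obtain q q' where q: "q \<in> S" "q' \<in> S'" "base_proj q = base_proj q'"
    "q \<in> {q \<in> \<Lambda>. zcoord q > c}" "q' \<in> {q \<in> \<Lambda>. zcoord q < c}"
    by (rule tube2[OF I J sheet_component[OF S(1)] sheet_component[OF S(2)] p(1) p'(1) _
          openin_z(1)[of c] _ openin_z(2)[of c]])
      (simp_all add: p p' c \<Lambda>)
  then have "sheet_z S (base_proj q) > sheet_z S' (base_proj q)"
    using sheet_z_eq[OF I S(1) q(1)] sheet_z_eq[OF I S(2) q(2)] by simp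
  moreover have "base_proj q \<in> e I" using component_subset[OF sheet_component[OF S(1)]] q(1) by blast
  ultimately show ?thesis
    using P2 I S unfolding P2_def above_def by (metis order.asym order.irrefl)
qed

text \<open>The square loses the sign of the distinguished coordinate, but its cube determines
  it.\<close>

lemma standard_cusp_inj: "standard_cusp i s = standard_cusp i t \<Longrightarrow> s = t"
proof -
  assume eq: "standard_cusp i s = standard_cusp i t"
  then have "s $ i ^ 3 = t $ i ^ 3" by (simp add: standard_cusp_def)
  then have i: "s $ i = t $ i"
    by (metis odd_numeral odd_real_root_power_cancel)
  have v: "(\<chi> j. if j = i then (s $ i) ^ 2 else s $ j) = (\<chi> j. if j = i then (t $ i) ^ 2 else t $ j)"
    using eq by (simp add: standard_cusp_def)
  have "s $ j = t $ j" if "j \<noteq> i" for j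
    using arg_cong[OF v, of "\<lambda>w. w $ j"] that by simp
  then show "s = t" using i by (metis vec_eq_iff)
qed

text \<open>The standard cusp is an injective map, so sheets have different heights near a cusp at which
  they meet.\<close>

lemma front_injective_at_cusp:
  assumes "p \<in> C"
  obtains N where "openin L N" "p \<in> N"
    "\<And>q q'. q \<in> N \<Longrightarrow> q' \<in> N \<Longrightarrow> base_proj q = base_proj q' \<Longrightarrow> zcoord q = zcoord q' \<Longrightarrow> q = q'"
proof -
  have "front_cusp_at M A \<Lambda> C p"
    using mild assms by (simp add: mild_front_singularities_def)
  then obtain i W \<psi> c Q G where l: "local_param M A \<Lambda> W \<psi>" "0 \<in> W" "\<psi> 0 = p" "diffeo_on Q G"
    and std: "\<forall>t\<in>W. standard_cusp i t \<in> Q \<and> front_coords c (\<psi> t) = G (standard_cusp i t)"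
    unfolding front_cusp_at_def by blast
  have "q = q'" if q: "q \<in> \<psi> ` W" "q' \<in> \<psi> ` W" "base_proj q = base_proj q'" "zcoord q = zcoord q'" for q q'
  proof -
    obtain t t' where t: "t \<in> W" "q = \<psi> t" "t' \<in> W" "q' = \<psi> t'" using q by blast
    have "front_coords c q = front_coords c q'" using q by (simp add: front_coords_def)
    then have "G (standard_cusp i t) = G (standard_cusp i t')" using t std by simp
    moreover have "inj_on G Q" using l(4) by (simp add: diffeo_on_def)
    ultimately have "standard_cusp i t = standard_cusp i t'" using std t by (meson inj_onD)
    then show ?thesis using standard_cusp_inj t by blast
  qed
  moreover have "openin L (\<psi> ` W)" using l(1) by (simp add: local_param_def)
  moreover have "p \<in> \<psi> ` W" using l by blast
  ultimately show thesis using that by blast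
qed

lemma cusp_point:
  assumes I: "I \<in> K" and J: "J \<subseteq> I" "J \<noteq> {}" and S: "S \<in> sheets I" "S' \<in> sheets I"
    and m: "meet_at_cusp J S S'"
  obtains p where "p \<in> face_component J S" "p \<in> face_component J S'" "p \<in> C" "p \<in> \<Lambda>"
proof -
  have m': "face_component J S = face_component J S'" "face_component J S \<notin> sheets J"
    using m meet_iff[OF I J S] by auto
  note f = face_component(1)[OF I J sheet_component[OF S(1)]]
  have "face_component J S \<in> cusp_components J"
    using component_dichotomy[OF face_in_complex[OF I J] f] m'(2) by blast
  then have "face_component J S \<subseteq> C" by (simp add: cusp_components_def)
  moreover obtain p where "p \<in> face_component J S" using component_nonempty[OF f] by blast
  ultimately show thesis using that m'(1) component_subset[OF f] by blast
qed

text \<open>Near the cusp, points of equal height over one base point coincide, but distinct sheets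
  are disjoint. So the heights differ at one point, and (P2) spreads this over the cell.\<close>

lemma meet_not_level:
  assumes I: "I \<in> K" and J: "J \<subseteq> I" "J \<noteq> {}" and S: "S \<in> sheets I" "S' \<in> sheets I"
    and m: "meet_at_cusp J S S'"
  shows "above I S S' \<or> above I S' S"
proof -
  obtain p where p: "p \<in> face_component J S" "p \<in> face_component J S'" "p \<in> C"
    by (rule cusp_point[OF I J S m])
  obtain N where N: "openin L N" "p \<in> N"
    "\<And>q q'. q \<in> N \<Longrightarrow> q' \<in> N \<Longrightarrow> base_proj q = base_proj q' \<Longrightarrow> zcoord q = zcoord q' \<Longrightarrow> q = q'"
    by (rule front_injective_at_cusp[OF p(3)]) blast
  obtain q q' where q: "q \<in> S" "q' \<in> S'" "base_proj q = base_proj q'" "q \<in> N" "q' \<in> N"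
    by (rule tube2[OF I J sheet_component[OF S(1)] sheet_component[OF S(2)] p(1,2) refl N(1,2,1,2)])
  have "S \<noteq> S'" using m by (simp add: meet_at_cusp_def)
  then have "q \<noteq> q'"
    using component_disjoint[OF sheet_component[OF S(1)] sheet_component[OF S(2)] q(1)] q(2) by blast
  then have "zcoord q \<noteq> zcoord q'" using N(3) q(3-5) by blast
  then have "sheet_z S (base_proj q) \<noteq> sheet_z S' (base_proj q)"
    using sheet_z_eq[OF I S(1) q(1)] sheet_z_eq[OF I S(2) q(2)] q(3) by simp
  moreover have "base_proj q \<in> e I" using component_subset[OF sheet_component[OF S(1)]] q(1) by blast
  ultimately show ?thesis
    using P2 I S unfolding P2_def above_def by metis
qed

text \<open>For sheets that meet at a cusp, \<open>above_face\<close> becomes an equivalence: such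
  sheets are ordered above \<open>F\<close>, and the wrong order there would carry over to
  \<open>I\<close>. So the entry 1 of a cusp sits in the same position seen from \<open>F\<close>
  and from \<open>I\<close>.\<close>

lemma above_face_cusp:
  assumes I: "I \<in> K" and F: "F \<subseteq> I" and G: "G \<subseteq> F" "G \<noteq> {}"
    and S: "S \<in> sheets I" "S' \<in> sheets I"
    and f: "face_component F S \<in> sheets F" "face_component F S' \<in> sheets F"
    and m: "meet_at_cusp G (face_component F S) (face_component F S')"
  shows "above F (face_component F S) (face_component F S') \<longleftrightarrow> above I S S'"
proof
  have F0: "F \<noteq> {}" using G by auto
  show "above I S S'" if "above F (face_component F S) (face_component F S')"
    by (rule above_face[OF I F F0 S f that])
  show "above F (face_component F S) (face_component F S')" if a: "above I S S'"
  proof (rule ccontr)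
    assume "\<not> ?thesis"
    then have "above F (face_component F S') (face_component F S)"
      using meet_not_level[OF face_in_complex[OF I F F0] G f m] by blast
    then have "above I S' S"
      by (rule above_face[OF I F F0 S(2,1) f(2,1)])
    then show False using above_trans[OF a] above_irrefl[OF I] by blast
  qed
qed

section \<open>The Maslov potential on faces and at cusps\<close>

lemma sheet_mu_eq:
  assumes S: "S \<in> sheets I" and p: "p \<in> S"
  shows "sheet_mu S = \<mu> p"
proof -
  have "continuous_map (subtopology (jet_topology M A) (\<Lambda> - C)) (discrete_topology UNIV) \<mu>"
    using maslov by (simp add: maslov_potential_def)
  moreover have "connectedin (subtopology (jet_topology M A) (\<Lambda> - C)) S"
    using component_connected[OF sheet_component[OF S]] S unfolding sheets_def
    by (simp add: connectedin_subtopology)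
  ultimately have "connectedin (discrete_topology UNIV) (\<mu> ` S)"
    by (rule connectedin_continuous_map_image)
  then obtain k where "\<mu> ` S \<subseteq> {k}"
    unfolding connectedin_discrete_topology by blast
  then have "\<forall>q\<in>S. \<mu> q = \<mu> p" using p by blast
  show ?thesis
    unfolding sheet_mu_def
  proof (rule the_equality)
    show "\<forall>q\<in>S. \<mu> q = \<mu> p" by fact
    show "k = \<mu> p" if "\<forall>q\<in>S. \<mu> q = k" for k using that p by simp
  qed
qed

text \<open>A point of the face is a limit of \<open>S\<close> and lies off the cusp locus, where
  \<mu> is locally constant. Degrees therefore survive the passage between a sheet and its
  face.\<close>

lemma sheet_mu_face:
  assumes I: "I \<in> K" and J: "J \<subseteq> I" "J \<noteq> {}" and S: "S \<in> sheets I" and f: "face_component J S \<in> sheets J"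
  shows "sheet_mu (face_component J S) = sheet_mu S"
proof -
  obtain p where p: "p \<in> face_component J S" using component_nonempty[OF sheet_component[OF f]] by blast
  have p\<Lambda>: "p \<in> \<Lambda> - C" using f p unfolding sheets_def by blast
  have "continuous_map (subtopology (jet_topology M A) (\<Lambda> - C)) (discrete_topology UNIV) \<mu>"
    using maslov by (simp add: maslov_potential_def)
  then have "openin (subtopology (jet_topology M A) (\<Lambda> - C))
      {q \<in> topspace (subtopology (jet_topology M A) (\<Lambda> - C)). \<mu> q \<in> {\<mu> p}}"
    by (rule openin_continuous_map_preimage) simp
  then obtain T where T: "openin (jet_topology M A) T"
    "{q \<in> topspace (subtopology (jet_topology M A) (\<Lambda> - C)). \<mu> q \<in> {\<mu> p}} = T \<inter> (\<Lambda> - C)"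
    unfolding openin_subtopology by blast
  have "p \<in> topspace (subtopology (jet_topology M A) (\<Lambda> - C))"
    using p\<Lambda> Legendrian_topspace by simp
  then have "p \<in> T" using T(2) by blast
  have "openin L (T \<inter> \<Lambda>)" using T(1) by (rule openin_subtopology_Int)
  moreover have "p \<in> L closure_of S" using face_component(2)[OF I J sheet_component[OF S]] p by blast
  ultimately obtain q where q: "q \<in> S" "q \<in> T \<inter> \<Lambda>"
    using closure_of_meets[of p L S "T \<inter> \<Lambda>"] \<open>p \<in> T\<close> p\<Lambda> by blast
  then have "\<mu> q = \<mu> p" using T(2) S unfolding sheets_def by blast
  then show ?thesis using sheet_mu_eq[OF S q(1)] sheet_mu_eq[OF f p] by simp
qed

text \<open>The jump of \<mu> is a statement about pairs of points over one base point near the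
  cusp; \<open>tube2\<close> finds such a pair on the two sheets.\<close>

lemma sheet_mu_cusp:
  assumes I: "I \<in> K" and J: "J \<subseteq> I" "J \<noteq> {}" and S: "S \<in> sheets I" "S' \<in> sheets I"
    and m: "meet_at_cusp J S S'" and a: "above I S S'"
  shows "sheet_mu S = sheet_mu S' + 1"
proof -
  obtain p where p: "p \<in> face_component J S" "p \<in> face_component J S'" "p \<in> C"
    by (rule cusp_point[OF I J S m])
  obtain N where N: "openin L N" "p \<in> N"
    "\<And>q q'. q \<in> N - C \<Longrightarrow> q' \<in> N - C \<Longrightarrow> base_proj q = base_proj q' \<and> zcoord q > zcoord q' \<Longrightarrow> \<mu> q = \<mu> q' + 1"
    using maslov p(3) unfolding maslov_potential_def by meson
  obtain q q' where q: "q \<in> S" "q' \<in> S'" "base_proj q = base_proj q'" "q \<in> N" "q' \<in> N"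
    by (rule tube2[OF I J sheet_component[OF S(1)] sheet_component[OF S(2)] p(1,2) refl N(1,2,1,2)])
  have "base_proj q \<in> e I" using component_subset[OF sheet_component[OF S(1)]] q(1) by blast
  then have "zcoord q > zcoord q'"
    using a sheet_z_eq[OF I S(1) q(1)] sheet_z_eq[OF I S(2) q(2)] q(3) unfolding above_def by auto
  moreover have "q \<in> N - C" "q' \<in> N - C" using q S unfolding sheets_def by blast+
  ultimately have "\<mu> q = \<mu> q' + 1" using N(3) q(3) by blast
  then show ?thesis using sheet_mu_eq[OF S(1) q(1)] sheet_mu_eq[OF S(2) q(2)] by simp
qed

end

section \<open>Finiteness of the sets of sheets\<close>

lemma finite_closed_functions:
  fixes T :: "('v \<Rightarrow> real) set"
  assumes "finite T"
  shows "closed T"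
proof -
  have "closed (\<Inter>v. {t. t v = s v})" for s :: "'v \<Rightarrow> real"
    by (intro closed_INT ballI closed_Collect_eq continuous_on_product_coordinates continuous_on_const)
  moreover have "(\<Inter>v. {t. t v = s v}) = {s}" for s :: "'v \<Rightarrow> real"
    by auto
  ultimately have "closed {s}" for s :: "'v \<Rightarrow> real"
    by simp
  then have "closed (\<Union>s\<in>T. {s})"
    using assms by (intro closed_UN) auto
  then show ?thesis by simp
qed

context compatible_sheets
begin

text \<open>If infinitely many simplices contained \<open>J\<close>, one point from each could be
  chosen in a fixed compact set, and these points would accumulate. But every set of them is closed
  in the weak topology.\<close>

lemma finite_star:
  assumes J: "J \<in> K"
  shows "finite {I \<in> K. J \<subseteq> I}"
proof (rule ccontr)
  let ?R = "realization K" and ?star = "{I \<in> K. J \<subseteq> I}"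
  assume inf: "infinite ?star"
  obtain x where x: "x \<in> e J" using cell_nonempty[OF J] by blast
  then have "x \<in> topspace M" using cell_subset[OF J] by blast
  then obtain U N where U: "openin M U" "compactin M N" "x \<in> U" "U \<subseteq> N"
    using locally_compact_manifold[OF manifold] unfolding locally_compact_space_def by meson
  have "\<exists>t\<in>open_simplex I. h t \<in> U" if "I \<in> ?star" for I
  proof -
    have "x \<in> M closure_of (e I)"
      using face_cell_le[of I J] that simplex_nonempty[OF J] x unfolding cell_le_def by blast
    from closure_of_meets[OF this U(1,3)] show ?thesis unfolding cell_def by blast
  qed
  then obtain t where t: "\<And>I. I \<in> ?star \<Longrightarrow> t I \<in> open_simplex I" "\<And>I. I \<in> ?star \<Longrightarrow> h (t I) \<in> U"
    by metis
  have tR: "t ` ?star \<subseteq> topspace ?R"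
    using t(1) open_simplex_in_realization by blast
  have "inj_on t ?star"
  proof (rule inj_onI)
    fix I I' assume I: "I \<in> ?star" "I' \<in> ?star" "t I = t I'"
    have "{v. t I v \<noteq> 0} = {v. t I' v \<noteq> 0}" by (simp only: I(3))
    then show "I = I'"
      unfolding open_simplex_support[OF t(1)[OF I(1)]] open_simplex_support[OF t(1)[OF I(2)]] .
  qed
  then have "infinite (t ` ?star)" using inf finite_imageD by blast
  then have "infinite (h ` t ` ?star)"
    using inj_on_subset[OF inj_h tR] finite_imageD by blast
  moreover have "h ` t ` ?star \<subseteq> N" using t(2) U(4) by blast
  ultimately obtain y where y: "y \<in> M derived_set_of (h ` t ` ?star)"
    using compactin_imp_Bolzano_Weierstrass[OF U(2)] by blast
  \<comment> \<open>A closed simplex contains a chosen point only if it contains the vertices of the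
    corresponding simplex; this leaves finitely many of its faces, so every trace is finite.\<close>
  have closed: "closedin ?R T" if T: "T \<subseteq> t ` ?star" for T
  proof -
    have TR: "T \<subseteq> topspace ?R" using T tR by blast
    have "openin ?R (topspace ?R - T)"
      unfolding openin_realization
    proof (intro conjI ballI)
      show "topspace ?R - T \<subseteq> (\<Union>I\<in>K. closed_simplex I)" by (auto simp: topspace_realization)
      fix I assume I: "I \<in> K"
      have "T \<inter> closed_simplex I \<subseteq> t ` Pow I"
      proof
        fix s assume s: "s \<in> T \<inter> closed_simplex I"
        then obtain I' where I': "I' \<in> ?star" "s = t I'" using T by blast
        then have "I' = {v. s v \<noteq> 0}" using t(1) open_simplex_support by metis
        also have "\<dots> \<subseteq> I" using s closed_simplex_support(1)[OF simplex_finite[OF I]] by blast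
        finally show "s \<in> t ` Pow I" using I' by blast
      qed
      then have "finite (T \<inter> closed_simplex I)"
        using simplex_finite[OF I] finite_subset by blast
      then have "open (- (T \<inter> closed_simplex I))"
        by (intro open_Compl finite_closed_functions)
      moreover have "(topspace ?R - T) \<inter> closed_simplex I = closed_simplex I \<inter> - (T \<inter> closed_simplex I)"
        using I by (auto simp: topspace_realization)
      ultimately show "openin (top_of_set (closed_simplex I)) ((topspace ?R - T) \<inter> closed_simplex I)"
        by (simp only: openin_open_Int)
    qed
    then show ?thesis using TR by (simp add: closedin_def)
  qed
  \<comment> \<open>The accumulation point may itself be a chosen point, so it is left out before
    closedness is used.\<close>
  define T where "T = {s \<in> t ` ?star. h s \<noteq> y}"
  have "T \<subseteq> t ` ?star" unfolding T_def by blast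
  from closed[OF this] have "closedin M (h ` T)"
    using homeomorphic_imp_closed_map[OF homeo_h] by (simp add: closed_map_def)
  then have "openin M (topspace M - h ` T)" by blast
  moreover have "y \<in> topspace M - h ` T"
    using y unfolding T_def derived_set_of_def by blast
  moreover have "y \<in> S \<and> openin M S \<longrightarrow> (\<exists>y'\<noteq>y. y' \<in> h ` t ` ?star \<and> y' \<in> S)" for S
    using y unfolding derived_set_of_def mem_Collect_eq by (rule spec[OF conjunct2])
  ultimately have "\<exists>y'\<noteq>y. y' \<in> h ` t ` ?star \<and> y' \<in> topspace M - h ` T"
    by (simp only: simp_thms)
  then obtain y' where "y' \<noteq> y" "y' \<in> h ` t ` ?star" "y' \<notin> h ` T"
    by blast
  then show False unfolding T_def by blast
qed

lemma maximal_simplex: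
  assumes "J \<in> K"
  obtains I where "I \<in> K" "J \<subseteq> I" "\<And>I'. I' \<in> K \<Longrightarrow> I \<subseteq> I' \<Longrightarrow> I' = I"
proof -
  obtain I where I: "I \<in> {I \<in> K. J \<subseteq> I}" "\<forall>I'\<in>{I \<in> K. J \<subseteq> I}. I \<subseteq> I' \<longrightarrow> I = I'"
    using finite_has_maximal[OF finite_star[OF assms]] assms by blast
  show thesis
  proof (rule that)
    show "I \<in> K" "J \<subseteq> I" using I(1) by simp_all
    show "I' = I" if "I' \<in> K" "I \<subseteq> I'" for I'
    proof -
      have "I' \<in> {I \<in> K. J \<subseteq> I}" using that I(1) by auto
      then show ?thesis using I(2) that(2) by blast
    qed
  qed
qed

text \<open>An open simplex meets a closed simplex only when its vertices belong to the latter,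
  which maximality restricts to the simplex itself.\<close>

lemma openin_maximal_cell:
  assumes I: "I \<in> K" and max: "\<And>I'. I' \<in> K \<Longrightarrow> I \<subseteq> I' \<Longrightarrow> I' = I"
  shows "openin M (e I)"
proof -
  have "openin (realization K) (open_simplex I)"
    unfolding openin_realization
  proof (intro conjI ballI)
    show "open_simplex I \<subseteq> (\<Union>I\<in>K. closed_simplex I)"
      using open_simplex_in_realization[OF I] by (simp add: topspace_realization)
    fix I' assume I': "I' \<in> K"
    show "openin (top_of_set (closed_simplex I')) (open_simplex I \<inter> closed_simplex I')"
    proof (cases "I' = I")
      case True
      have "open {t :: 'v \<Rightarrow> real. 0 < t v}" for v
        by (intro open_Collect_less continuous_intros continuous_on_product_coordinates)
      then have "open (\<Inter>v\<in>I. {t :: 'v \<Rightarrow> real. 0 < t v})"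
        using simplex_finite[OF I] by (intro open_INT) auto
      moreover have "open_simplex I \<inter> closed_simplex I = closed_simplex I \<inter> (\<Inter>v\<in>I. {t. 0 < t v})"
        by (auto simp: open_simplex_def)
      ultimately show ?thesis using True by (simp add: openin_open_Int)
    next
      case False
      have "open_simplex I \<inter> closed_simplex I' = {}"
      proof (rule ccontr)
        assume "\<not> ?thesis"
        then obtain t where t: "t \<in> open_simplex I" "t \<in> closed_simplex I'" by blast
        then have "I \<subseteq> I'"
          using open_simplex_support closed_simplex_support(1)[OF simplex_finite[OF I']] by metis
        then show False using max I' False by blast
      qed
      then show ?thesis by simp
    qed
  qed
  then show ?thesis
    using homeomorphic_imp_open_map[OF homeo_h] by (simp add: open_map_def cell_def)
qed

text \<open>\<Lambda> is locally Euclidean, hence locally connected: a small parametrised ball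
  around a point stays over the open cell and is absorbed by the component.\<close>

lemma openin_component:
  assumes op: "openin M (e I)" and D: "D \<in> components_above I"
  shows "openin L D"
proof (subst openin_subopen, intro ballI)
  fix p assume p: "p \<in> D"
  have p\<Lambda>: "p \<in> \<Lambda>" "base_proj p \<in> e I" using component_subset[OF D] p by blast+
  then obtain W \<psi> where l: "local_param M A \<Lambda> W \<psi>" and "p \<in> \<psi> ` W"
    using legendrian unfolding closed_legendrian_def closed_submanifold_def by blast
  then obtain t where t: "t \<in> W" "p = \<psi> t" by blast
  let ?X = "subtopology (jet_topology M A) (\<psi> ` W)"
  have opW: "open W" and op\<psi>: "openin L (\<psi> ` W)" and hom: "homeomorphic_map (top_of_set W) ?X \<psi>"
    using l by (simp_all add: local_param_def)
  have \<psi>\<Lambda>: "\<psi> ` W \<subseteq> \<Lambda>" using openin_subset[OF op\<psi>] unfolding topspace_L .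
  then have X: "?X = subtopology L (\<psi> ` W)"
    by (simp add: subtopology_subtopology inf.absorb2)
  have "continuous_map (top_of_set W) L \<psi>"
    using homeomorphic_imp_continuous_map[OF hom] unfolding X
    by (simp only: continuous_map_in_subtopology)
  then have "openin (top_of_set W) {s \<in> topspace (top_of_set W). \<psi> s \<in> {q \<in> \<Lambda>. base_proj q \<in> e I}}"
    by (rule openin_continuous_map_preimage[OF _ open_base_preimage[OF op]])
  then have "open {s \<in> W. \<psi> s \<in> {q \<in> \<Lambda>. base_proj q \<in> e I}}"
    using opW openin_open_trans by fastforce
  moreover have "t \<in> {s \<in> W. \<psi> s \<in> {q \<in> \<Lambda>. base_proj q \<in> e I}}"
    using t p\<Lambda> by simp
  ultimately obtain r where r: "r > 0" "ball t r \<subseteq> {s \<in> W. \<psi> s \<in> {q \<in> \<Lambda>. base_proj q \<in> e I}}"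
    by (rule openE)
  have bW: "ball t r \<subseteq> W" and be: "\<And>q. q \<in> \<psi> ` ball t r \<Longrightarrow> base_proj q \<in> e I"
    using r(2) by blast+
  have "openin (top_of_set W) (ball t r)"
    using bW by (simp add: openin_open_eq opW)
  then have "openin ?X (\<psi> ` ball t r)"
    using homeomorphic_imp_open_map[OF hom] by (simp add: open_map_def)
  then have opB: "openin L (\<psi> ` ball t r)"
    unfolding X using op\<psi> by (rule openin_trans_full)
  have "connectedin (top_of_set W) (ball t r)"
    using bW by (simp add: connectedin_subtopology)
  then have "connectedin L (\<psi> ` ball t r)"
    using connectedin_continuous_map_image[OF \<open>continuous_map (top_of_set W) L \<psi>\<close>] by blast
  moreover have "p \<in> \<psi> ` ball t r" using t r(1) by simp
  ultimately have "\<psi> ` ball t r \<subseteq> D"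
    using component_maximal[OF D _ be] p by blast
  then show "\<exists>T. openin L T \<and> p \<in> T \<and> T \<subseteq> D"
    using opB \<open>p \<in> \<psi> ` ball t r\<close> by blast
qed

lemma finite_components_maximal:
  assumes I: "I \<in> K" and op: "openin M (e I)"
  shows "finite (components_above I)"
proof -
  obtain x where x: "x \<in> e I" using cell_nonempty[OF I] by blast
  have "closedin M {x}"
    using Hausdorff_M x cell_subset[OF I] by (intro closedin_Hausdorff_singleton) auto
  then have "closedin L {p \<in> topspace L. base_proj p \<in> {x}}"
    using continuous_base closedin_continuous_map_preimage by blast
  then have "compactin L {p \<in> topspace L. base_proj p \<in> {x}}"
    by (rule closedin_compact_space[OF compact_L])
  then have "compactin L {p \<in> \<Lambda>. base_proj p = x}" unfolding topspace_L by simp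
  moreover have "{p \<in> \<Lambda>. base_proj p = x} \<subseteq> \<Union>(components_above I)"
  proof
    fix p assume "p \<in> {p \<in> \<Lambda>. base_proj p = x}"
    then have "p \<in> \<Lambda>" "base_proj p \<in> e I" using x by simp_all
    then obtain D where "D \<in> components_above I" "p \<in> D" by (rule component_exists)
    then show "p \<in> \<Union>(components_above I)" by blast
  qed
  ultimately have "\<exists>\<F>. finite \<F> \<and> \<F> \<subseteq> components_above I \<and> {p \<in> \<Lambda>. base_proj p = x} \<subseteq> \<Union>\<F>"
    by (intro compactinD[OF _ openin_component[OF op]])
  then obtain \<F> where \<F>: "finite \<F>" "\<F> \<subseteq> components_above I" "{p \<in> \<Lambda>. base_proj p = x} \<subseteq> \<Union>\<F>"
    by blast
  have "components_above I \<subseteq> \<F>"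
  proof
    fix D assume D: "D \<in> components_above I"
    obtain p where p: "p \<in> D" "base_proj p = x" by (rule component_over[OF I D x])
    then have "p \<in> {p \<in> \<Lambda>. base_proj p = x}" using component_subset[OF D] by blast
    then obtain D' where D': "D' \<in> \<F>" "p \<in> D'" using \<F>(3) by blast
    then have "D = D'" using component_disjoint[OF D _ p(1) D'(2)] \<F>(2) by blast
    then show "D \<in> \<F>" using D'(1) by simp
  qed
  then show ?thesis using \<F>(1) finite_subset by blast
qed

text \<open>Components need not be open above a smaller cell, but by (P3) each sheet is the face of
  a sheet above a maximal cell, where finiteness is known.\<close>

lemma finite_sheets:
  assumes J: "J \<in> K"
  shows "finite (sheets J)"
proof -
  obtain I where I: "I \<in> K" "J \<subseteq> I" "\<And>I'. I' \<in> K \<Longrightarrow> I \<subseteq> I' \<Longrightarrow> I' = I"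
    by (rule maximal_simplex[OF J]) blast
  have "finite (components_above I)"
    by (rule finite_components_maximal[OF I(1) openin_maximal_cell[OF I(1,3)]])
  moreover have "sheets J \<subseteq> face_component J ` components_above I"
  proof
    fix T assume T: "T \<in> sheets J"
    show "T \<in> face_component J ` components_above I"
      using extend_sheet[OF I(1,2) simplex_nonempty[OF J] T] sheet_component by (metis image_eqI)
  qed
  ultimately show ?thesis using finite_surj by blast
qed

end

section \<open>Evaluation of the free algebra\<close>

definition eval_word :: "('g \<Rightarrow> 'k::comm_ring_1) \<Rightarrow> 'g list \<Rightarrow> 'k" where
  "eval_word x w = prod_list (map x w)"

definition eval_alg :: "('g \<Rightarrow> 'k::comm_ring_1) \<Rightarrow> 'g free_alg \<Rightarrow> 'k" where
  "eval_alg x a = (\<Sum>w\<in>Poly_Mapping.keys a. of_int (Poly_Mapping.lookup a w) * eval_word x (letters w))"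

lemma eval_alg_superset:
  assumes "finite F" "Poly_Mapping.keys a \<subseteq> F"
  shows "eval_alg x a = (\<Sum>w\<in>F. of_int (Poly_Mapping.lookup a w) * eval_word x (letters w))"
  unfolding eval_alg_def using assms
  by (intro sum.mono_neutral_left) (auto simp: in_keys_iff)

lemma eval_alg_add: "eval_alg x (a + b) = eval_alg x a + eval_alg x b"
proof -
  let ?F = "Poly_Mapping.keys a \<union> Poly_Mapping.keys b"
  have "finite ?F" "Poly_Mapping.keys (a + b) \<subseteq> ?F"
    by (simp_all add: Poly_Mapping.keys_add)
  then show ?thesis
    by (simp add: eval_alg_superset[of ?F] lookup_add distrib_right sum.distrib)
qed

lemma eval_alg_zero [simp]: "eval_alg x 0 = 0"
  by (simp add: eval_alg_def)

lemma eval_alg_sum: "eval_alg x (\<Sum>i\<in>I. f i) = (\<Sum>i\<in>I. eval_alg x (f i))"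
  by (induction I rule: infinite_finite_induct) (simp_all add: eval_alg_add)

lemma eval_alg_single: "eval_alg x (Poly_Mapping.single w n) = of_int n * eval_word x (letters w)"
  by (simp add: eval_alg_def)

lemma eval_alg_monomial: "eval_alg x (monomial w) = eval_word x w"
  by (simp add: monomial_def eval_alg_single)

lemma eval_alg_one [simp]: "eval_alg x 1 = 1"
  using eval_alg_monomial[of x "[]"] by (simp add: eval_word_def)

lemma free_alg_expand:
  "a = (\<Sum>w\<in>Poly_Mapping.keys a. Poly_Mapping.single w (Poly_Mapping.lookup a w))"
  for a :: "'g free_alg"
  by (rule poly_mapping_eqI) (simp add: lookup_sum lookup_single when_def in_keys_iff sum.delta)

lemma eval_alg_mult: "eval_alg x (a * b) = eval_alg x a * eval_alg x b"
proof -
  have "a * b = (\<Sum>u\<in>Poly_Mapping.keys a. Poly_Mapping.single u (Poly_Mapping.lookup a u)) *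
      (\<Sum>w\<in>Poly_Mapping.keys b. Poly_Mapping.single w (Poly_Mapping.lookup b w))"
    by (simp only: free_alg_expand[symmetric])
  also have "\<dots> = (\<Sum>u\<in>Poly_Mapping.keys a. \<Sum>w\<in>Poly_Mapping.keys b.
      Poly_Mapping.single (u + w) (Poly_Mapping.lookup a u * Poly_Mapping.lookup b w))"
    by (simp add: sum_product mult_single)
  finally show ?thesis
    by (simp add: eval_alg_sum eval_alg_single eval_word_def plus_word_def)
      (simp add: eval_alg_def eval_word_def sum_product mult_ac)
qed

lemma eval_alg_uminus: "eval_alg x (- a) = - eval_alg x a"
  using eval_alg_add[of x a "- a"] by (simp add: add_eq_0_iff)

lemma eval_alg_diff: "eval_alg x (a - b) = eval_alg x a - eval_alg x b"
  using eval_alg_add[of x a "- b"] by (simp add: eval_alg_uminus)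

lemma eval_alg_parity: "eval_alg x (parity_sign d) = parity_sign d"
  by (simp add: parity_sign_def eval_alg_uminus)

lemma eval_alg_sign: "eval_alg x ((- 1) ^ k) = (- 1) ^ k"
  by (induction k) (simp_all add: eval_alg_mult eval_alg_uminus)

section \<open>The subalgebra generated by a set of letters\<close>

lemma free_algebra_add:
  "a \<in> free_algebra G \<Longrightarrow> b \<in> free_algebra G \<Longrightarrow> a + b \<in> free_algebra G"
  using Poly_Mapping.keys_add[of a b] unfolding free_algebra_def by blast

lemma free_algebra_zero: "0 \<in> free_algebra G"
  by (simp add: free_algebra_def)

lemma free_algebra_sum:
  "(\<And>i. i \<in> I \<Longrightarrow> f i \<in> free_algebra G) \<Longrightarrow> (\<Sum>i\<in>I. f i) \<in> free_algebra G"
  by (induction I rule: infinite_finite_induct) (simp_all add: free_algebra_zero free_algebra_add)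

lemma free_algebra_single: "set (letters w) \<subseteq> G \<Longrightarrow> Poly_Mapping.single w n \<in> free_algebra G"
  by (simp add: free_algebra_def)

lemma free_algebra_monomial: "set w \<subseteq> G \<Longrightarrow> monomial w \<in> free_algebra G"
  by (simp add: monomial_def free_algebra_single)

lemma free_algebra_one: "1 \<in> free_algebra G"
  using free_algebra_monomial[of "[]" G] by simp

lemma free_algebra_mult:
  assumes "a \<in> free_algebra G" "b \<in> free_algebra G"
  shows "a * b \<in> free_algebra G"
proof -
  have "set (letters (u + w)) \<subseteq> G" if "u \<in> Poly_Mapping.keys a" "w \<in> Poly_Mapping.keys b" for u w
    using assms that by (auto simp: free_algebra_def plus_word_def)
  then show ?thesis
    using keys_mult[of a b] unfolding free_algebra_def by blast
qed

lemma free_algebra_uminus: "a \<in> free_algebra G \<Longrightarrow> - a \<in> free_algebra G"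
  by (simp add: free_algebra_def)

lemma free_algebra_diff:
  "a \<in> free_algebra G \<Longrightarrow> b \<in> free_algebra G \<Longrightarrow> a - b \<in> free_algebra G"
  using free_algebra_add[OF _ free_algebra_uminus, of a G b] by simp

lemma free_algebra_sign: "(- 1) ^ k \<in> free_algebra G"
  by (induction k) (simp_all add: free_algebra_one free_algebra_mult free_algebra_uminus)

lemma free_algebra_parity: "parity_sign d \<in> free_algebra G"
  by (simp add: parity_sign_def free_algebra_one free_algebra_uminus)

lemma free_algebra_of_int: "of_int n \<in> free_algebra G"
proof -
  have "of_nat k \<in> free_algebra G" for k
    by (induction k) (simp_all add: free_algebra_zero free_algebra_one free_algebra_add)
  then show ?thesis by (cases n) (simp_all add: free_algebra_uminus del: of_nat_Suc)
qed

lemma derivation_in_free_algebra: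
  assumes \<delta>: "\<And>g. g \<in> G \<Longrightarrow> \<delta> g \<in> free_algebra G" and a: "a \<in> free_algebra G"
  shows "derivation deg \<delta> a \<in> free_algebra G"
proof -
  have "derive_word deg \<delta> w \<in> free_algebra G" if "set w \<subseteq> G" for w
    using that
    by (induction w) (simp_all add: free_algebra_zero free_algebra_add free_algebra_mult \<delta>
        free_algebra_monomial free_algebra_parity)
  then show ?thesis
    unfolding derivation_def using a
    by (intro free_algebra_sum free_algebra_mult free_algebra_of_int) (auto simp: free_algebra_def)
qed

text \<open>Every term of the Leibniz expansion of a word has a factor from some
  \<open>\<delta> g\<close>, so compatibility with the differential only has to be tested on
  generators.\<close>

lemma eval_derivation_zero:
  assumes \<delta>: "\<And>g. g \<in> G \<Longrightarrow> eval_alg x (\<delta> g) = 0" and a: "a \<in> free_algebra G"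
  shows "eval_alg x (derivation deg \<delta> a) = 0"
proof -
  have "eval_alg x (derive_word deg \<delta> w) = 0" if "set w \<subseteq> G" for w
    using that by (induction w) (simp_all add: eval_alg_add eval_alg_mult \<delta>)
  then show ?thesis
    unfolding derivation_def eval_alg_sum eval_alg_mult using a
    by (intro sum.neutral) (simp add: free_algebra_def)
qed

text \<open>A unital ring homomorphism on the subalgebra generated by \<open>G\<close> is the evaluation at its values
  on the generators.\<close>

lemma hom_eq_eval_alg:
  fixes \<epsilon> :: "'g free_alg \<Rightarrow> 'k::comm_ring_1"
  assumes one: "\<epsilon> 1 = 1"
    and add: "\<And>a b. a \<in> free_algebra G \<Longrightarrow> b \<in> free_algebra G \<Longrightarrow> \<epsilon> (a + b) = \<epsilon> a + \<epsilon> b"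
    and mult: "\<And>a b. a \<in> free_algebra G \<Longrightarrow> b \<in> free_algebra G \<Longrightarrow> \<epsilon> (a * b) = \<epsilon> a * \<epsilon> b"
    and x: "\<And>g. g \<in> G \<Longrightarrow> \<epsilon> (monomial [g]) = x g"
    and a: "a \<in> free_algebra G"
  shows "\<epsilon> a = eval_alg x a"
proof -
  have zero: "\<epsilon> 0 = 0"
    using add[OF free_algebra_zero free_algebra_zero] by simp
  have uminus: "\<epsilon> (- b) = - \<epsilon> b" if "b \<in> free_algebra G" for b
    using add[OF that free_algebra_uminus[OF that]] zero by (simp add: add_eq_0_iff)
  have sum: "\<epsilon> (\<Sum>i\<in>I. f i) = (\<Sum>i\<in>I. \<epsilon> (f i))" if "\<And>i. i \<in> I \<Longrightarrow> f i \<in> free_algebra G"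
    for I and f :: "'g word \<Rightarrow> 'g free_alg"
    using that
    by (induction I rule: infinite_finite_induct) (simp_all add: zero add free_algebra_sum)
  have nat: "\<epsilon> (of_nat k) = of_nat k" for k
  proof (induction k)
    case (Suc k)
    have "of_nat k \<in> free_algebra G" using free_algebra_of_int[of "int k" G] by simp
    then show ?case using Suc add[OF free_algebra_one] one by simp
  qed (simp add: zero)
  have int: "\<epsilon> (of_int n) = of_int n" for n
  proof (cases n)
    case (nonneg k)
    then show ?thesis using nat by simp
  next
    case (neg k)
    have "of_nat (Suc k) \<in> free_algebra G" using free_algebra_of_int[of "int (Suc k)" G] by simp
    then show ?thesis
      using uminus[of "of_nat (Suc k)"] nat[of "Suc k"] neg by (simp del: of_nat_Suc)
  qed
  have word: "\<epsilon> (monomial w) = eval_word x w" if "set w \<subseteq> G" for w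
    using that
  proof (induction w)
    case (Cons g w)
    have "monomial (g # w) = monomial [g] * monomial w"
      using monomial_append[of "[g]" w] by simp
    then show ?case
      using Cons mult[of "monomial [g]" "monomial w"] x[of g]
      by (simp add: free_algebra_monomial eval_word_def)
  qed (simp add: one eval_word_def)
  \<comment> \<open>Turning the coefficient into a factor of the algebra brings multiplicativity to
    bear, so the values at integers and at words suffice.\<close>
  have single: "Poly_Mapping.single w n = of_int n * monomial (letters w)" for w :: "'g word" and n
  proof -
    have nat': "of_nat k * monomial (letters w) = Poly_Mapping.single w (int k)" for k
      by (induction k) (simp_all add: distrib_right monomial_def flip: single_add)
    show ?thesis
      by (cases n) (simp_all add: nat' single_uminus del: of_nat_Suc)
  qed
  have letters: "set (letters w) \<subseteq> G" if "w \<in> Poly_Mapping.keys a" for w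
    using a that by (simp add: free_algebra_def)
  have "\<epsilon> a = (\<Sum>w\<in>Poly_Mapping.keys a. \<epsilon> (Poly_Mapping.single w (Poly_Mapping.lookup a w)))"
    by (subst free_alg_expand, rule sum) (simp add: free_algebra_single letters)
  also have "\<dots> = eval_alg x a"
    unfolding eval_alg_def single
    by (intro sum.cong refl) (simp add: mult free_algebra_of_int free_algebra_monomial letters int word)
  finally show ?thesis .
qed

section \<open>Linear maps and matrices\<close>

text \<open>The matrix acts on row vectors, so that composition of maps corresponds to the product of
  matrices in the same order as in the differential.\<close>

definition matrix_map :: "'s set \<Rightarrow> ('s \<Rightarrow> 's \<Rightarrow> 'k::field) \<Rightarrow> ('s \<Rightarrow> 'k) \<Rightarrow> 's \<Rightarrow> 'k" where
  "matrix_map X a v = (\<lambda>t. if t \<in> X then \<Sum>s\<in>X. v s * a s t else 0)"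

lemma matrix_map_in_span: "matrix_map X a v \<in> span_space X"
  by (simp add: matrix_map_def span_space_def)

lemma linear_matrix_map: "linear_endo (span_space X) (matrix_map X a)"
  unfolding linear_endo_def
  by (auto simp: matrix_map_in_span)
    (auto simp: matrix_map_def fun_eq_iff sum.distrib distrib_right sum_distrib_left mult.assoc)

lemma has_degree_matrix_map:
  assumes "\<And>s t. s \<in> X \<Longrightarrow> t \<in> X \<Longrightarrow> a s t \<noteq> 0 \<Longrightarrow> gr t = gr s + r"
  shows "has_degree (span_space X) gr r (matrix_map X a)"
  unfolding has_degree_def
proof (intro allI subsetI)
  fix d w assume "w \<in> matrix_map X a ` graded_part (span_space X) gr d"
  then obtain v where v: "v \<in> graded_part (span_space X) gr d" "w = matrix_map X a v" by blast
  have "gr t = d + r" if "w t \<noteq> 0" for t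
  proof -
    have t: "t \<in> X" "(\<Sum>s\<in>X. v s * a s t) \<noteq> 0"
      using that v(2) by (auto simp: matrix_map_def split: if_splits)
    then obtain s where "s \<in> X" "v s * a s t \<noteq> 0" by (meson sum.neutral)
    then show ?thesis using assms[of s t] t v(1) by (auto simp: graded_part_def)
  qed
  then show "w \<in> graded_part (span_space X) gr (d + r)"
    using v(2) matrix_map_in_span by (auto simp: graded_part_def)
qed

lemma linear_endo_cong:
  assumes "\<And>v. v \<in> V \<Longrightarrow> f v = g v" and "linear_endo V g"
    and "\<And>u v. u \<in> V \<Longrightarrow> v \<in> V \<Longrightarrow> (\<lambda>s. u s + v s) \<in> V" and "\<And>r v. v \<in> V \<Longrightarrow> (\<lambda>s. r * v s) \<in> V"
  shows "linear_endo V f"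
  using assms unfolding linear_endo_def by simp

lemma span_space_add: "u \<in> span_space X \<Longrightarrow> v \<in> span_space X \<Longrightarrow> (\<lambda>s. u s + v s) \<in> span_space X"
  and span_space_scale: "v \<in> span_space X \<Longrightarrow> (\<lambda>s. r * v s) \<in> span_space X"
  by (simp_all add: span_space_def)

lemma has_degree_cong:
  assumes "\<And>v. v \<in> V \<Longrightarrow> f v = g v" and "has_degree V gr r g"
  shows "has_degree V gr r f"
  using assms unfolding has_degree_def graded_part_def by (auto simp: image_subset_iff)

lemma basis_vec_in_span: "s \<in> X \<Longrightarrow> basis_vec s \<in> span_space X"
  by (auto simp: basis_vec_def span_space_def)

lemma matrix_map_basis_vec:
  assumes "finite X" "s \<in> X" "t \<in> X"
  shows "matrix_map X a (basis_vec s) t = a s t"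
proof -
  have "matrix_map X a (basis_vec s) t = (\<Sum>u\<in>X. if u = s then a u t else 0)"
    unfolding matrix_map_def basis_vec_def if_P[OF assms(3)] by (rule sum.cong) auto
  then show ?thesis using assms by simp
qed

lemma matrix_map_compose:
  assumes "t \<in> X"
  shows "matrix_map X b (matrix_map X a v) t = (\<Sum>s\<in>X. v s * (\<Sum>r\<in>X. a s r * b r t))"
proof -
  have "matrix_map X b (matrix_map X a v) t = (\<Sum>r\<in>X. \<Sum>s\<in>X. v s * (a s r * b r t))"
    using assms by (simp add: matrix_map_def sum_distrib_right mult.assoc)
  also have "\<dots> = (\<Sum>s\<in>X. \<Sum>r\<in>X. v s * (a s r * b r t))" by (rule sum.swap)
  finally show ?thesis by (simp add: sum_distrib_left)
qed

lemma linear_eq_matrix_map: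
  fixes f :: "('s \<Rightarrow> 'k::field) \<Rightarrow> 's \<Rightarrow> 'k"
  assumes X: "finite X" and f: "linear_endo (span_space X) f" and v: "v \<in> span_space X"
  shows "f v = matrix_map X (\<lambda>s t. f (basis_vec s) t) v"
proof -
  have add: "f (\<lambda>s. u s + w s) = (\<lambda>s. f u s + f w s)" if "u \<in> span_space X" "w \<in> span_space X" for u w
    using f that by (simp add: linear_endo_def)
  have scale: "f (\<lambda>s. r * w s) = (\<lambda>s. r * f w s)" if "w \<in> span_space X" for r w
    using f that by (simp add: linear_endo_def)
  have zero: "f (\<lambda>s. 0) = (\<lambda>s. 0)"
    using scale[of "\<lambda>s. 0" 0] by (simp add: span_space_def)
  \<comment> \<open>\<open>linear_endo\<close> speaks of sums of two vectors, so the expansion in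
    the basis is built up one basis element at a time.\<close>
  have part: "f (\<lambda>t. if t \<in> Y then v t else 0) t = (\<Sum>s\<in>Y. v s * f (basis_vec s) t)" if "Y \<subseteq> X" for Y t
  proof -
    have "finite Y" using that X finite_subset by blast
    then show ?thesis using that
    proof (induction Y)
      case empty
      then show ?case by (simp add: zero)
    next
      case (insert s Y)
      have "(\<lambda>t. if t \<in> insert s Y then v t else 0) =
          (\<lambda>t. v s * basis_vec s t + (if t \<in> Y then v t else 0))"
        using insert(2) by (auto simp: basis_vec_def)
      moreover have "(\<lambda>t. if t \<in> Y then v t else 0) \<in> span_space X"
        using insert(4) by (auto simp: span_space_def)
      moreover have b: "(basis_vec s :: 's \<Rightarrow> 'k) \<in> span_space X"
        using insert(4) by (intro basis_vec_in_span) simp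
      ultimately have "f (\<lambda>t. if t \<in> insert s Y then v t else 0) t =
          v s * f (basis_vec s) t + f (\<lambda>t. if t \<in> Y then v t else 0) t"
        using add[OF span_space_scale[OF b, of "v s"], of "\<lambda>t. if t \<in> Y then v t else 0"] scale[OF b, of "v s"]
        by (simp only:)
      then show ?case using insert by simp
    qed
  qed
  have "(\<lambda>t. if t \<in> X then v t else 0) = v"
    using v by (auto simp: span_space_def)
  then have eq: "f v t = (\<Sum>s\<in>X. v s * f (basis_vec s) t)" for t
    using part[of X t] by simp
  have "f v \<in> span_space X" using f v by (simp add: linear_endo_def)
  then show ?thesis
    using eq by (auto simp: matrix_map_def span_space_def)
qed

text \<open>With \<open>A\<^sub>F = M\<^sub>F + id\<close> for edges \<open>F\<close> and \<open>A\<^sub>F = M\<^sub>F\<close> otherwise, the products in the simplex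
  relation for \<open>A\<close> also give the first and last face, which the relation for \<open>A\<close> omits but the
  differential contains; in dimension 2 the identity of the omitted face cancels.\<close>

lemma simplex_relation_shift:
  fixes f b :: "nat \<Rightarrow> 's \<Rightarrow> 's \<Rightarrow> 'k::field" and om :: "nat \<Rightarrow> 'k"
  assumes X: "finite X" "s \<in> X" "t \<in> X"
    and first: "m > 0 \<Longrightarrow> b 1 s t = om 0" and last: "m > 0 \<Longrightarrow> f (m - 1) s t = om m"
  shows "(\<Sum>k\<in>{0<..<m}. (- 1) ^ (k + 1) * (om k + (if m - 1 = 1 \<and> s = t then 1 else 0))) +
      (\<Sum>k\<le>m. (- 1) ^ k * (\<Sum>r\<in>X. (f k s r + (if k = 1 \<and> s = r then 1 else 0)) *
         (b k r t + (if m - k = 1 \<and> r = t then 1 else 0)))) =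
    - (if m = 0 then 0 else \<Sum>k\<le>m. (- 1) ^ k * om k) +
      (\<Sum>k\<le>m. (- 1) ^ k * (\<Sum>r\<in>X. f k s r * b k r t))"
proof -
  \<comment> \<open>Expanding the product leaves, besides \<open>f k s r * b k r t\<close>, one term
    for each Kronecker delta and one for the product of both, which requires \<open>k = 1\<close>
    and \<open>m = 2\<close>.\<close>
  have inner: "(\<Sum>r\<in>X. (f k s r + (if k = 1 \<and> s = r then 1 else 0)) *
         (b k r t + (if m - k = 1 \<and> r = t then 1 else 0))) =
      (\<Sum>r\<in>X. f k s r * b k r t) + (if k = 1 then b k s t else 0) +
      (if m - k = 1 then f k s t else 0) + (if k = 1 \<and> m - k = 1 \<and> s = t then 1 else 0)" for k
  proof -
    have "(\<Sum>r\<in>X. (f k s r + (if k = 1 \<and> s = r then 1 else 0)) *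
         (b k r t + (if m - k = 1 \<and> r = t then 1 else 0))) =
      (\<Sum>r\<in>X. f k s r * b k r t + (if r = s then (if k = 1 then b k r t else 0) else 0) +
        (if r = t then (if m - k = 1 then f k s r else 0) else 0) +
        (if r = s then (if k = 1 \<and> m - k = 1 \<and> s = t then 1 else 0) else 0))"
      by (intro sum.cong refl) (auto simp: algebra_simps)
    then show ?thesis using X by (simp add: sum.distrib)
  qed
  show ?thesis
  proof (cases "m = 0")
    case True
    then show ?thesis by (simp add: inner)
  next
    case False
    have b1: "(\<Sum>k\<le>m. (- 1) ^ k * (if k = 1 then b k s t else 0)) = - b 1 s t"
    proof -
      have "(\<Sum>k\<le>m. (- 1) ^ k * (if k = 1 then b k s t else 0)) =
          (\<Sum>k\<le>m. if k = 1 then - b 1 s t else 0)"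
        by (intro sum.cong) auto
      then show ?thesis using False by simp
    qed
    have f1: "(\<Sum>k\<le>m. (- 1) ^ k * (if m - k = 1 then f k s t else 0)) = (- 1) ^ (m - 1) * f (m - 1) s t"
    proof -
      have "(\<Sum>k\<le>m. (- 1) ^ k * (if m - k = 1 then f k s t else 0)) =
          (\<Sum>k\<le>m. if k = m - 1 then (- 1) ^ (m - 1) * f (m - 1) s t else 0)"
        using False by (intro sum.cong) auto
      then show ?thesis by simp
    qed
    have i1: "(\<Sum>k\<le>m. (- 1) ^ k * (if k = 1 \<and> m - k = 1 \<and> s = t then 1 else 0)) =
        (if m = 2 \<and> s = t then - 1 else (0 :: 'k))"
    proof -
      have "(\<Sum>k\<le>m. (- 1) ^ k * (if k = 1 \<and> m - k = 1 \<and> s = t then 1 else 0)) =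
          (\<Sum>k\<le>m. if k = 1 then (if m = 2 \<and> s = t then - 1 else (0 :: 'k)) else 0)"
        by (intro sum.cong) auto
      then show ?thesis using False by simp
    qed
    have o1: "(\<Sum>k\<in>{0<..<m}. (- 1) ^ (k + 1) * (om k + (if m - 1 = 1 \<and> s = t then 1 else 0))) =
        - (\<Sum>k\<in>{0<..<m}. (- 1) ^ k * om k) + (if m = 2 \<and> s = t then 1 else 0)"
    proof (cases "m = 2")
      case True
      have "{0<..<2::nat} = {1}" by auto
      then show ?thesis using True by simp
    next
      case False
      then have "m - 1 \<noteq> 1" by simp
      then show ?thesis using False by (simp add: sum_negf)
    qed
    have "{..m} = insert 0 (insert m {0<..<m})" using False by auto
    then have o2: "(\<Sum>k\<le>m. (- 1) ^ k * om k) = om 0 + (- 1) ^ m * om m + (\<Sum>k\<in>{0<..<m}. (- 1) ^ k * om k)"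
      using False by simp
    \<comment> \<open>The extra term \<open>f (m - 1) s t\<close> thus carries the sign opposite to
      \<open>(- 1) ^ m\<close>, as the last omitted face does in the negated sum on the
      right.\<close>
    have sgn: "(- 1) ^ (m - 1) = - ((- 1) ^ m :: 'k)" using False by (cases m) auto
    have split: "(\<Sum>k\<le>m. (- 1) ^ k * (p k + q k + r k + u k)) = (\<Sum>k\<le>m. (- 1) ^ k * p k) +
        (\<Sum>k\<le>m. (- 1) ^ k * q k) + (\<Sum>k\<le>m. (- 1) ^ k * r k) + (\<Sum>k\<le>m. (- 1) ^ k * u k)"
      for p q r u :: "nat \<Rightarrow> 'k"
      by (simp add: distrib_left sum.distrib)
    show ?thesis
      unfolding inner split b1 f1 i1 o1 o2 sgn using False first last by simp
  qed
qed


section \<open>Faces of a simplex\<close>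

lemma front_face_props:
  assumes "finite F" "F \<noteq> {}" "k \<le> cell_dim F"
  shows "front_face F k \<subseteq> F" "front_face F k \<noteq> {}" "cell_dim (front_face F k) = k"
proof -
  let ?xs = "sorted_list_of_set F"
  have l: "length ?xs = card F" "set ?xs = F" "distinct ?xs" using assms by simp_all
  have c: "card F > 0" using assms by (simp add: card_gt_0_iff)
  show "front_face F k \<subseteq> F" using l(2) set_take_subset[of "Suc k" ?xs] by (simp add: front_face_def)
  have "card (front_face F k) = Suc k"
    using l c assms(3) distinct_card[OF distinct_take[OF l(3)], of "Suc k"]
    by (simp add: front_face_def cell_dim_def)
  then show "front_face F k \<noteq> {}" "cell_dim (front_face F k) = k"
    by (auto simp: cell_dim_def)
qed

lemma back_face_props:
  assumes "finite F" "F \<noteq> {}" "k \<le> cell_dim F"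
  shows "back_face F k \<subseteq> F" "back_face F k \<noteq> {}" "cell_dim (back_face F k) = cell_dim F - k"
proof -
  let ?xs = "sorted_list_of_set F"
  have l: "length ?xs = card F" "set ?xs = F" "distinct ?xs" using assms by simp_all
  have c: "card F > 0" using assms by (simp add: card_gt_0_iff)
  show "back_face F k \<subseteq> F" using l(2) set_drop_subset[of k ?xs] by (simp add: back_face_def)
  have "card (back_face F k) = card F - k"
    using l distinct_card[OF distinct_drop[OF l(3)], of k]
    by (simp add: back_face_def)
  then show "back_face F k \<noteq> {}" "cell_dim (back_face F k) = cell_dim F - k"
    using c assms(3) by (auto simp: cell_dim_def)
qed

lemma omit_face_props:
  assumes "finite F" "cell_dim F > 0" "k \<le> cell_dim F"
  shows "omit_face F k \<subseteq> F" "omit_face F k \<noteq> {}" "cell_dim (omit_face F k) = cell_dim F - 1"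
proof -
  let ?xs = "sorted_list_of_set F"
  have l: "length ?xs = card F" "set ?xs = F" using assms by simp_all
  have "?xs ! k \<in> F" using l assms by (metis cell_dim_def nth_mem le_less_trans diff_less less_numeral_extra(1) zero_less_diff gr_zeroI diff_0_eq_0 not_less_zero)
  then have "card (omit_face F k) = card F - 1"
    using assms(1) by (simp add: omit_face_def)
  then show "omit_face F k \<noteq> {}" "cell_dim (omit_face F k) = cell_dim F - 1"
    using assms(2) by (auto simp: cell_dim_def)
  show "omit_face F k \<subseteq> F" by (auto simp: omit_face_def)
qed

text \<open>This and \<open>front_face_last\<close> identify the two outer omitted faces with
  factors of those products whose other factor belongs to an edge and so contributes an
  identity.\<close>

lemma back_face_Suc_0:
  assumes "finite F" "cell_dim F > 0"
  shows "back_face F (Suc 0) = omit_face F 0"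
proof -
  let ?xs = "sorted_list_of_set F"
  have l: "set ?xs = F" "distinct ?xs" "length ?xs = card F" using assms by simp_all
  then obtain y ys where "?xs = y # ys" using assms(2) by (cases ?xs) (auto simp: cell_dim_def)
  then show ?thesis using l by (auto simp: back_face_def omit_face_def)
qed

lemma front_face_last:
  assumes "finite F" "cell_dim F > 0"
  shows "front_face F (cell_dim F - 1) = omit_face F (cell_dim F)"
proof -
  let ?xs = "sorted_list_of_set F"
  have l: "set ?xs = F" "distinct ?xs" "length ?xs = card F" using assms by simp_all
  have "length ?xs > 0" using l(3) assms(2) by (simp add: cell_dim_def)
  then have "?xs \<noteq> []" unfolding length_greater_0_conv .
  then obtain ys y where xs: "?xs = ys @ [y]" by (metis rev_exhaust)
  then have "cell_dim F = length ys" using l(3) by (simp add: cell_dim_def)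
  moreover have "F = insert y (set ys)" "y \<notin> set ys" using l(1,2) xs by auto
  ultimately show ?thesis using xs assms(2) by (auto simp: front_face_def omit_face_def)
qed

section \<open>The matrices above a cell and its faces\<close>

context compatible_sheets
begin

definition cell_mat ::
    "('v set \<times> ('m, 'n) jet set \<times> ('m, 'n) jet set \<Rightarrow> 'k::field) \<Rightarrow>
     'v set \<Rightarrow> ('m, 'n) jet set \<Rightarrow> ('m, 'n) jet set \<Rightarrow> 'k" where
  "cell_mat x I S S' = (if (I, S, S') \<in> generators then x (I, S, S') else 0)"

definition face_mat ::
    "('v set \<times> ('m, 'n) jet set \<times> ('m, 'n) jet set \<Rightarrow> 'k::field) \<Rightarrow>
     'v set \<Rightarrow> 'v set \<Rightarrow> ('m, 'n) jet set \<Rightarrow> ('m, 'n) jet set \<Rightarrow> 'k" where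
  "face_mat x I J S S' =
     (if S \<in> sheets I - remaining_sheets J I \<and> S' \<in> sheets I - remaining_sheets J I
      then cell_mat x J (face_sheet J S) (face_sheet J S')
      else if cell_dim J = 0 \<and> S \<in> sheets I \<and> S' \<in> sheets I \<and> meet_at_cusp J S S' \<and> above I S S'
      then 1 else 0)"

text \<open>For \<open>F = I\<close> this is the evaluated differential without its sign. For a
  proper face \<open>F\<close> the entries are still indexed by the sheets above \<open>I\<close>,
  as the simplex diagram on \<open>V(e_I)\<close> demands.\<close>

definition relation ::
    "('v set \<times> ('m, 'n) jet set \<times> ('m, 'n) jet set \<Rightarrow> 'k::field) \<Rightarrow>
     'v set \<Rightarrow> 'v set \<Rightarrow> ('m, 'n) jet set \<Rightarrow> ('m, 'n) jet set \<Rightarrow> 'k" where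
  "relation x I F S S' =
     - (if cell_dim F = 0 then 0 else \<Sum>k\<le>cell_dim F. (- 1) ^ k * face_mat x I (omit_face F k) S S') +
     (\<Sum>k\<le>cell_dim F. (- 1) ^ k *
        (\<Sum>R\<in>sheets I. face_mat x I (front_face F k) S R * face_mat x I (back_face F k) R S'))"

lemma eval_cell_matrix: "eval_alg x (cell_matrix I S S') = cell_mat x I S S'"
  by (simp add: cell_matrix_def cell_mat_def eval_alg_monomial eval_word_def)

lemma eval_bdry_matrix: "eval_alg x (bdry_matrix I J S S') = face_mat x I J S S'"
  by (simp add: bdry_matrix_def face_mat_def eval_cell_matrix)

lemma eval_gen_diff:
  "eval_alg x (gen_diff (I, S, S')) = parity_sign (sheet_mu S) * relation x I I S S'"
  by (simp add: gen_diff_def relation_def eval_alg_mult eval_alg_add eval_alg_uminus eval_alg_diff eval_alg_sum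
      eval_alg_sign eval_alg_parity eval_bdry_matrix)

lemma gen_diff_in_free_algebra: "gen_diff g \<in> free_algebra generators"
proof -
  have "bdry_matrix I J S S' \<in> free_algebra generators" for I J S S'
    by (simp add: bdry_matrix_def cell_matrix_def free_algebra_zero free_algebra_one free_algebra_monomial)
  then show ?thesis
    unfolding gen_diff_def
    by (auto intro!: free_algebra_mult free_algebra_add free_algebra_uminus free_algebra_diff free_algebra_sum
        free_algebra_parity free_algebra_sign free_algebra_zero split: prod.split)
qed

section \<open>Entries of the face matrices\<close>

lemma face_mat_sheets:
  assumes "I \<in> K" "J \<subseteq> I" "J \<noteq> {}" "S \<in> sheets I" "S' \<in> sheets I"
    and "face_component J S \<in> sheets J" "face_component J S' \<in> sheets J"
  shows "face_mat x I J S S' = cell_mat x J (face_component J S) (face_component J S')"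
  using assms remaining_iff[OF assms(1-3)] face_sheet_eq[OF assms(1-3)] by (simp add: face_mat_def)

lemma face_mat_cusp:
  assumes "I \<in> K" "J \<subseteq> I" "J \<noteq> {}" "S \<in> sheets I" "S' \<in> sheets I"
    and "\<not> (face_component J S \<in> sheets J \<and> face_component J S' \<in> sheets J)"
  shows "face_mat x I J S S' = (if cell_dim J = 0 \<and> meet_at_cusp J S S' \<and> above I S S' then 1 else 0)"
proof -
  have "\<not> (S \<in> sheets I - remaining_sheets J I \<and> S' \<in> sheets I - remaining_sheets J I)"
    using assms(6) remaining_iff[OF assms(1-3)] by blast
  then show ?thesis unfolding face_mat_def using assms(4,5) by (simp only: if_False simp_thms)
qed

lemma face_mat_self:
  assumes I: "I \<in> K" and S: "S \<in> sheets I" "S' \<in> sheets I"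
  shows "face_mat x I I S S' = cell_mat x I S S'"
proof -
  have "face_component I S = S" "face_component I S' = S'"
    using face_component_self[OF I sheet_component] S by blast+
  then show ?thesis
    using face_mat_sheets[OF I order_refl simplex_nonempty[OF I] S, where x = x] S by simp
qed

lemma face_mat_above:
  assumes I: "I \<in> K" and J: "J \<subseteq> I" "J \<noteq> {}" and S: "S \<in> sheets I" "S' \<in> sheets I"
    and nz: "face_mat x I J S S' \<noteq> 0"
  shows "above I S S'"
proof (cases "face_component J S \<in> sheets J \<and> face_component J S' \<in> sheets J")
  case True
  then have "cell_mat x J (face_component J S) (face_component J S') \<noteq> 0"
    using nz face_mat_sheets[OF I J S, where x = x] by simp
  then have "above J (face_component J S) (face_component J S')"
    unfolding cell_mat_def generators_def by (auto split: if_splits)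
  then show ?thesis using above_face[OF I J S] True by blast
next
  case False
  then show ?thesis using nz face_mat_cusp[OF I J S False, where x = x] by (auto split: if_splits)
qed

lemma faces:
  assumes I: "I \<in> K" and F: "F \<subseteq> I" "F \<noteq> {}" and k: "k \<le> cell_dim F"
  shows "front_face F k \<subseteq> F" "front_face F k \<noteq> {}" "cell_dim (front_face F k) = k"
    "back_face F k \<subseteq> F" "back_face F k \<noteq> {}" "cell_dim (back_face F k) = cell_dim F - k"
    "cell_dim F > 0 \<Longrightarrow> omit_face F k \<subseteq> F" "cell_dim F > 0 \<Longrightarrow> omit_face F k \<noteq> {}"
    "cell_dim F > 0 \<Longrightarrow> cell_dim (omit_face F k) = cell_dim F - 1"
proof -
  have fin: "finite F" using simplex_finite[OF I] F(1) finite_subset by blast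
  show "front_face F k \<subseteq> F" "front_face F k \<noteq> {}" "cell_dim (front_face F k) = k"
    by (rule front_face_props[OF fin F(2) k])+
  show "back_face F k \<subseteq> F" "back_face F k \<noteq> {}" "cell_dim (back_face F k) = cell_dim F - k"
    by (rule back_face_props[OF fin F(2) k])+
  show "cell_dim F > 0 \<Longrightarrow> omit_face F k \<subseteq> F" "cell_dim F > 0 \<Longrightarrow> omit_face F k \<noteq> {}"
    "cell_dim F > 0 \<Longrightarrow> cell_dim (omit_face F k) = cell_dim F - 1"
    by (rule omit_face_props[OF fin _ k], assumption)+
qed

text \<open>A nonzero product would give a chain \<open>S\<close> above \<open>R\<close> above
  \<open>S'\<close>. This settles the entries that carry no generator, about which an augmentation
  says nothing.\<close>

lemma relation_above:
  assumes I: "I \<in> K" and S: "S \<in> sheets I" "S' \<in> sheets I" and na: "\<not> above I S S'"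
  shows "relation x I I S S' = 0"
proof -
  note fc = faces[OF I order_refl simplex_nonempty[OF I]]
  have o: "face_mat x I (omit_face I k) S S' = 0" if "k \<le> cell_dim I" "cell_dim I > 0" for k
    using face_mat_above[OF I fc(7,8)[OF that] S, where x = x] na by blast
  have p: "face_mat x I (front_face I k) S R * face_mat x I (back_face I k) R S' = 0"
    if k: "k \<le> cell_dim I" and R: "R \<in> sheets I" for k R
    using face_mat_above[OF I fc(1,2)[OF k] S(1) R, where x = x] face_mat_above[OF I fc(4,5)[OF k] R S(2), where x = x]
      above_trans[of I S R S'] na by (metis mult_eq_0_iff)
  have "(\<Sum>R\<in>sheets I. face_mat x I (front_face I k) S R * face_mat x I (back_face I k) R S') = 0"
    if "k \<le> cell_dim I" for k
    using p[OF that] by (rule sum.neutral[rule_format])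
  then show ?thesis unfolding relation_def using o by simp
qed

text \<open>Once a sheet ends in a cusp above \<open>F\<close>, its entries in the matrix of a face
  \<open>G\<close> of \<open>F\<close> depend on \<open>G\<close> only through its dimension,
  because cusp partners above \<open>F\<close> and \<open>G\<close> agree.\<close>

lemma face_mat_remaining:
  assumes I: "I \<in> K" and F: "F \<subseteq> I" and G: "G \<subseteq> F" "G \<noteq> {}" and S: "S \<in> sheets I" "S' \<in> sheets I"
    and r: "\<not> (face_component F S \<in> sheets F \<and> face_component F S' \<in> sheets F)"
  shows "face_mat x I G S S' = (if cell_dim G = 0 \<and> meet_at_cusp F S S' \<and> above I S S' then 1 else 0)"
proof -
  have GI: "G \<subseteq> I" using F G by blast
  have "\<not> (face_component G S \<in> sheets G \<and> face_component G S' \<in> sheets G)"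
    using r face_remaining[OF I F G] S by blast
  moreover have "meet_at_cusp G S S' \<longleftrightarrow> meet_at_cusp F S S'"
    using r meet_face_iff[OF I F G S] meet_face_iff[OF I F G S(2,1)] meet_sym by blast
  ultimately show ?thesis using face_mat_cusp[OF I GI G(2) S, where x = x] by simp
qed

text \<open>The matrix of \<open>G\<close> seen from \<open>I\<close> restricts to the one seen from
  \<open>F\<close>: entries between sheets agree by functoriality of faces, cusp entries because
  meeting and order agree above \<open>F\<close> and \<open>I\<close>.\<close>

lemma face_mat_face:
  assumes I: "I \<in> K" and F: "F \<subseteq> I" and G: "G \<subseteq> F" "G \<noteq> {}" and S: "S \<in> sheets I" "S' \<in> sheets I"
    and f: "face_component F S \<in> sheets F" "face_component F S' \<in> sheets F"
  shows "face_mat x I G S S' = face_mat x F G (face_component F S) (face_component F S')"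
proof -
  have F0: "F \<noteq> {}" and GI: "G \<subseteq> I" using F G by auto
  have FK: "F \<in> K" by (rule face_in_complex[OF I F F0])
  have tr: "face_component G (face_component F S) = face_component G S"
    "face_component G (face_component F S') = face_component G S'"
    using face_component_trans[OF I F G sheet_component] S by blast+
  show ?thesis
  proof (cases "face_component G S \<in> sheets G \<and> face_component G S' \<in> sheets G")
    case True
    then show ?thesis
      using face_mat_sheets[OF I GI G(2) S, where x = x] face_mat_sheets[OF FK G f, where x = x] tr by simp
  next
    case False
    have "meet_at_cusp G (face_component F S) (face_component F S') \<longleftrightarrow> meet_at_cusp G S S'"
      by (rule meet_face_face[OF I F G S f])
    moreover have "above F (face_component F S) (face_component F S') \<longleftrightarrow> above I S S'"
      if "meet_at_cusp G S S'"
      using above_face_cusp[OF I F G S f] that calculation by blast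
    ultimately show ?thesis
      using face_mat_cusp[OF I GI G(2) S False, where x = x] face_mat_cusp[OF FK G f, where x = x] False tr by auto
  qed
qed

lemma sum_sheets_face:
  assumes I: "I \<in> K" and F: "F \<subseteq> I" "F \<noteq> {}"
    and z: "\<And>R. R \<in> sheets I \<Longrightarrow> face_component F R \<notin> sheets F \<Longrightarrow> f R = 0"
  shows "(\<Sum>R\<in>sheets I. f R) = (\<Sum>T\<in>sheets F. f (extend_sheet F I T))"
proof -
  have "(\<Sum>R\<in>sheets I. f R) = (\<Sum>R\<in>{R \<in> sheets I. face_component F R \<in> sheets F}. f R)"
    using finite_sheets[OF I] z by (intro sum.mono_neutral_right) auto
  also have "\<dots> = (\<Sum>T\<in>sheets F. f (extend_sheet F I T))"
    by (rule sum.reindex_bij_witness[of _ "extend_sheet F I" "face_component F"])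
      (simp_all add: extend_sheet[OF I F] extend_face[OF I F])
  finally show ?thesis .
qed

lemma relation_face:
  assumes I: "I \<in> K" and F: "F \<subseteq> I" "F \<noteq> {}" and S: "S \<in> sheets I" "S' \<in> sheets I"
    and f: "face_component F S \<in> sheets F" "face_component F S' \<in> sheets F"
  shows "relation x I F S S' = relation x F F (face_component F S) (face_component F S')"
proof -
  note fc = faces[OF I F]
  have o: "face_mat x I (omit_face F k) S S' =
      face_mat x F (omit_face F k) (face_component F S) (face_component F S')"
    if "k \<le> cell_dim F" "cell_dim F > 0" for k
    by (rule face_mat_face[OF I F(1) fc(7,8)[OF that] S f, where x = x])
  have p: "(\<Sum>R\<in>sheets I. face_mat x I (front_face F k) S R * face_mat x I (back_face F k) R S') =
      (\<Sum>R\<in>sheets F. face_mat x F (front_face F k) (face_component F S) R *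
        face_mat x F (back_face F k) R (face_component F S'))" if k: "k \<le> cell_dim F" for k
  proof -
    have z: "face_mat x I (front_face F k) S R * face_mat x I (back_face F k) R S' = 0"
      if R: "R \<in> sheets I" "face_component F R \<notin> sheets F" for R
    proof -
      \<comment> \<open>A summand \<open>R\<close> that ends in a cusp above \<open>F\<close> could
        be linked to \<open>S\<close> only as its cusp partner, but the face of \<open>S\<close> is
        a sheet.\<close>
      have "\<not> meet_at_cusp F S R" using meet_iff[OF I F S(1) R(1)] f(1) by blast
      then show ?thesis
        using face_mat_remaining[OF I F(1) fc(1,2)[OF k] S(1) R(1), where x = x] R(2) by simp
    qed
    have eq: "face_mat x I (front_face F k) S (extend_sheet F I T) = face_mat x F (front_face F k) (face_component F S) T"
      "face_mat x I (back_face F k) (extend_sheet F I T) S' = face_mat x F (back_face F k) T (face_component F S')"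
      if T: "T \<in> sheets F" for T
      using face_mat_face[OF I F(1) fc(1,2)[OF k] S(1) extend_sheet(1)[OF I F T] f(1), where x = x]
        face_mat_face[OF I F(1) fc(4,5)[OF k] extend_sheet(1)[OF I F T] S(2) _ f(2), where x = x]
        extend_sheet(2)[OF I F T] T by simp_all
    have "(\<Sum>R\<in>sheets I. face_mat x I (front_face F k) S R * face_mat x I (back_face F k) R S') =
        (\<Sum>T\<in>sheets F. face_mat x I (front_face F k) S (extend_sheet F I T) *
          face_mat x I (back_face F k) (extend_sheet F I T) S')"
      by (rule sum_sheets_face[OF I F z])
    also have "\<dots> = (\<Sum>R\<in>sheets F. face_mat x F (front_face F k) (face_component F S) R *
        face_mat x F (back_face F k) R (face_component F S'))"
      by (intro sum.cong refl) (simp only: eq)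
    finally show ?thesis .
  qed
  show ?thesis unfolding relation_def using o p by simp
qed

text \<open>On the cusp part the relation holds by itself: the square of \<open>d_0\<close>
  vanishes, the two vertices of an edge contribute equal terms of opposite sign, and omitted faces
  of positive dimension contribute nothing.\<close>

lemma relation_remaining:
  assumes I: "I \<in> K" and F: "F \<subseteq> I" "F \<noteq> {}" and S: "S \<in> sheets I" "S' \<in> sheets I"
    and r: "\<not> (face_component F S \<in> sheets F \<and> face_component F S' \<in> sheets F)"
  shows "relation x I F S S' = 0"
proof -
  note fc = faces[OF I F]
  have p: "face_mat x I (front_face F k) S R * face_mat x I (back_face F k) R S' = 0"
    if k: "k \<le> cell_dim F" and R: "R \<in> sheets I" for k R
  proof (rule ccontr)
    assume nz: "\<not> ?thesis"
    note fr = face_mat_remaining[OF I F(1) fc(1,2)[OF k] S(1) R, where x = x]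
      and bk = face_mat_remaining[OF I F(1) fc(4,5)[OF k] R S(2), where x = x]
      and m1 = meet_iff[OF I F S(1) R] and m2 = meet_iff[OF I F R S(2)]
    have nz': "face_mat x I (front_face F k) S R \<noteq> 0" "face_mat x I (back_face F k) R S' \<noteq> 0"
      using nz by auto
    have a: "meet_at_cusp F S R \<and> above I S R"
      if "\<not> (face_component F S \<in> sheets F \<and> face_component F R \<in> sheets F)"
      using fr[OF that] nz'(1) by presburger
    have b: "meet_at_cusp F R S' \<and> above I R S'"
      if "\<not> (face_component F R \<in> sheets F \<and> face_component F S' \<in> sheets F)"
      using bk[OF that] nz'(2) by presburger
    \<comment> \<open>Whichever of \<open>S\<close> and \<open>S'\<close> ends in a cusp passes this
      on to \<open>R\<close>, so both factors are cusp entries and \<open>S\<close>,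
      \<open>S'\<close> are both the partner of \<open>R\<close>.\<close>
    have "meet_at_cusp F S R \<Longrightarrow> face_component F R \<notin> sheets F"
      "meet_at_cusp F R S' \<Longrightarrow> face_component F R \<notin> sheets F"
      using m1 m2 by metis+
    then have m: "meet_at_cusp F S R" "above I S R" "meet_at_cusp F R S'" "above I R S'"
      using a b r by blast+
    then have "S = S'" using meet_unique[OF I F R S] meet_sym by blast
    then show False using above_trans[OF m(2,4)] above_irrefl[OF I] by blast
  qed
  have o: "(\<Sum>k\<le>cell_dim F. (- 1) ^ k * face_mat x I (omit_face F k) S S') = 0" if d: "cell_dim F > 0"
  proof -
    have om: "face_mat x I (omit_face F k) S S' =
      (if cell_dim F = 1 \<and> meet_at_cusp F S S' \<and> above I S S' then 1 else 0)" if "k \<le> cell_dim F" for k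
      using face_mat_remaining[OF I F(1) fc(7,8)[OF that d] S r, where x = x] fc(9)[OF that d] d by auto
    show ?thesis
    proof (cases "cell_dim F = 1")
      case True
      then show ?thesis using om[of 0] om[of 1] by simp
    next
      case False
      then show ?thesis using om by simp
    qed
  qed
  have "(\<Sum>R\<in>sheets I. face_mat x I (front_face F k) S R * face_mat x I (back_face F k) R S') = 0"
    if "k \<le> cell_dim F" for k
    using p[OF that] by (rule sum.neutral[rule_format])
  then show ?thesis unfolding relation_def using o by simp
qed


section \<open>Chain homotopy diagrams from matrices\<close>

text \<open>For edges the single identity does two jobs: it passes from the matrix of generators to
  the unipotent map on \<open>V(e_F)\<close>, and it is the prescribed boundary extension on the
  cusp part.\<close>

definition hom_mat ::
    "('v set \<times> ('m, 'n) jet set \<times> ('m, 'n) jet set \<Rightarrow> 'k::field) \<Rightarrow>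
     'v set \<Rightarrow> 'v set \<Rightarrow> ('m, 'n) jet set \<Rightarrow> ('m, 'n) jet set \<Rightarrow> 'k" where
  "hom_mat x I F S S' = face_mat x I F S S' + (if cell_dim F = 1 \<and> S = S' then 1 else 0)"

lemma bdry_extension_eq:
  assumes I: "I \<in> K" and F: "F \<subseteq> I" "F \<noteq> {}" and v: "v \<in> sheet_space I"
    and f: "\<And>w. w \<in> sheet_space F \<Longrightarrow> f w = matrix_map (sheets F) (hom_mat x F F) w"
  shows "bdry_extension I F f v = matrix_map (sheets I) (hom_mat x I F) v"
proof
  fix S'
  note rem = remaining_iff[OF I F]
  have FF: "F \<subseteq> F" by blast
  consider "S' \<notin> sheets I" | "S' \<in> sheets I" "face_component F S' \<in> sheets F"
    | "S' \<in> sheets I" "face_component F S' \<notin> sheets F" by blast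
  then show "bdry_extension I F f v S' = matrix_map (sheets I) (hom_mat x I F) v S'"
  proof cases
    case 1
    then show ?thesis using rem by (simp add: bdry_extension_def matrix_map_def)
  next
    case 2
    let ?w = "\<lambda>T. if T \<in> sheets F then v (extend_sheet F I T) else 0"
    have "?w \<in> sheet_space F" by (simp add: sheet_space_def span_space_def)
    then have "bdry_extension I F f v S' = matrix_map (sheets F) (hom_mat x F F) ?w (face_component F S')"
      using 2 rem f face_sheet_eq[OF I F 2] by (simp add: bdry_extension_def)
    also have "\<dots> = (\<Sum>T\<in>sheets F. v (extend_sheet F I T) * hom_mat x F F T (face_component F S'))"
      using 2 by (simp add: matrix_map_def)
    also have "\<dots> = (\<Sum>T\<in>sheets F. v (extend_sheet F I T) * hom_mat x I F (extend_sheet F I T) S')"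
    proof (intro sum.cong refl)
      fix T assume T: "T \<in> sheets F"
      \<comment> \<open>Makes the Kronecker deltas of edges agree before and after extending sheets
        from \<open>F\<close> to \<open>I\<close>.\<close>
      have "extend_sheet F I T = S' \<longleftrightarrow> T = face_component F S'"
        using extend_sheet(2)[OF I F T] extend_face[OF I F 2] by metis
      moreover have "face_mat x I F (extend_sheet F I T) S' = face_mat x F F T (face_component F S')"
        using face_mat_face[OF I F(1) FF F(2) extend_sheet(1)[OF I F T] 2(1) _ 2(2), where x = x]
          extend_sheet(2)[OF I F T] T by simp
      ultimately show "v (extend_sheet F I T) * hom_mat x F F T (face_component F S') =
          v (extend_sheet F I T) * hom_mat x I F (extend_sheet F I T) S'"
        by (simp add: hom_mat_def)
    qed
    also have "\<dots> = (\<Sum>S\<in>sheets I. v S * hom_mat x I F S S')"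
    \<comment> \<open>A column whose target has a sheet as its face receives nothing from the cusp
      part.\<close>
    proof (rule sum_sheets_face[OF I F, symmetric])
      fix R assume R: "R \<in> sheets I" "face_component F R \<notin> sheets F"
      have "\<not> meet_at_cusp F R S'" using meet_iff[OF I F R(1) 2(1)] 2(2) by auto
      then have "face_mat x I F R S' = 0"
        using face_mat_remaining[OF I F(1) FF F(2) R(1) 2(1), where x = x] R(2) by simp
      moreover have "R \<noteq> S'" using R(2) 2(2) by blast
      ultimately show "v R * hom_mat x I F R S' = 0" by (simp add: hom_mat_def)
    qed
    finally show ?thesis using 2 by (simp add: matrix_map_def)
  next
    case 3
    have fm: "face_mat x I F S S' = (if cell_dim F = 0 \<and> meet_at_cusp F S S' \<and> above I S S' then 1 else 0)"
      if "S \<in> sheets I" for S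
      using face_mat_remaining[OF I F(1) FF F(2) that 3(1), where x = x] 3(2) by blast
    have "matrix_map (sheets I) (hom_mat x I F) v S' = (\<Sum>S\<in>sheets I.
        (if cell_dim F = 0 \<and> meet_at_cusp F S S' \<and> above I S S' then v S else 0) +
        (if S = S' then (if cell_dim F = 1 then v S else 0) else 0))"
      unfolding matrix_map_def using 3(1) fm
      by (auto simp: hom_mat_def intro!: sum.cong)
    also have "\<dots> = (\<Sum>S\<in>sheets I. if cell_dim F = 0 \<and> meet_at_cusp F S S' \<and> above I S S' then v S else 0) +
        (if cell_dim F = 1 then v S' else 0)"
      using finite_sheets[OF I] 3(1) by (simp add: sum.distrib)
    also have "\<dots> = (if cell_dim F = 0 then \<Sum>S\<in>{R \<in> remaining_sheets F I. meet_at_cusp F R S' \<and> above I R S'}. v S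
        else if cell_dim F = 1 then v S' else 0)"
    proof -
      have "{R \<in> remaining_sheets F I. meet_at_cusp F R S' \<and> above I R S'} =
          {S \<in> sheets I. meet_at_cusp F S S' \<and> above I S S'}"
        using rem meet_iff[OF I F _ 3(1)] by blast
      then show ?thesis
        using finite_sheets[OF I] by (auto simp: sum.If_cases Int_def intro!: sum.cong)
    qed
    also have "\<dots> = bdry_extension I F f v S'"
      using 3 rem by (simp add: bdry_extension_def)
    finally show ?thesis by simp
  qed
qed

text \<open>The deltas of \<open>simplex_relation_shift\<close> are switched on by dimension: the
  front face is an edge for \<open>k = 1\<close>, the back face for \<open>m - k = 1\<close>, an
  omitted face for \<open>m - 1 = 1\<close>.\<close>

lemma simplex_relation_eq:
  assumes I: "I \<in> K" and F: "F \<subseteq> I" "F \<noteq> {}" and S: "S \<in> sheets I" "S' \<in> sheets I"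
  shows "(\<Sum>k\<in>{0<..<cell_dim F}. (- 1) ^ (k + 1) * hom_mat x I (omit_face F k) S S') +
      (\<Sum>k\<le>cell_dim F. (- 1) ^ k * (\<Sum>R\<in>sheets I. hom_mat x I (front_face F k) S R * hom_mat x I (back_face F k) R S')) =
    relation x I F S S'"
proof -
  note fc = faces[OF I F]
  let ?m = "cell_dim F"
  have fin: "finite F" using simplex_finite[OF I] F(1) finite_subset by blast
  have "(\<Sum>k\<in>{0<..<?m}. (- 1) ^ (k + 1) * hom_mat x I (omit_face F k) S S') =
      (\<Sum>k\<in>{0<..<?m}. (- 1) ^ (k + 1) * (face_mat x I (omit_face F k) S S' + (if ?m - 1 = 1 \<and> S = S' then 1 else 0)))"
    using fc(9) by (intro sum.cong refl) (simp add: hom_mat_def)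
  moreover have "(\<Sum>k\<le>?m. (- 1) ^ k * (\<Sum>R\<in>sheets I. hom_mat x I (front_face F k) S R * hom_mat x I (back_face F k) R S')) =
      (\<Sum>k\<le>?m. (- 1) ^ k * (\<Sum>R\<in>sheets I. (face_mat x I (front_face F k) S R + (if k = 1 \<and> S = R then 1 else 0)) *
         (face_mat x I (back_face F k) R S' + (if ?m - k = 1 \<and> R = S' then 1 else 0))))"
    using fc(3,6) by (intro sum.cong refl) (simp add: hom_mat_def)
  ultimately show ?thesis
    unfolding relation_def
    using simplex_relation_shift[OF finite_sheets[OF I] S, of ?m "\<lambda>k. face_mat x I (back_face F k)"
        "\<lambda>k. face_mat x I (omit_face F k) S S'" "\<lambda>k. face_mat x I (front_face F k)"]
      back_face_Suc_0[OF fin] front_face_last[OF fin] by simp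
qed

text \<open>The common parameter set of both bijections. Requiring 0 off the generators makes such a
  function the same thing as its values on them.\<close>

definition points :: "('v set \<times> ('m, 'n) jet set \<times> ('m, 'n) jet set \<Rightarrow> 'k::field) set" where
  "points = {x. (\<forall>g. g \<notin> generators \<longrightarrow> x g = 0) \<and> (\<forall>g\<in>generators. gen_deg g \<noteq> 0 \<longrightarrow> x g = 0) \<and>
     (\<forall>I\<in>K. \<forall>S\<in>sheets I. \<forall>S'\<in>sheets I. relation x I I S S' = 0)}"

definition chd :: "('v set \<times> ('m, 'n) jet set \<times> ('m, 'n) jet set \<Rightarrow> 'k::field) \<Rightarrow>
    'v set \<Rightarrow> (('m, 'n) jet set \<Rightarrow> 'k) \<Rightarrow> (('m, 'n) jet set \<Rightarrow> 'k)" where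
  "chd x = (\<lambda>I\<in>K. \<lambda>v\<in>sheet_space I. matrix_map (sheets I) (hom_mat x I I) v)"

lemma chd_eq: "I \<in> K \<Longrightarrow> v \<in> sheet_space I \<Longrightarrow> chd x I v = matrix_map (sheets I) (hom_mat x I I) v"
  by (simp add: chd_def)

text \<open>A nonzero entry is the identity of an edge, of degree 0; or a generator of degree 0,
  whose potentials are inherited from the faces; or a cusp at a vertex, where the jump of \<mu>
  gives degree 1.\<close>

lemma hom_mat_degree:
  assumes x: "\<And>g. g \<in> generators \<Longrightarrow> gen_deg g \<noteq> 0 \<Longrightarrow> x g = 0"
    and I: "I \<in> K" and F: "F \<subseteq> I" "F \<noteq> {}" and S: "S \<in> sheets I" "S' \<in> sheets I"
    and nz: "hom_mat x I F S S' \<noteq> 0"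
  shows "sheet_deg S' = sheet_deg S + (1 - int (cell_dim F))"
proof (cases "face_mat x I F S S' = 0")
  case True
  then show ?thesis using nz by (auto simp: hom_mat_def split: if_splits)
next
  case False
  show ?thesis
  proof (cases "face_component F S \<in> sheets F \<and> face_component F S' \<in> sheets F")
    case True
    then have "cell_mat x F (face_component F S) (face_component F S') \<noteq> 0"
      using False face_mat_sheets[OF I F S, where x = x] by simp
    then have "gen_deg (F, face_component F S, face_component F S') = 0"
      using x unfolding cell_mat_def by (auto split: if_splits)
    then show ?thesis
      using sheet_mu_face[OF I F S(1)] sheet_mu_face[OF I F S(2)] True
      by (simp add: gen_deg_def sheet_deg_def)
  next
    case False2: False
    then have "cell_dim F = 0" "meet_at_cusp F S S'" "above I S S'"
      using False face_mat_cusp[OF I F S False2, where x = x] by (auto split: if_splits)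
    then show ?thesis
      using sheet_mu_cusp[OF I F S] by (simp add: sheet_deg_def)
  qed
qed

text \<open>Stated for any family \<open>c\<close> given by these matrices, so that it serves both
  for constructing a CHD and for reading equations off one.\<close>

lemma simplex_relation_iff:
  fixes c :: "'v set \<Rightarrow> (('m, 'n) jet set \<Rightarrow> 'k::field) \<Rightarrow> (('m, 'n) jet set \<Rightarrow> 'k)"
  assumes I: "I \<in> K" and F: "F \<subseteq> I" "F \<noteq> {}"
    and c: "\<And>G w. G \<in> K \<Longrightarrow> w \<in> sheet_space G \<Longrightarrow> c G w = matrix_map (sheets G) (hom_mat x G G) w"
  shows "(\<forall>v\<in>sheet_space I. \<forall>S'.
      (\<Sum>k\<in>{0<..<cell_dim F}. (- 1) ^ (k + 1) * bdry_extension I (omit_face F k) (c (omit_face F k)) v S') +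
      (\<Sum>k\<le>cell_dim F. (- 1) ^ k * bdry_extension I (back_face F k) (c (back_face F k))
         (bdry_extension I (front_face F k) (c (front_face F k)) v) S') = 0) \<longleftrightarrow>
    (\<forall>S\<in>sheets I. \<forall>S'\<in>sheets I. relation x I F S S' = 0)" (is "(\<forall>v\<in>_. \<forall>S'. ?E v S' = 0) \<longleftrightarrow> _")
proof -
  note fc = faces[OF I F]
  have be: "bdry_extension I G (c G) v = matrix_map (sheets I) (hom_mat x I G) v"
    if "G \<subseteq> F" "G \<noteq> {}" "v \<in> sheet_space I" for G v
  proof -
    have G: "G \<subseteq> I" "G \<noteq> {}" using that F by auto
    show ?thesis by (rule bdry_extension_eq[OF I G that(3) c[OF face_in_complex[OF I G]]])
  qed
  have in_sp: "matrix_map (sheets I) a v \<in> sheet_space I" for a :: "('m, 'n) jet set \<Rightarrow> ('m, 'n) jet set \<Rightarrow> 'k" and v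
    unfolding sheet_space_def by (rule matrix_map_in_span)
  \<comment> \<open>The left-hand side is the row vector \<open>v\<close> times the relation matrix,
    so basis vectors detect all of its entries.\<close>
  have E: "?E v S' = (if S' \<in> sheets I then \<Sum>S\<in>sheets I. v S * relation x I F S S' else 0)"
    if v: "v \<in> sheet_space I" for v S'
  proof -
    have o: "bdry_extension I (omit_face F k) (c (omit_face F k)) v = matrix_map (sheets I) (hom_mat x I (omit_face F k)) v"
      if "k \<in> {0<..<cell_dim F}" for k
      using be[OF fc(7,8) v] that by simp
    have p: "bdry_extension I (back_face F k) (c (back_face F k)) (bdry_extension I (front_face F k) (c (front_face F k)) v) =
        matrix_map (sheets I) (hom_mat x I (back_face F k)) (matrix_map (sheets I) (hom_mat x I (front_face F k)) v)"
      if "k \<in> {..cell_dim F}" for k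
      using be[OF fc(1,2) v] be[OF fc(4,5) in_sp] that by simp
    have "?E v S' = (\<Sum>k\<in>{0<..<cell_dim F}. (- 1) ^ (k + 1) * matrix_map (sheets I) (hom_mat x I (omit_face F k)) v S') +
      (\<Sum>k\<le>cell_dim F. (- 1) ^ k * matrix_map (sheets I) (hom_mat x I (back_face F k))
         (matrix_map (sheets I) (hom_mat x I (front_face F k)) v) S')"
      using o p by (intro arg_cong2[of _ _ _ _ "(+)"] sum.cong refl) simp_all
    also have "\<dots> = (if S' \<in> sheets I then \<Sum>S\<in>sheets I. v S * relation x I F S S' else 0)"
    proof (cases "S' \<in> sheets I")
      case False
      then show ?thesis by (simp add: matrix_map_def)
    next
      case True
      have "(\<Sum>k\<in>{0<..<cell_dim F}. (- 1) ^ (k + 1) * matrix_map (sheets I) (hom_mat x I (omit_face F k)) v S') =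
          (\<Sum>S\<in>sheets I. v S * (\<Sum>k\<in>{0<..<cell_dim F}. (- 1) ^ (k + 1) * hom_mat x I (omit_face F k) S S'))"
        using True unfolding matrix_map_def sum_distrib_left
        by (simp add: sum.swap[of _ "sheets I"] mult_ac sum_distrib_left)
      moreover have "(\<Sum>k\<le>cell_dim F. (- 1) ^ k * matrix_map (sheets I) (hom_mat x I (back_face F k))
            (matrix_map (sheets I) (hom_mat x I (front_face F k)) v) S') =
          (\<Sum>S\<in>sheets I. v S * (\<Sum>k\<le>cell_dim F. (- 1) ^ k *
            (\<Sum>R\<in>sheets I. hom_mat x I (front_face F k) S R * hom_mat x I (back_face F k) R S')))"
      proof -
        have "(\<Sum>k\<le>cell_dim F. (- 1) ^ k * matrix_map (sheets I) (hom_mat x I (back_face F k))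
            (matrix_map (sheets I) (hom_mat x I (front_face F k)) v) S') =
          (\<Sum>k\<le>cell_dim F. \<Sum>S\<in>sheets I. v S * ((- 1) ^ k *
            (\<Sum>R\<in>sheets I. hom_mat x I (front_face F k) S R * hom_mat x I (back_face F k) R S')))"
          unfolding matrix_map_compose[OF True] sum_distrib_left[of _ _ "sheets I"]
          by (intro sum.cong refl) (simp add: mult_ac sum_distrib_left)
        also have "\<dots> = (\<Sum>S\<in>sheets I. \<Sum>k\<le>cell_dim F. v S * ((- 1) ^ k *
            (\<Sum>R\<in>sheets I. hom_mat x I (front_face F k) S R * hom_mat x I (back_face F k) R S')))"
          by (rule sum.swap)
        finally show ?thesis by (simp only: sum_distrib_left[of "v _"])
      qed
      ultimately show ?thesis
        using True simplex_relation_eq[OF I F _ True, where x = x]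
        by (simp flip: sum.distrib distrib_left)
    qed
    finally show ?thesis .
  qed
  show ?thesis
  proof
    assume L: "\<forall>v\<in>sheet_space I. \<forall>S'. ?E v S' = 0"
    show "\<forall>S\<in>sheets I. \<forall>S'\<in>sheets I. relation x I F S S' = 0"
    proof (intro ballI)
      fix S S' assume S: "S \<in> sheets I" "S' \<in> sheets I"
      have b: "(basis_vec S :: _ \<Rightarrow> 'k) \<in> sheet_space I"
        unfolding sheet_space_def by (rule basis_vec_in_span[OF S(1)])
      have "matrix_map (sheets I) (relation x I F) (basis_vec S) S' = ?E (basis_vec S) S'"
        using E[OF b, of S'] S(2) by (simp add: matrix_map_def)
      then show "relation x I F S S' = 0"
        using L b matrix_map_basis_vec[OF finite_sheets[OF I] S, of "relation x I F"] by simp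
    qed
  next
    assume R: "\<forall>S\<in>sheets I. \<forall>S'\<in>sheets I. relation x I F S S' = 0"
    then show "\<forall>v\<in>sheet_space I. \<forall>S'. ?E v S' = 0"
      using E by simp
  qed
qed

end

section \<open>The two bijections\<close>

context compatible_sheets
begin

lemma points_outside: "x \<in> points \<Longrightarrow> g \<notin> generators \<Longrightarrow> x g = 0"
  and points_degree: "x \<in> points \<Longrightarrow> g \<in> generators \<Longrightarrow> gen_deg g \<noteq> 0 \<Longrightarrow> x g = 0"
  unfolding points_def by blast+

text \<open>A word of nonzero degree contains a letter of nonzero degree, which evaluates to
  0.\<close>

lemma eval_word_degree:
  fixes x :: "'v set \<times> ('m, 'n) jet set \<times> ('m, 'n) jet set \<Rightarrow> 'k::field"
  assumes "\<And>g. g \<in> generators \<Longrightarrow> gen_deg g \<noteq> 0 \<Longrightarrow> x g = 0" "set w \<subseteq> generators" "word_deg gen_deg w \<noteq> 0"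
  shows "eval_word x w = 0"
proof -
  have "\<exists>g\<in>set w. gen_deg g \<noteq> 0"
  proof (rule ccontr)
    assume "\<not> ?thesis"
    then have "map gen_deg w = map (\<lambda>_. 0) w" by (intro map_cong) auto
    then have "word_deg gen_deg w = 0"
      unfolding word_deg_def by (simp only: sum_list_0)
    then show False using assms(3) by simp
  qed
  then obtain g where "g \<in> set w" "gen_deg g \<noteq> 0" by blast
  moreover from this have "x g = 0" using assms(1,2) by blast
  ultimately have "0 \<in> set (map x w)" by force
  then show ?thesis
    unfolding eval_word_def prod_list_zero_iff .
qed

lemma bij_augmentations:
  "bij_betw (\<lambda>x. restrict (eval_alg x) (free_algebra generators))
     (points :: ('v set \<times> ('m, 'n) jet set \<times> ('m, 'n) jet set \<Rightarrow> 'k::field) set) augmentations"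
proof (rule bij_betwI')
  fix x y :: "'v set \<times> ('m, 'n) jet set \<times> ('m, 'n) jet set \<Rightarrow> 'k"
  assume xy: "x \<in> points" "y \<in> points"
  show "restrict (eval_alg x) (free_algebra generators) = restrict (eval_alg y) (free_algebra generators) \<longleftrightarrow> x = y"
  proof
    assume eq: "restrict (eval_alg x) (free_algebra generators) = restrict (eval_alg y) (free_algebra generators)"
    have "x g = y g" for g
    proof (cases "g \<in> generators")
      case True
      then have "monomial [g] \<in> free_algebra generators" by (simp add: free_algebra_monomial)
      then have "eval_alg x (monomial [g]) = eval_alg y (monomial [g])"
        using fun_cong[OF eq, of "monomial [g]"] by simp
      then show ?thesis by (simp add: eval_alg_monomial eval_word_def)
    next
      case False
      then show ?thesis using xy by (simp add: points_outside)
    qed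
    then show "x = y" by blast
  qed simp
next
  fix x :: "'v set \<times> ('m, 'n) jet set \<times> ('m, 'n) jet set \<Rightarrow> 'k"
  assume x: "x \<in> points"
  have deg: "x g = 0" if "g \<in> generators" "gen_deg g \<noteq> 0" for g
    using x that by (rule points_degree)
  have "eval_alg x (gen_diff g) = 0" if "g \<in> generators" for g
  proof -
    obtain I S S' where "g = (I, S, S')" by (cases g)
    then show ?thesis
      using that x by (simp add: eval_gen_diff points_def generators_def)
  qed
  then have "eval_alg x (differential a) = 0" if "a \<in> free_algebra generators" for a
    unfolding differential_def using that by (intro eval_derivation_zero[of generators])
  moreover have "differential a \<in> free_algebra generators" if "a \<in> free_algebra generators" for a
    unfolding differential_def using that gen_diff_in_free_algebra
    by (intro derivation_in_free_algebra)
  moreover have "eval_alg x a = 0"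
    if "a \<in> free_algebra generators" "homogeneous gen_deg d a" "d \<noteq> 0" for a d
    unfolding eval_alg_def
  proof (intro sum.neutral ballI)
    fix w assume "w \<in> Poly_Mapping.keys a"
    then have "eval_word x (letters w) = 0"
      using that by (intro eval_word_degree[OF deg]) (auto simp: free_algebra_def homogeneous_def)
    then show "of_int (Poly_Mapping.lookup a w) * eval_word x (letters w) = 0" by simp
  qed
  ultimately show "restrict (eval_alg x) (free_algebra generators) \<in> augmentations"
    by (simp add: augmentations_def free_algebra_one free_algebra_add free_algebra_mult
        eval_alg_add eval_alg_mult) blast
next
  fix \<epsilon> :: "('v set \<times> ('m, 'n) jet set \<times> ('m, 'n) jet set) free_alg \<Rightarrow> 'k"
  assume \<epsilon>: "\<epsilon> \<in> augmentations"
  have ext: "\<epsilon> \<in> extensional (free_algebra generators)" and one: "\<epsilon> 1 = 1"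
    using \<epsilon> by (simp_all add: augmentations_def)
  have add: "\<epsilon> (a + b) = \<epsilon> a + \<epsilon> b" and mult: "\<epsilon> (a * b) = \<epsilon> a * \<epsilon> b"
    if "a \<in> free_algebra generators" "b \<in> free_algebra generators" for a b
    using \<epsilon> that by (simp_all add: augmentations_def)
  have diff: "\<epsilon> (differential a) = 0" if "a \<in> free_algebra generators" for a
    using \<epsilon> that by (simp add: augmentations_def)
  have deg: "\<epsilon> a = 0" if "a \<in> free_algebra generators" "homogeneous gen_deg d a" "d \<noteq> 0" for a d
    using \<epsilon> that unfolding augmentations_def mem_Collect_eq by blast
  define x where "x g = (if g \<in> generators then \<epsilon> (monomial [g]) else 0)" for g
  have eval: "\<epsilon> a = eval_alg x a" if "a \<in> free_algebra generators" for a
    by (rule hom_eq_eval_alg[OF one add mult _ that]) (simp_all add: x_def)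
  have gen: "monomial [g] \<in> free_algebra generators" if "g \<in> generators" for g
    using that by (simp add: free_algebra_monomial)
  have "x g = 0" if "g \<in> generators" "gen_deg g \<noteq> 0" for g
    using that deg[OF gen[OF that(1)], of "gen_deg g"]
    by (simp add: x_def homogeneous_def monomial_def word_deg_def)
  moreover have "relation x I I S S' = 0" if I: "I \<in> K" and S: "S \<in> sheets I" "S' \<in> sheets I" for I S S'
  \<comment> \<open>Where there is a generator, the augmentation equation holds up to an invertible
    sign; elsewhere the relation is automatic.\<close>
  proof (cases "above I S S'")
    case True
    then have g: "(I, S, S') \<in> generators" using I S by (simp add: generators_def)
    have "differential (monomial [(I, S, S')]) = gen_diff (I, S, S')"
      by (simp add: differential_def derivation_generator)
    then have "eval_alg x (gen_diff (I, S, S')) = 0"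
      using diff[OF gen[OF g]] eval[OF gen_diff_in_free_algebra] by simp
    then show ?thesis by (simp add: eval_gen_diff parity_sign_def split: if_splits)
  next
    case False
    then show ?thesis by (rule relation_above[OF I S])
  qed
  ultimately have "x \<in> points" by (simp add: points_def x_def)
  moreover have "\<epsilon> = restrict (eval_alg x) (free_algebra generators)"
    using ext eval by (intro extensionalityI[OF ext restrict_extensional]) simp
  ultimately show "\<exists>x\<in>points. \<epsilon> = restrict (eval_alg x) (free_algebra generators)" by blast
qed

lemma hom_mat_self:
  assumes I: "I \<in> K" and S: "S \<in> sheets I" "S' \<in> sheets I"
  shows "hom_mat x I I S S' = cell_mat x I S S' + (if cell_dim I = 1 \<and> S = S' then 1 else 0)"
  using face_mat_self[OF I S, where x = x] by (simp add: hom_mat_def)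

lemma chd_basis_vec:
  fixes x :: "'v set \<times> ('m, 'n) jet set \<times> ('m, 'n) jet set \<Rightarrow> 'k::field"
  assumes I: "I \<in> K" and S: "S \<in> sheets I" "S' \<in> sheets I"
  shows "chd x I (basis_vec S) S' = hom_mat x I I S S'"
proof -
  have b: "(basis_vec S :: _ \<Rightarrow> 'k) \<in> sheet_space I"
    unfolding sheet_space_def by (rule basis_vec_in_span[OF S(1)])
  show ?thesis
    unfolding chd_eq[OF I b] by (rule matrix_map_basis_vec[OF finite_sheets[OF I] S])
qed

lemma chd_in_CHDs:
  fixes x :: "'v set \<times> ('m, 'n) jet set \<times> ('m, 'n) jet set \<Rightarrow> 'k::field"
  assumes x: "x \<in> points"
  shows "chd x \<in> CHDs"
proof -
  have deg: "x g = 0" if "g \<in> generators" "gen_deg g \<noteq> 0" for g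
    using x that by (rule points_degree)
  have lin: "linear_endo (sheet_space I) f"
    if "\<And>v. v \<in> sheet_space I \<Longrightarrow> f v = matrix_map (sheets I) a v"
    for I and f :: "(('m, 'n) jet set \<Rightarrow> 'k) \<Rightarrow> (('m, 'n) jet set \<Rightarrow> 'k)"
      and a :: "('m, 'n) jet set \<Rightarrow> ('m, 'n) jet set \<Rightarrow> 'k"
    by (rule linear_endo_cong[OF that], assumption)
      (unfold sheet_space_def, simp_all add: linear_matrix_map span_space_add span_space_scale)
  have mat_deg: "has_degree (sheet_space I) sheet_deg (1 - int (cell_dim F)) (matrix_map (sheets I) (hom_mat x I F))"
    if I: "I \<in> K" and F: "F \<subseteq> I" "F \<noteq> {}" for I F
    unfolding sheet_space_def by (rule has_degree_matrix_map) (rule hom_mat_degree[OF deg I F])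
  have "simplex_diagram I (sheet_space I) sheet_deg (\<lambda>F. bdry_extension I F (chd x F))" if I: "I \<in> K" for I
    unfolding simplex_diagram_def
  proof (intro allI impI)
    fix F assume "F \<subseteq> I \<and> F \<noteq> {}"
    then have F: "F \<subseteq> I" "F \<noteq> {}" by simp_all
    have be: "bdry_extension I F (chd x F) v = matrix_map (sheets I) (hom_mat x I F) v"
      if "v \<in> sheet_space I" for v
      by (rule bdry_extension_eq[OF I F that chd_eq[OF face_in_complex[OF I F]], where x = x])
    have "linear_endo (sheet_space I) (bdry_extension I F (chd x F))"
      by (rule lin[OF be])
    moreover have "has_degree (sheet_space I) sheet_deg (1 - int (cell_dim F)) (bdry_extension I F (chd x F))"
      by (rule has_degree_cong[OF be mat_deg[OF I F]])
    moreover have "relation x I F S S' = 0" if S: "S \<in> sheets I" "S' \<in> sheets I" for S S'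
    \<comment> \<open>Between sheets that persist above \<open>F\<close> this is the equation
      imposed at the cell \<open>F\<close>; the other entries hold without any equation.\<close>
    proof (cases "face_component F S \<in> sheets F \<and> face_component F S' \<in> sheets F")
      case True
      then show ?thesis
        using relation_face[OF I F S, where x = x] x face_in_complex[OF I F] by (simp add: points_def)
    next
      case False
      then show ?thesis by (rule relation_remaining[OF I F S])
    qed
    then have "\<forall>v\<in>sheet_space I. \<forall>S'.
      (\<Sum>k\<in>{0<..<cell_dim F}. (- 1) ^ (k + 1) * bdry_extension I (omit_face F k) (chd x (omit_face F k)) v S') +
      (\<Sum>k\<le>cell_dim F. (- 1) ^ k * bdry_extension I (back_face F k) (chd x (back_face F k))
         (bdry_extension I (front_face F k) (chd x (front_face F k)) v) S') = 0"
      using simplex_relation_iff[OF I F chd_eq[where x = x]] by blast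
    ultimately show "linear_endo (sheet_space I) (bdry_extension I F (chd x F)) \<and>
      has_degree (sheet_space I) sheet_deg (1 - int (cell_dim F)) (bdry_extension I F (chd x F)) \<and>
      (\<forall>v\<in>sheet_space I. \<forall>S'.
      (\<Sum>k\<in>{0<..<cell_dim F}. (- 1) ^ (k + 1) * bdry_extension I (omit_face F k) (chd x (omit_face F k)) v S') +
      (\<Sum>k\<le>cell_dim F. (- 1) ^ k * bdry_extension I (back_face F k) (chd x (back_face F k))
         (bdry_extension I (front_face F k) (chd x (front_face F k)) v) S') = 0)" by blast
  qed
  moreover have "linear_endo (sheet_space I) (chd x I)" if I: "I \<in> K" for I
    by (rule lin[OF chd_eq[OF I]])
  moreover have "has_degree (sheet_space I) sheet_deg (1 - int (cell_dim I)) (chd x I)" if I: "I \<in> K" for I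
    by (rule has_degree_cong[OF chd_eq[OF I] mat_deg[OF I order_refl simplex_nonempty[OF I]]])
  \<comment> \<open>The conditional subtraction treats edges and all other cells in one
    statement.\<close>
  moreover have "strictly_lower_triangular I (\<lambda>v S. chd x I v S - (if cell_dim I = 1 then v S else 0))"
    if I: "I \<in> K" for I
    unfolding strictly_lower_triangular_def
  proof (intro ballI)
    fix S assume S: "S \<in> sheets I"
    have b: "(basis_vec S :: _ \<Rightarrow> 'k) \<in> sheet_space I"
      unfolding sheet_space_def by (rule basis_vec_in_span[OF S])
    have "chd x I (basis_vec S) S' - (if cell_dim I = 1 then basis_vec S S' else 0) = 0"
      if S': "\<not> (S' \<in> sheets I \<and> above I S S')" for S'
    proof (cases "S' \<in> sheets I")
      case True
      then have "cell_mat x I S S' = 0" using S' by (simp add: cell_mat_def generators_def)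
      then show ?thesis
        unfolding chd_basis_vec[OF I S True] hom_mat_self[OF I S True] by (auto simp: basis_vec_def)
    next
      case False
      then have "S' \<noteq> S" using S by blast
      then show ?thesis
        unfolding chd_eq[OF I b] using False by (simp add: matrix_map_def basis_vec_def)
    qed
    then show "(\<lambda>S'. chd x I (basis_vec S) S' - (if cell_dim I = 1 then basis_vec S S' else 0))
      \<in> span_space {S' \<in> sheets I. above I S S'}"
      unfolding span_space_def by simp
  qed
  then have "if cell_dim I = 1 then strictly_lower_triangular I (\<lambda>v S. chd x I v S - v S)
      else strictly_lower_triangular I (chd x I)" if "I \<in> K" for I
    using that by (cases "cell_dim I = 1") force+
  moreover have "chd x \<in> extensional K" "\<And>I. I \<in> K \<Longrightarrow> chd x I \<in> extensional (sheet_space I)"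
    by (simp_all add: chd_def)
  ultimately show ?thesis
    unfolding CHDs_def by (intro CollectI conjI ballI)
qed

lemma CHD_is_chd:
  fixes c :: "'v set \<Rightarrow> (('m, 'n) jet set \<Rightarrow> 'k::field) \<Rightarrow> (('m, 'n) jet set \<Rightarrow> 'k)"
  assumes "c \<in> CHDs"
  shows "\<exists>x\<in>points. c = chd x"
proof -
  have ext: "c \<in> extensional K"
    and extI: "\<And>I. I \<in> K \<Longrightarrow> c I \<in> extensional (sheet_space I)"
    and lin: "\<And>I. I \<in> K \<Longrightarrow> linear_endo (sheet_space I) (c I)"
    and deg: "\<And>I. I \<in> K \<Longrightarrow> has_degree (sheet_space I) sheet_deg (1 - int (cell_dim I)) (c I)"
    and tri1: "\<And>I. I \<in> K \<Longrightarrow> cell_dim I = 1 \<Longrightarrow> strictly_lower_triangular I (\<lambda>v S. c I v S - v S)"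
    and tri2: "\<And>I. I \<in> K \<Longrightarrow> cell_dim I \<noteq> 1 \<Longrightarrow> strictly_lower_triangular I (c I)"
    and dia: "\<And>I. I \<in> K \<Longrightarrow> simplex_diagram I (sheet_space I) sheet_deg (\<lambda>F. bdry_extension I F (c F))"
    using assms by (auto simp: CHDs_def split: if_splits)
  define x where "x g = (case g of (I, S, S') \<Rightarrow> if g \<in> generators then c I (basis_vec S) S' else 0)" for g
  have entry: "c I (basis_vec S) S' = hom_mat x I I S S'"
    if I: "I \<in> K" and S: "S \<in> sheets I" "S' \<in> sheets I" for I S S'
  proof (cases "above I S S'")
    case True
    then have "S \<noteq> S'" "(I, S, S') \<in> generators"
      using above_irrefl[OF I] I S by (auto simp: generators_def)
    then show ?thesis unfolding hom_mat_self[OF I S] by (simp add: cell_mat_def x_def)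
  next
    \<comment> \<open>Where there is no generator, triangularity leaves no freedom: the entry is 0,
      or that of the identity for an edge.\<close>
    case False
    have "c I (basis_vec S) S' = (if cell_dim I = 1 \<and> S = S' then 1 else 0)"
    proof (cases "cell_dim I = 1")
      case True
      then have "(\<lambda>S'. c I (basis_vec S) S' - basis_vec S S') \<in> span_space {S' \<in> sheets I. above I S S'}"
        using tri1[OF I] S(1) unfolding strictly_lower_triangular_def by blast
      then have "c I (basis_vec S) S' - basis_vec S S' = 0"
        using False unfolding span_space_def by simp
      then show ?thesis using True by (auto simp: basis_vec_def)
    next
      case dim: False
      then have "c I (basis_vec S) \<in> span_space {S' \<in> sheets I. above I S S'}"
        using tri2[OF I] S(1) unfolding strictly_lower_triangular_def by blast
      then show ?thesis
        using False dim unfolding span_space_def by simp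
    qed
    moreover have "cell_mat x I S S' = 0" using False by (simp add: cell_mat_def generators_def)
    ultimately show ?thesis unfolding hom_mat_self[OF I S] by simp
  qed
  have mat: "c I v = matrix_map (sheets I) (hom_mat x I I) v" if I: "I \<in> K" and v: "v \<in> sheet_space I" for I v
  proof -
    have "c I v = matrix_map (sheets I) (\<lambda>S S'. c I (basis_vec S) S') v"
      using linear_eq_matrix_map[OF finite_sheets[OF I]] lin[OF I] v unfolding sheet_space_def by blast
    also have "\<dots> = matrix_map (sheets I) (hom_mat x I I) v"
      unfolding matrix_map_def using entry[OF I] by (auto intro!: sum.cong)
    finally show ?thesis .
  qed
  have "x g = 0" if g: "g \<in> generators" and d: "gen_deg g \<noteq> 0" for g
  proof (rule ccontr)
    assume nz: "x g \<noteq> 0"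
    obtain I S S' where gS: "g = (I, S, S')" by (cases g)
    have I: "I \<in> K" and S: "S \<in> sheets I" using g gS by (simp_all add: generators_def)
    have "(basis_vec S :: _ \<Rightarrow> 'k) \<in> graded_part (sheet_space I) sheet_deg (sheet_deg S)"
      using basis_vec_in_span[OF S] by (auto simp: graded_part_def sheet_space_def basis_vec_def)
    then have "c I (basis_vec S) \<in> graded_part (sheet_space I) sheet_deg (sheet_deg S + (1 - int (cell_dim I)))"
      using deg[OF I] unfolding has_degree_def by blast
    moreover have "c I (basis_vec S) S' \<noteq> 0" using nz gS g by (simp add: x_def)
    ultimately have "sheet_deg S' = sheet_deg S + (1 - int (cell_dim I))"
      by (simp add: graded_part_def)
    then show False using d gS by (simp add: gen_deg_def sheet_deg_def)
  qed
  \<comment> \<open>The equation at \<open>I\<close> is the relation of the top face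
    \<open>F = I\<close> of its simplex diagram.\<close>
  moreover have "relation x I I S S' = 0" if I: "I \<in> K" and S: "S \<in> sheets I" "S' \<in> sheets I" for I S S'
    using simplex_relation_iff[OF I order_refl simplex_nonempty[OF I] mat] S dia[OF I] simplex_nonempty[OF I]
    unfolding simplex_diagram_def by blast
  moreover have "x g = 0" if "g \<notin> generators" for g
    using that by (cases g) (simp add: x_def)
  ultimately have "x \<in> points" by (simp add: points_def)
  moreover have "c = chd x"
  proof (rule extensionalityI[OF ext])
    show "chd x \<in> extensional K" by (simp add: chd_def)
    fix I assume I: "I \<in> K"
    show "c I = chd x I"
    proof (rule extensionalityI[OF extI[OF I]])
      show "chd x I \<in> extensional (sheet_space I)" using I by (simp add: chd_def)
      show "c I v = chd x I v" if "v \<in> sheet_space I" for v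
        using mat[OF I that] chd_eq[OF I that] by simp
    qed
  qed
  ultimately show ?thesis by blast
qed

lemma bij_CHDs:
  "bij_betw chd (points :: ('v set \<times> ('m, 'n) jet set \<times> ('m, 'n) jet set \<Rightarrow> 'k::field) set) CHDs"
proof (rule bij_betwI')
  fix x y :: "'v set \<times> ('m, 'n) jet set \<times> ('m, 'n) jet set \<Rightarrow> 'k"
  assume xy: "x \<in> points" "y \<in> points"
  show "chd x = chd y \<longleftrightarrow> x = y"
  proof
    assume eq: "chd x = chd y"
    have "x g = y g" for g
    proof (cases "g \<in> generators")
      case True
      obtain I S S' where g: "g = (I, S, S')" by (cases g)
      have I: "I \<in> K" and S: "S \<in> sheets I" "S' \<in> sheets I"
        using True g by (simp_all add: generators_def)
      have "hom_mat x I I S S' = hom_mat y I I S S'"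
        using chd_basis_vec[OF I S, of x] chd_basis_vec[OF I S, of y] eq by simp
      then show ?thesis
        unfolding hom_mat_self[OF I S] using True g by (simp add: cell_mat_def)
    next
      case False
      then show ?thesis using xy by (simp add: points_outside)
    qed
    then show "x = y" by blast
  qed simp
qed (use chd_in_CHDs CHD_is_chd in blast)+

text \<open>The bijection is explicit: take the values of the augmentation on the generators, insert
  the identities on edges, and read the matrices as linear maps.\<close>

lemma bij_augmentations_CHDs:
  "\<exists>\<Phi>. bij_betw \<Phi>
    (augmentations :: (('v set \<times> ('m, 'n) jet set \<times> ('m, 'n) jet set) free_alg \<Rightarrow> 'k::field) set)
    (CHDs :: ('v set \<Rightarrow> (('m, 'n) jet set \<Rightarrow> 'k) \<Rightarrow> (('m, 'n) jet set \<Rightarrow> 'k)) set)"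
  using bij_betw_trans[OF bij_betw_inv_into[OF bij_augmentations] bij_CHDs] by blast

end

theorem proposition5p8:
  fixes M :: "'m topology"
    and A :: "('m, 'n::finite) chart set"
    and \<Lambda> C :: "('m, 'n) jet set"
    and \<mu> :: "('m, 'n) jet \<Rightarrow> int"
    and K :: "'v::linorder set set"
    and h :: "('v \<Rightarrow> real) \<Rightarrow> 'm"
  assumes "smooth_manifold M A"
    and "closed_legendrian M A \<Lambda>"
    and "mild_front_singularities M A \<Lambda> C"
    and "maslov_potential M A \<Lambda> C \<mu>"
    and "simplicial_decomposition M K h"
    and "sheet_data.compatible M A \<Lambda> C K h"
  shows "\<exists>\<Phi>. bij_betw \<Phi>
    (sheet_data.augmentations M A \<Lambda> C \<mu> K h ::
       (('v set \<times> ('m, 'n) jet set \<times> ('m, 'n) jet set) free_alg \<Rightarrow> 'k::field) set)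
    (sheet_data.CHDs M A \<Lambda> C \<mu> K h ::
       ('v set \<Rightarrow> (('m, 'n) jet set \<Rightarrow> 'k) \<Rightarrow> (('m, 'n) jet set \<Rightarrow> 'k)) set)"
proof -
  interpret compatible_sheets M A \<Lambda> C \<mu> K h
    using assms by unfold_locales
  show ?thesis by (rule bij_augmentations_CHDs)
qed

end
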